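(* With the notation fixed in the context, let $(W,\theta)$ be a 2-relative cluster family of $\pi$. The scheme $W_{\mathrm{red}}$ is a closed subscheme of the schematic union $W'+W_E$ of $W'$ and $W_E$ in $W$. In particular, the underlying topological spaces of $X'+X_E^{\mathrm{c}}$ (schematic union in $X_1^{\mathrm{c}}$) and $X_1^{\mathrm{c}}$ are homeomorphic.
   Context: Work over a base field $\Bbbk$; all unadorned products are over $\Bbbk$. Let $\pi\colon\mathcal{S}\to B$ be a morphism of $\Bbbk$-schemes with $\mathcal{S}$ piecewise quasiprojective (a disjoint union of quasiprojective schemes) and $B$ projective and integral. A section family of a morphism $\mathcal{T}\to B$ is a couple $(W,\theta)$ with $W$ a $\Bbbk$-scheme and $\theta\colon B\times W\to\mathcal{T}$ a $B$-morphism. It is the universal section family if for every section family $(V,\sigma)$ there is a unique morphism $f\colon V\to W$ with $\sigma=\theta\circ(\mathrm{Id}_B\times f)$. Let $(X,\psi)$ be the universal section family of $\pi$ (it exists). Let $\mathcal{S}_0=\mathcal{S}\times X$, $\pi_0=\pi\times\mathrm{Id}_X\colon\mathcal{S}_0\to B\times X$, $p\colon B\times X\to B$ the projection, $\iota$ the automorphism of $B\times X\times X$ exchanging the second and third factors, and $\psi_0=(\psi\times\mathrm{Id}_X)\circ\iota\colon B\times X\times X\to\mathcal{S}_0$. Let $\Delta\subseteq\mathcal{S}_0$ be the image of the section $\psi\times_X\mathrm{Id}_X\colon B\times X\to\mathcal{S}\times X$ of $\pi_0$ (i.e. $(\beta,x)\mapsto(\psi(\beta,x),x)$). Let $\mathcal{S}_1$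 be the blow up of $\mathcal{S}_0$ along $\Delta$, $E$ its exceptional divisor, $\pi_1\colon\mathcal{S}_1\to B\times X$ the composition of the blow up morphism with $\pi_0$, and $q_1\colon\mathcal{S}_1\to X$ the composition of the blow up morphism with the projection $\mathcal{S}_0\to X$. A morphism $u\colon P\to Q$ is constant along the fibres of $v\colon P\to R$ if $u\circ r_1=u\circ r_2$, where $r_1,r_2\colon P\times_R P\to P$ are the projections. A 2-relative cluster family of $\pi$ is a section family $(W,\theta)$ of $p\circ\pi_1\colon\mathcal{S}_1\to B$ such that $q_1\circ\theta$ is constant along the fibres of the projection $B\times W\to W$. For such a family put $E_W=\theta^{-1}(E)$, a locally principal closed subscheme of $B\times W$. $W'$ denotes the closed subscheme of $W$ for which $B\times W'\hookrightarrow B\times W$ is the blow up of $B\times W$ along $E_W$. $W_E$ denotes the closed subscheme of $W$ such that a morphism $T\to W$ factorises through $W_E$ if and only if the base change of $E_W\hookrightarrow B\times W$ by $T\to W$ is an isomorphism. The schematic union of closed subschemes with ideals $\mathscr{I}_1,\mathscr{I}_2$ is the closed subscheme with ideal $\mathscr{I}_1\cap\mathscr{I}_2$. $(X_1,\psi_1)$ is the universal section family of $p\circ\pi_1\colon\mathcal{S}_1\to B$. $X_1^{\mathrm{c}}$ is the closed subscheme of $X_1$ such that a morphism $T\to X_1$ factorises through $X_1^{\mathrm{c}}$ if and only if the restriction of $q_1\circ\psi_1$ to $B\times T$ is constant along the fibres of $B\times T\to T$; with $\psi^{\mathrm{c}}=\psi_1|_{B\times X_1^{\mathrm{c}}}$,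 the couple $(X_1^{\mathrm{c}},\psi^{\mathrm{c}})$ is a 2-relative cluster family, and every 2-relative cluster family is obtained from it by a unique morphism to $X_1^{\mathrm{c}}$. $X_E^{\mathrm{c}}$ denotes $W_E$ for $(W,\theta)=(X_1^{\mathrm{c}},\psi^{\mathrm{c}})$. $(X',b)$ is the blow up split section family of the projection $B\times X\times X\to B$ along $(\psi_0)^{-1}(\Delta)$: $b\colon X'\to X\times X$ is such that the pullback of $(\psi_0)^{-1}(\Delta)$ by $\mathrm{Id}_B\times b$ is an effective Cartier divisor of $B\times X'$, and every $g\colon T\to X\times X$ for which the pullback of $(\psi_0)^{-1}(\Delta)$ by $\mathrm{Id}_B\times g$ is an effective Cartier divisor of $B\times T$ factors uniquely through $b$. Let $b'\colon B\times X'\to\mathcal{S}_1$ be the unique morphism whose composition with the blow up morphism $\mathcal{S}_1\to\mathcal{S}_0$ is $\psi_0\circ(\mathrm{Id}_B\times b)$. Then $(X',b')$ is a 2-relative cluster family and the corresponding morphism $X'\to X_1^{\mathrm{c}}$ is a closed embedding, through which $X'$ is regarded as a closed subscheme of $X_1^{\mathrm{c}}$ (it coincides with $W'$ for $W=X_1^{\mathrm{c}}$).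
   Formalization: B is additionally assumed geometrically reduced over the base field; for B merely integral the claim fails, e.g. B = Spec K purely inseparable over k, S the affine line over K, W = Spec K, with two sections differing by a nonzero nilpotent. *)

theory Defs
  imports
    "HOL-Analysis.Abstract_Topology"
    "HOL-Algebra.Ideal"
    "HOL-Algebra.RingHom"
    "HOL-Library.Multiset"
    "HOL-Library.Infinite_Typeclass"
begin

text \<open>
  Schemes, in the sense of Hartshorne, Chapter II.

  A sheaf of rings is stored as the sheaf of sections of its espace etale: there is a ring
  \<open>stalk X x\<close> for each point \<open>x\<close>, and the sections over an open \<open>U\<close> are extensional functions
  sending \<open>x \<in> U\<close> to an element of \<open>stalk X x\<close>, with pointwise operations.  Every sheaf is
  canonically of this form.  The advantage here is that only the stalks have to fit into the type
  \<open>'s\<close>; rings of sections (which may be large, for instance on infinite disjoint unions) need not.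

  Universal properties quantify over schemes with points in one type \<open>'p\<close> and stalks in
  one type \<open>'s\<close>.  With \<open>'p = 'a set\<close>, \<open>'s = 'a\<close> and \<open>'a\<close> infinite, this class of schemes is (up to
  isomorphism) closed under open and closed subschemes, fibre products and blow-ups, because the
  local rings of these constructions have at most \<open>|'a|\<close> elements and at most \<open>2 ^ |'a|\<close> points lie
  over each given tuple of points.  Since \<open>'a\<close> is arbitrary, it can be chosen to
  accommodate any given set of schemes.
\<close>

section \<open>Locally ringed spaces and their morphisms\<close>

record ('p, 's) lrs =
  sp :: "'p topology"
  stalk :: "'p \<Rightarrow> 's ring"
  sect :: "'p set \<Rightarrow> ('p \<Rightarrow> 's) set"

abbreviation pts :: "('p, 's) lrs \<Rightarrow> 'p set"
  where "pts X \<equiv> topspace (sp X)"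

definition local_ring :: "'s ring \<Rightarrow> bool"
  where "local_ring R \<longleftrightarrow> cring R \<and> (\<exists>!M. maximalideal M R)"

definition section_ring :: "('p, 's) lrs \<Rightarrow> 'p set \<Rightarrow> ('p \<Rightarrow> 's) ring"
  where "section_ring X U =
    \<lparr>carrier = sect X U,
     monoid.mult = (\<lambda>s t. \<lambda>x\<in>U. s x \<otimes>\<^bsub>stalk X x\<^esub> t x),
     one = (\<lambda>x\<in>U. \<one>\<^bsub>stalk X x\<^esub>),
     zero = (\<lambda>x\<in>U. \<zero>\<^bsub>stalk X x\<^esub>),
     add = (\<lambda>s t. \<lambda>x\<in>U. s x \<oplus>\<^bsub>stalk X x\<^esub> t x)\<rparr>"

text \<open>
  The last two conditions of the following definition say that \<open>stalk X x\<close> is the colimit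
  of the rings \<open>sect X U\<close> over the open neighbourhoods \<open>U\<close> of \<open>x\<close>.
\<close>

definition locally_ringed_space :: "('p, 's) lrs \<Rightarrow> bool"
  where "locally_ringed_space X \<longleftrightarrow>
    (\<forall>x\<in>pts X. local_ring (stalk X x)) \<and>
    (\<forall>U. openin (sp X) U \<longrightarrow>
        sect X U \<subseteq> (\<Pi>\<^sub>E x\<in>U. carrier (stalk X x)) \<and> cring (section_ring X U)) \<and>
    (\<forall>U V s. openin (sp X) U \<and> openin (sp X) V \<and> V \<subseteq> U \<and> s \<in> sect X U \<longrightarrow>
        restrict s V \<in> sect X V) \<and>
    (\<forall>U s. openin (sp X) U \<and> s \<in> (\<Pi>\<^sub>E x\<in>U. carrier (stalk X x)) \<and>
        (\<forall>x\<in>U. \<exists>V. openin (sp X) V \<and> x \<in> V \<and> V \<subseteq> U \<and> restrict s V \<in> sect X V) \<longrightarrow>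
        s \<in> sect X U) \<and>
    (\<forall>x\<in>pts X. \<forall>a\<in>carrier (stalk X x).
        \<exists>U s. openin (sp X) U \<and> x \<in> U \<and> s \<in> sect X U \<and> s x = a) \<and>
    (\<forall>U s t x. openin (sp X) U \<and> s \<in> sect X U \<and> t \<in> sect X U \<and> x \<in> U \<and> s x = t x \<longrightarrow>
        (\<exists>V. openin (sp X) V \<and> x \<in> V \<and> V \<subseteq> U \<and> restrict s V = restrict t V))"

definition open_sub :: "('p, 's) lrs \<Rightarrow> 'p set \<Rightarrow> ('p, 's) lrs"
  where "open_sub X U = X\<lparr>sp := subtopology (sp X) U\<rparr>"

text \<open>
  For a point \<open>x\<close> of the source, \<open>smap f x\<close> is the map
  \<open>stalk (tgt f) (pmap f x) \<Rightarrow> stalk (src f) x\<close>.  All components are extensional, so that equality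
  of morphisms is equality of records.
\<close>

record ('p, 's, 'q, 't) mor =
  src :: "('p, 's) lrs"
  tgt :: "('q, 't) lrs"
  pmap :: "'p \<Rightarrow> 'q"
  smap :: "'p \<Rightarrow> 't \<Rightarrow> 's"

definition is_mor :: "('p, 's, 'q, 't) mor \<Rightarrow> bool"
  where "is_mor f \<longleftrightarrow>
    locally_ringed_space (src f) \<and> locally_ringed_space (tgt f) \<and>
    continuous_map (sp (src f)) (sp (tgt f)) (pmap f) \<and>
    pmap f \<in> extensional (pts (src f)) \<and> smap f \<in> extensional (pts (src f)) \<and>
    (\<forall>x\<in>pts (src f).
        smap f x \<in> ring_hom (stalk (tgt f) (pmap f x)) (stalk (src f) x) \<and>
        smap f x \<in> extensional (carrier (stalk (tgt f) (pmap f x))) \<and>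
        (\<forall>a\<in>carrier (stalk (tgt f) (pmap f x)).
            smap f x a \<in> Units (stalk (src f) x) \<longrightarrow> a \<in> Units (stalk (tgt f) (pmap f x)))) \<and>
    (\<forall>V s. openin (sp (tgt f)) V \<and> s \<in> sect (tgt f) V \<longrightarrow>
        (\<lambda>x\<in>{x \<in> pts (src f). pmap f x \<in> V}. smap f x (s (pmap f x)))
          \<in> sect (src f) {x \<in> pts (src f). pmap f x \<in> V})"

definition id_mor :: "('p, 's) lrs \<Rightarrow> ('p, 's, 'p, 's) mor"
  where "id_mor X =
    \<lparr>src = X, tgt = X, pmap = (\<lambda>x\<in>pts X. x),
     smap = (\<lambda>x\<in>pts X. \<lambda>a\<in>carrier (stalk X x). a)\<rparr>"

definition comp_mor ::
  "('q, 't, 'r, 'u) mor \<Rightarrow> ('p, 's, 'q, 't) mor \<Rightarrow> ('p, 's, 'r, 'u) mor"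
    (infixl \<open>\<circ>\<^sub>s\<close> 55)
  where "g \<circ>\<^sub>s f =
    \<lparr>src = src f, tgt = tgt g, pmap = (\<lambda>x\<in>pts (src f). pmap g (pmap f x)),
     smap = (\<lambda>x\<in>pts (src f). \<lambda>a\<in>carrier (stalk (tgt g) (pmap g (pmap f x))).
               smap f x (smap g (pmap f x) a))\<rparr>"

definition open_restrict :: "('p, 's, 'q, 't) mor \<Rightarrow> 'p set \<Rightarrow> ('p, 's, 'q, 't) mor"
  where "open_restrict f U =
    f\<lparr>src := open_sub (src f) U, pmap := restrict (pmap f) U, smap := restrict (smap f) U\<rparr>"

definition is_iso :: "('p, 's, 'q, 't) mor \<Rightarrow> bool"
  where "is_iso f \<longleftrightarrow> is_mor f \<and>
    (\<exists>g. is_mor g \<and> src g = tgt f \<and> tgt g = src f \<and>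
         g \<circ>\<^sub>s f = id_mor (src f) \<and> f \<circ>\<^sub>s g = id_mor (tgt f))"

definition isomorphic :: "('p, 's) lrs \<Rightarrow> ('q, 't) lrs \<Rightarrow> bool"
  where "isomorphic X Y \<longleftrightarrow> (\<exists>f. is_iso f \<and> src f = X \<and> tgt f = Y)"


section \<open>Spectra and projective spaces\<close>

text \<open>
  Fractions \<open>a / f\<close>, where the pair \<open>(a, f)\<close> runs over a set \<open>D\<close> of admissible pairs and
  \<open>a / f = b / g\<close> means \<open>h (g a - f b) = 0\<close> for some admissible denominator \<open>h\<close>.  For Spec, \<open>D\<close> is
  \<open>R \<times> (R - P)\<close>; for Proj, numerator and denominator must be homogeneous of the same degree.
\<close>

definition fraction :: "'r ring \<Rightarrow> ('r \<times> 'r) set \<Rightarrow> 'r \<times> 'r \<Rightarrow> ('r \<times> 'r) set"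
  where "fraction R D af =
    {bg \<in> D. \<exists>h \<in> snd ` D.
       h \<otimes>\<^bsub>R\<^esub> (snd bg \<otimes>\<^bsub>R\<^esub> fst af \<ominus>\<^bsub>R\<^esub> snd af \<otimes>\<^bsub>R\<^esub> fst bg) = \<zero>\<^bsub>R\<^esub>}"

definition fraction_ring :: "'r ring \<Rightarrow> ('r \<times> 'r) set \<Rightarrow> ('r \<times> 'r) set ring"
  where "fraction_ring R D =
    \<lparr>carrier = fraction R D ` D,
     monoid.mult = (\<lambda>x y. \<Union>(a, f)\<in>x. \<Union>(b, g)\<in>y. fraction R D (a \<otimes>\<^bsub>R\<^esub> b, f \<otimes>\<^bsub>R\<^esub> g)),
     one = fraction R D (\<one>\<^bsub>R\<^esub>, \<one>\<^bsub>R\<^esub>),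
     zero = fraction R D (\<zero>\<^bsub>R\<^esub>, \<one>\<^bsub>R\<^esub>),
     add = (\<lambda>x y. \<Union>(a, f)\<in>x. \<Union>(b, g)\<in>y.
              fraction R D (g \<otimes>\<^bsub>R\<^esub> a \<oplus>\<^bsub>R\<^esub> f \<otimes>\<^bsub>R\<^esub> b, f \<otimes>\<^bsub>R\<^esub> g))\<rparr>"

text \<open>
  A set \<open>Ps\<close> of primes of \<open>R\<close> with the topology whose basic open sets are
  \<open>{P \<in> Ps. f \<notin> P}\<close> for \<open>f \<in> B\<close>, and the sheaf of functions that are locally fractions.
\<close>

definition fraction_space ::
  "'r ring \<Rightarrow> 'r set set \<Rightarrow> 'r set \<Rightarrow> ('r set \<Rightarrow> ('r \<times> 'r) set) \<Rightarrow> ('r set, ('r \<times> 'r) set) lrs"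
  where "fraction_space R Ps B D =
    (let T = topology_generated_by ((\<lambda>f. {P \<in> Ps. f \<notin> P}) ` B) in
     \<lparr>sp = T,
      stalk = (\<lambda>P. fraction_ring R (D P)),
      sect = (\<lambda>U. {s \<in> (\<Pi>\<^sub>E P\<in>U. carrier (fraction_ring R (D P))).
                \<forall>P\<in>U. \<exists>V af. openin T V \<and> P \<in> V \<and> V \<subseteq> U \<and>
                  (\<forall>Q\<in>V. af \<in> D Q \<and> s Q = fraction R (D Q) af)})\<rparr>)"

definition Spec :: "'r ring \<Rightarrow> ('r set, ('r \<times> 'r) set) lrs"
  where "Spec R =
    fraction_space R {P. primeideal P R} (carrier R) (\<lambda>P. carrier R \<times> (carrier R - P))"

text \<open>The polynomial ring over \<open>k\<close> in the variables \<open>0, \<dots>, n\<close>; monomials are multisets.\<close>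

definition poly_const :: "'r ring \<Rightarrow> 'r \<Rightarrow> nat multiset \<Rightarrow> 'r"
  where "poly_const k a = (\<lambda>m. if m = {#} then a else \<zero>\<^bsub>k\<^esub>)"

definition poly_var :: "'r ring \<Rightarrow> nat \<Rightarrow> nat multiset \<Rightarrow> 'r"
  where "poly_var k i = (\<lambda>m. if m = {#i#} then \<one>\<^bsub>k\<^esub> else \<zero>\<^bsub>k\<^esub>)"

definition poly_ring :: "'r ring \<Rightarrow> nat \<Rightarrow> (nat multiset \<Rightarrow> 'r) ring"
  where "poly_ring k n =
    \<lparr>carrier = {p. (\<forall>m. p m \<in> carrier k) \<and> finite {m. p m \<noteq> \<zero>\<^bsub>k\<^esub>} \<and>
                   (\<forall>m. p m \<noteq> \<zero>\<^bsub>k\<^esub> \<longrightarrow> set_mset m \<subseteq> {..n})},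
     monoid.mult = (\<lambda>p q m. \<Oplus>\<^bsub>k\<^esub> a\<in>{a. a \<subseteq># m}. p a \<otimes>\<^bsub>k\<^esub> q (m - a)),
     one = poly_const k \<one>\<^bsub>k\<^esub>,
     zero = poly_const k \<zero>\<^bsub>k\<^esub>,
     add = (\<lambda>p q m. p m \<oplus>\<^bsub>k\<^esub> q m)\<rparr>"

definition homogeneous :: "'r ring \<Rightarrow> nat \<Rightarrow> nat \<Rightarrow> (nat multiset \<Rightarrow> 'r) set"
  where "homogeneous k n d =
    {p \<in> carrier (poly_ring k n). \<forall>m. p m \<noteq> \<zero>\<^bsub>k\<^esub> \<longrightarrow> size m = d}"

definition homogeneous_part :: "'r ring \<Rightarrow> nat \<Rightarrow> (nat multiset \<Rightarrow> 'r) \<Rightarrow> nat multiset \<Rightarrow> 'r"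
  where "homogeneous_part k d p = (\<lambda>m. if size m = d then p m else \<zero>\<^bsub>k\<^esub>)"

type_synonym 'r pspace =
  "((nat multiset \<Rightarrow> 'r) set, ((nat multiset \<Rightarrow> 'r) \<times> (nat multiset \<Rightarrow> 'r)) set) lrs"

definition proj_fractions ::
  "'r ring \<Rightarrow> nat \<Rightarrow> (nat multiset \<Rightarrow> 'r) set \<Rightarrow>
    ((nat multiset \<Rightarrow> 'r) \<times> (nat multiset \<Rightarrow> 'r)) set"
  where "proj_fractions k n P = (\<Union>d. homogeneous k n d \<times> (homogeneous k n d - P))"

text \<open>\<open>Proj k[x\<^sub>0, \<dots>, x\<^sub>n]\<close>: homogeneous primes not containing all the variables.\<close>

definition proj_space :: "'r ring \<Rightarrow> nat \<Rightarrow> 'r pspace"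
  where "proj_space k n =
    fraction_space (poly_ring k n)
      {P. primeideal P (poly_ring k n) \<and> (\<forall>p\<in>P. \<forall>d. homogeneous_part k d p \<in> P) \<and>
          (\<exists>i\<le>n. poly_var k i \<notin> P)}
      (\<Union>d. homogeneous k n d)
      (proj_fractions k n)"

definition proj_space_str ::
  "'r ring \<Rightarrow> nat \<Rightarrow> ((nat multiset \<Rightarrow> 'r) set,
     ((nat multiset \<Rightarrow> 'r) \<times> (nat multiset \<Rightarrow> 'r)) set, 'r set, ('r \<times> 'r) set) mor"
  where "proj_space_str k n =
    (let c = poly_const k; pre = (\<lambda>P. {a \<in> carrier k. c a \<in> P}) in
     \<lparr>src = proj_space k n, tgt = Spec k,
      pmap = (\<lambda>P\<in>pts (proj_space k n). pre P),
      smap = (\<lambda>P\<in>pts (proj_space k n). \<lambda>x\<in>carrier (stalk (Spec k) (pre P)).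
                \<Union>(a, f)\<in>x. fraction (poly_ring k n) (proj_fractions k n P) (c a, c f))\<rparr>)"


section \<open>Schemes\<close>

text \<open>The ring \<open>R\<close> can be taken of this type, since it has to be isomorphic to the ring of global sections.\<close>

definition affine_scheme :: "('p, 's) lrs \<Rightarrow> bool"
  where "affine_scheme X \<longleftrightarrow> (\<exists>R :: ('p \<Rightarrow> 's) ring. cring R \<and> isomorphic X (Spec R))"

definition scheme :: "('p, 's) lrs \<Rightarrow> bool"
  where "scheme X \<longleftrightarrow> locally_ringed_space X \<and>
    (\<forall>x\<in>pts X. \<exists>U. openin (sp X) U \<and> x \<in> U \<and> affine_scheme (open_sub X U))"

definition sch_mor :: "('p, 's, 'q, 't) mor \<Rightarrow> bool"
  where "sch_mor f \<longleftrightarrow> is_mor f \<and> scheme (src f) \<and> scheme (tgt f)"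

definition field_spectrum :: "('p, 's) lrs \<Rightarrow> bool"
  where "field_spectrum X \<longleftrightarrow> (\<exists>F :: 's ring. field F \<and> isomorphic X (Spec F))"

definition reduced_scheme :: "('p, 's) lrs \<Rightarrow> bool"
  where "reduced_scheme X \<longleftrightarrow> scheme X \<and>
    (\<forall>x\<in>pts X. \<forall>a\<in>carrier (stalk X x). \<forall>n::nat.
        a [^]\<^bsub>stalk X x\<^esub> n = \<zero>\<^bsub>stalk X x\<^esub> \<longrightarrow> a = \<zero>\<^bsub>stalk X x\<^esub>)"

definition integral_scheme :: "('p, 's) lrs \<Rightarrow> bool"
  where "integral_scheme X \<longleftrightarrow> scheme X \<and> pts X \<noteq> {} \<and>
    (\<forall>U. openin (sp X) U \<and> U \<noteq> {} \<longrightarrow> domain (section_ring X U))"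

definition open_immersion :: "('p, 's, 'q, 't) mor \<Rightarrow> bool"
  where "open_immersion f \<longleftrightarrow> sch_mor f \<and>
    embedding_map (sp (src f)) (sp (tgt f)) (pmap f) \<and>
    openin (sp (tgt f)) (pmap f ` pts (src f)) \<and>
    (\<forall>x\<in>pts (src f).
        bij_betw (smap f x) (carrier (stalk (tgt f) (pmap f x))) (carrier (stalk (src f) x)))"

definition closed_immersion :: "('p, 's, 'q, 't) mor \<Rightarrow> bool"
  where "closed_immersion f \<longleftrightarrow> sch_mor f \<and>
    embedding_map (sp (src f)) (sp (tgt f)) (pmap f) \<and>
    closedin (sp (tgt f)) (pmap f ` pts (src f)) \<and>
    (\<forall>x\<in>pts (src f).
        smap f x ` carrier (stalk (tgt f) (pmap f x)) = carrier (stalk (src f) x))"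

text \<open>Closed subschemes of \<open>X\<close> are represented by closed immersions \<open>i\<close> with \<open>tgt i = X\<close>.\<close>

definition ideal_sheaf :: "('p, 's, 'q, 't) mor \<Rightarrow> 'q set \<Rightarrow> ('q \<Rightarrow> 't) set"
  where "ideal_sheaf i U =
    {s \<in> sect (tgt i) U. \<forall>z\<in>pts (src i). pmap i z \<in> U \<longrightarrow>
        smap i z (s (pmap i z)) = \<zero>\<^bsub>stalk (src i) z\<^esub>}"

text \<open>The ideal sheaf is invertible: locally, multiplication by a section \<open>f\<close> maps the structure
  sheaf isomorphically onto it.\<close>

definition effective_cartier :: "('p, 's, 'q, 't) mor \<Rightarrow> bool"
  where "effective_cartier i \<longleftrightarrow> closed_immersion i \<and>
    (\<forall>y\<in>pts (tgt i). \<exists>U f. openin (sp (tgt i)) U \<and> y \<in> U \<and> f \<in> sect (tgt i) U \<and>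
        (\<forall>V. openin (sp (tgt i)) V \<and> V \<subseteq> U \<longrightarrow>
            bij_betw (\<lambda>g. restrict f V \<otimes>\<^bsub>section_ring (tgt i) V\<^esub> g)
              (sect (tgt i) V) (ideal_sheaf i V)))"

definition reduction :: "('p, 's, 'q, 't) mor \<Rightarrow> bool"
  where "reduction r \<longleftrightarrow> closed_immersion r \<and>
    (\<forall>U. openin (sp (tgt r)) U \<longrightarrow>
        ideal_sheaf r U =
          {s \<in> sect (tgt r) U. \<forall>x\<in>U. \<exists>n::nat. s x [^]\<^bsub>stalk (tgt r) x\<^esub> n = \<zero>\<^bsub>stalk (tgt r) x\<^esub>})"

definition schematic_union ::
  "('p, 's, 'q, 't) mor \<Rightarrow> ('p, 's, 'q, 't) mor \<Rightarrow> ('p, 's, 'q, 't) mor \<Rightarrow> bool"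
  where "schematic_union i\<^sub>1 i\<^sub>2 u \<longleftrightarrow>
    closed_immersion i\<^sub>1 \<and> closed_immersion i\<^sub>2 \<and> closed_immersion u \<and>
    tgt i\<^sub>1 = tgt u \<and> tgt i\<^sub>2 = tgt u \<and>
    (\<forall>U. openin (sp (tgt u)) U \<longrightarrow> ideal_sheaf u U = ideal_sheaf i\<^sub>1 U \<inter> ideal_sheaf i\<^sub>2 U)"


section \<open>Fibre products and blow-ups\<close>

text \<open>
  Fibre products are treated as data \<open>p\<close>, \<open>q\<close> with a universal property.  They exist and are unique up
  to unique isomorphism, so quantifying over all of them below just means ``the'' fibre product.
\<close>

definition is_pullback ::
  "('p, 's, 'q, 't) mor \<Rightarrow> ('p, 's, 'q, 't) mor \<Rightarrow>
    ('p, 's, 'p, 's) mor \<Rightarrow> ('p, 's, 'p, 's) mor \<Rightarrow> bool"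
  where "is_pullback f g p q \<longleftrightarrow>
    sch_mor f \<and> sch_mor g \<and> sch_mor p \<and> sch_mor q \<and>
    tgt f = tgt g \<and> src p = src q \<and> tgt p = src f \<and> tgt q = src g \<and> f \<circ>\<^sub>s p = g \<circ>\<^sub>s q \<and>
    (\<forall>u v :: ('p, 's, 'p, 's) mor.
           sch_mor u \<and> sch_mor v \<and> src u = src v \<and> tgt u = src f \<and> tgt v = src g \<and>
           f \<circ>\<^sub>s u = g \<circ>\<^sub>s v \<longrightarrow>
       (\<exists>!h. sch_mor h \<and> src h = src u \<and> tgt h = src p \<and> p \<circ>\<^sub>s h = u \<and> q \<circ>\<^sub>s h = v))"

text \<open>The morphism \<open>(u, v)\<close> into the fibre product with projections \<open>p\<close>, \<open>q\<close>.\<close>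

definition pair_mor ::
  "('p, 's, 'p, 's) mor \<Rightarrow> ('p, 's, 'p, 's) mor \<Rightarrow>
    ('p, 's, 'p, 's) mor \<Rightarrow> ('p, 's, 'p, 's) mor \<Rightarrow> ('p, 's, 'p, 's) mor"
  where "pair_mor p q u v =
    (THE h. sch_mor h \<and> src h = src u \<and> tgt h = src p \<and> p \<circ>\<^sub>s h = u \<and> q \<circ>\<^sub>s h = v)"

text \<open>\<open>f \<times> g\<close>, from the product with projections \<open>p'\<close>, \<open>q'\<close> to the product with projections
  \<open>p\<close>, \<open>q\<close>.\<close>

definition cross_mor ::
  "('p, 's, 'p, 's) mor \<Rightarrow> ('p, 's, 'p, 's) mor \<Rightarrow> ('p, 's, 'p, 's) mor \<Rightarrow> ('p, 's, 'p, 's) mor \<Rightarrow>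
    ('p, 's, 'p, 's) mor \<Rightarrow> ('p, 's, 'p, 's) mor \<Rightarrow> ('p, 's, 'p, 's) mor"
  where "cross_mor p q p' q' f g = pair_mor p q (f \<circ>\<^sub>s p') (g \<circ>\<^sub>s q')"

text \<open>The pullback by \<open>g\<close> of the closed subscheme \<open>i\<close> is an effective Cartier divisor.\<close>

definition cartier_pullback :: "('p, 's, 'p, 's) mor \<Rightarrow> ('p, 's, 'p, 's) mor \<Rightarrow> bool"
  where "cartier_pullback g i \<longleftrightarrow> (\<forall>d d'. is_pullback g i d d' \<longrightarrow> effective_cartier d)"

text \<open>\<open>bl\<close> is the blow-up of \<open>tgt i\<close> along the closed subscheme \<open>i\<close>: the final morphism pulling \<open>i\<close>
  back to an effective Cartier divisor.\<close>

definition is_blowup :: "('p, 's, 'p, 's) mor \<Rightarrow> ('p, 's, 'p, 's) mor \<Rightarrow> bool"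
  where "is_blowup i bl \<longleftrightarrow>
    sch_mor bl \<and> tgt bl = tgt i \<and> cartier_pullback bl i \<and>
    (\<forall>g. sch_mor g \<and> tgt g = tgt i \<and> cartier_pullback g i \<longrightarrow>
       (\<exists>!h. sch_mor h \<and> src h = src g \<and> tgt h = src bl \<and> bl \<circ>\<^sub>s h = g))"

text \<open>\<open>u\<close> is constant along the fibres of \<open>v\<close>.\<close>

definition const_along :: "('p, 's, 'p, 's) mor \<Rightarrow> ('p, 's, 'p, 's) mor \<Rightarrow> bool"
  where "const_along u v \<longleftrightarrow> (\<forall>r\<^sub>1 r\<^sub>2. is_pullback v v r\<^sub>1 r\<^sub>2 \<longrightarrow> u \<circ>\<^sub>s r\<^sub>1 = u \<circ>\<^sub>s r\<^sub>2)"

definition factors_through :: "('p, 's, 'p, 's) mor \<Rightarrow> ('p, 's, 'p, 's) mor \<Rightarrow> bool"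
  where "factors_through f j \<longleftrightarrow>
    (\<exists>h. sch_mor h \<and> src h = src f \<and> tgt h = src j \<and> j \<circ>\<^sub>s h = f)"


section \<open>Schemes over a field\<close>

text \<open>A scheme over \<open>k\<close> is represented by its structure morphism; the product over \<open>k\<close> of
  \<open>X\<close> and \<open>Y\<close> is \<open>is_pullback X Y p q\<close>.\<close>

type_synonym 'a smor = "('a set, 'a, 'a set, 'a) mor"
type_synonym 'a ksch = "('a set, 'a, 'a set, ('a \<times> 'a) set) mor"

definition kscheme :: "'a ring \<Rightarrow> 'a ksch \<Rightarrow> bool"
  where "kscheme k X \<longleftrightarrow> sch_mor X \<and> tgt X = Spec k"

text \<open>\<open>f\<close> is a morphism from \<open>X\<close> to \<open>Y\<close> over their common base.\<close>

definition over_mor ::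
  "('p, 's, 'q, 't) mor \<Rightarrow> ('u, 'v, 'q, 't) mor \<Rightarrow> ('p, 's, 'u, 'v) mor \<Rightarrow> bool"
  where "over_mor X Y f \<longleftrightarrow>
    sch_mor f \<and> src f = src X \<and> tgt f = src Y \<and> Y \<circ>\<^sub>s f = X"

definition projective :: "'a ring \<Rightarrow> 'a ksch \<Rightarrow> bool"
  where "projective k X \<longleftrightarrow> kscheme k X \<and>
    (\<exists>n i. closed_immersion i \<and> over_mor X (proj_space_str k n) i)"

definition quasiprojective :: "'a ring \<Rightarrow> 'a ksch \<Rightarrow> bool"
  where "quasiprojective k X \<longleftrightarrow> kscheme k X \<and>
    (\<exists>Y j. projective k Y \<and> open_immersion j \<and> over_mor X Y j)"

definition piecewise_quasiprojective :: "'a ring \<Rightarrow> 'a ksch \<Rightarrow> bool"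
  where "piecewise_quasiprojective k X \<longleftrightarrow> kscheme k X \<and>
    (\<exists>\<U>. pairwise disjnt \<U> \<and> \<Union>\<U> = pts (src X) \<and>
       (\<forall>U\<in>\<U>. openin (sp (src X)) U \<and> quasiprojective k (open_restrict X U)))"

text \<open>
  Over a perfect field every reduced scheme is geometrically reduced.  Over an imperfect
  \<open>k\<close> the relative cluster theorem fails without this property: take \<open>K/k\<close> purely
  inseparable of degree \<open>char k\<close>, \<open>B = Spec K\<close>, \<open>\<S> = A\<^sup>1\<^sub>K\<close>, \<open>W = Spec K\<close> and the pair of sections over
  \<open>B \<times> W = Spec K[\<epsilon>]\<close> given by \<open>0\<close> and the nonzero nilpotent \<open>\<epsilon>\<close>.  Then \<open>E\<^sub>W\<close> is defined by
  \<open>\<epsilon>\<close>, its blow-up is empty, and no point of \<open>W\<close> lies in \<open>W\<^sub>E\<close>.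
\<close>

definition geometrically_reduced :: "'a ring \<Rightarrow> 'a ksch \<Rightarrow> bool"
  where "geometrically_reduced k X \<longleftrightarrow> kscheme k X \<and>
    (\<forall>T p q. kscheme k T \<and> field_spectrum (src T) \<and> is_pullback X T p q \<longrightarrow>
       reduced_scheme (src p))"


section \<open>Section families and relative clusters\<close>

text \<open>
  \<open>(W, \<theta>)\<close> is a section family of \<open>\<tau> : \<T> \<rightarrow> B\<close>, where \<open>p\<close>, \<open>q\<close> are the projections of \<open>B \<times> W\<close>.
\<close>

definition section_family ::
  "'a ring \<Rightarrow> 'a ksch \<Rightarrow> 'a smor \<Rightarrow> 'a ksch \<Rightarrow> 'a smor \<Rightarrow> 'a smor \<Rightarrow> 'a smor \<Rightarrow> bool"
  where "section_family k B \<tau> W p q \<theta> \<longleftrightarrow>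
    kscheme k B \<and> kscheme k W \<and> sch_mor \<tau> \<and> tgt \<tau> = src B \<and>
    is_pullback B W p q \<and> over_mor p \<tau> \<theta>"

definition universal_section_family ::
  "'a ring \<Rightarrow> 'a ksch \<Rightarrow> 'a smor \<Rightarrow> 'a ksch \<Rightarrow> 'a smor \<Rightarrow> 'a smor \<Rightarrow> 'a smor \<Rightarrow> bool"
  where "universal_section_family k B \<tau> W p q \<theta> \<longleftrightarrow>
    section_family k B \<tau> W p q \<theta> \<and>
    (\<forall>V p' q' \<sigma>. section_family k B \<tau> V p' q' \<sigma> \<longrightarrow>
       (\<exists>!f. over_mor V W f \<and> \<sigma> = \<theta> \<circ>\<^sub>s cross_mor p q p' q' (id_mor (src B)) f))"

text \<open>Here \<open>\<tau>\<^sub>1\<close> is the morphism \<open>p \<circ> \<pi>\<^sub>1 : \<S>\<^sub>1 \<rightarrow> B\<close>.\<close>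

definition cluster_family ::
  "'a ring \<Rightarrow> 'a ksch \<Rightarrow> 'a smor \<Rightarrow> 'a smor \<Rightarrow>
    'a ksch \<Rightarrow> 'a smor \<Rightarrow> 'a smor \<Rightarrow> 'a smor \<Rightarrow> bool"
  where "cluster_family k B \<tau>\<^sub>1 q\<^sub>1 W p q \<theta> \<longleftrightarrow>
    section_family k B \<tau>\<^sub>1 W p q \<theta> \<and> const_along (q\<^sub>1 \<circ>\<^sub>s \<theta>) q"

text \<open>
  The closed subscheme \<open>W'\<close> of \<open>W\<close> (with inclusion \<open>i\<close>): \<open>B \<times> W' \<rightarrow> B \<times> W\<close> is the blow-up
  along \<open>e : E\<^sub>W \<rightarrow> B \<times> W\<close>.
\<close>

definition blowup_locus ::
  "'a ksch \<Rightarrow> 'a ksch \<Rightarrow> 'a smor \<Rightarrow> 'a smor \<Rightarrow> 'a smor \<Rightarrow> 'a smor \<Rightarrow> bool"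
  where "blowup_locus B W p q e i \<longleftrightarrow>
    closed_immersion i \<and> tgt i = src W \<and>
    (\<exists>p' q'. is_pullback B (W \<circ>\<^sub>s i) p' q' \<and>
       is_blowup e (cross_mor p q p' q' (id_mor (src B)) i))"

text \<open>
  The closed subscheme \<open>W\<^sub>E\<close> of \<open>W\<close> (with inclusion \<open>j\<close>): \<open>f : T \<rightarrow> W\<close> factors through it iff the
  base change along \<open>f\<close> of the morphism \<open>e : E\<^sub>W \<rightarrow> B \<times> W\<close> of \<open>W\<close>-schemes is an
  isomorphism.  The base changes of \<open>E\<^sub>W\<close> and \<open>B \<times> W\<close> have projections \<open>d\<close>, \<open>d'\<close> and
  \<open>c\<close>, \<open>c'\<close>.
\<close>

definition iso_locus :: "'a ksch \<Rightarrow> 'a smor \<Rightarrow> 'a smor \<Rightarrow> 'a smor \<Rightarrow> bool"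
  where "iso_locus W q e j \<longleftrightarrow>
    closed_immersion j \<and> tgt j = src W \<and>
    (\<forall>f. sch_mor f \<and> tgt f = src W \<longrightarrow>
       (factors_through f j \<longleftrightarrow>
         (\<forall>c c' d d'. is_pullback q f c c' \<and> is_pullback (q \<circ>\<^sub>s e) f d d' \<longrightarrow>
            is_iso (pair_mor c c' (e \<circ>\<^sub>s d) d'))))"

text \<open>
  The closed subscheme \<open>W\<^sup>c\<close> of \<open>W\<close> (with inclusion \<open>j\<close>) over which \<open>q\<^sub>1 \<circ> \<theta>\<close> becomes constant along
  the fibres of the projection to the parameter scheme.
\<close>

definition const_locus ::
  "'a ksch \<Rightarrow> 'a smor \<Rightarrow> 'a ksch \<Rightarrow> 'a smor \<Rightarrow> 'a smor \<Rightarrow> 'a smor \<Rightarrow> 'a smor \<Rightarrow> bool"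
  where "const_locus B q\<^sub>1 W p q \<theta> j \<longleftrightarrow>
    closed_immersion j \<and> tgt j = src W \<and>
    (\<forall>f. sch_mor f \<and> tgt f = src W \<longrightarrow>
       (factors_through f j \<longleftrightarrow>
         (\<forall>p' q'. is_pullback B (W \<circ>\<^sub>s f) p' q' \<longrightarrow>
            const_along (q\<^sub>1 \<circ>\<^sub>s \<theta> \<circ>\<^sub>s cross_mor p q p' q' (id_mor (src B)) f) q')))"

text \<open>
  The blow up split section family \<open>b : V' \<rightarrow> V\<close> of the projection \<open>p : B \<times> V \<rightarrow> B\<close> along the
  closed subscheme \<open>z\<close> of \<open>B \<times> V\<close>; \<open>p'\<close>, \<open>q'\<close> are the projections of \<open>B \<times> V'\<close>.
\<close>

definition blowup_split ::
  "'a ksch \<Rightarrow> 'a ksch \<Rightarrow> 'a smor \<Rightarrow> 'a smor \<Rightarrow> 'a smor \<Rightarrow>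
    'a smor \<Rightarrow> 'a smor \<Rightarrow> 'a smor \<Rightarrow> bool"
  where "blowup_split B V p q z b p' q' \<longleftrightarrow>
    sch_mor b \<and> tgt b = src V \<and> is_pullback B (V \<circ>\<^sub>s b) p' q' \<and>
    cartier_pullback (cross_mor p q p' q' (id_mor (src B)) b) z \<and>
    (\<forall>g. sch_mor g \<and> tgt g = src V \<and>
         (\<forall>p'' q''. is_pullback B (V \<circ>\<^sub>s g) p'' q'' \<longrightarrow>
            cartier_pullback (cross_mor p q p'' q'' (id_mor (src B)) g) z) \<longrightarrow>
       (\<exists>!h. sch_mor h \<and> src h = src g \<and> tgt h = src b \<and> b \<circ>\<^sub>s h = g))"

end

theory Submission
  imports Defs "HOL-Algebra.Weak_Morphisms"
begin

text \<open>
  Every point \<open>w\<close> of \<open>W\<close> lies in \<open>W'\<close> or in \<open>W\<^sub>E\<close>.  The blow-up \<open>B \<times> W' \<rightarrow> B \<times> W\<close> is surjective off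
  \<open>E\<^sub>W\<close>, so if \<open>w\<close> is not in \<open>W'\<close>, then \<open>\<theta>\<close> maps the fibre of \<open>B \<times> W\<close> over \<open>w\<close> into \<open>E\<close> as a set, and
  also as a morphism, because this fibre is reduced.  Hence the base change of \<open>E\<^sub>W\<close> to the residue
  field of \<open>w\<close> is the whole fibre, which means that \<open>w\<close> lies in \<open>W\<^sub>E\<close>.

  Consequently a section in the ideal of the schematic union is a unit at no point, so it is locally
  nilpotent and vanishes on the reduction.
\<close>

section \<open>Rings\<close>

text \<open>Blow-ups, fibre products and W_E are available only through universal properties, so
  they are tested by morphisms rather than computed. One test object serves both halves: the
  spectrum of the residue field of a point. Mapped to a point off the center it lifts to the
  blow-up; mapped to w it decides whether w lies in W_E. The obstacle is that the universal
  properties range over schemes with fixed types of points and stalks, so this spectrum has to be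
  rebuilt as a one-point scheme in those types. The passage from sets of points to morphisms rests
  on \<open>scheme_nonunit_nilpotent\<close>, which is applied twice: on the reduced fibre, where
  nilpotent germs are zero, and on W, where the sections with nilpotent germs are those vanishing on
  the reduction. The fibre over w is the base change of B to the residue field of w, an extension of
  the base field that may be inseparable; this is where \<open>geometrically_reduced\<close>
  enters.\<close>

lemma local_ring_cring: "local_ring R \<Longrightarrow> cring R"
  by (simp add: local_ring_def)

lemma local_ring_nontrivial:
  assumes "local_ring R" shows "\<one>\<^bsub>R\<^esub> \<noteq> \<zero>\<^bsub>R\<^esub>"
proof
  assume *: "\<one>\<^bsub>R\<^esub> = \<zero>\<^bsub>R\<^esub>"
  interpret cring R by (rule local_ring_cring[OF assms])
  obtain M where "maximalideal M R" using assms by (auto simp: local_ring_def)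
  then interpret maximalideal M R .
  show False
    using I_notcarr * additive_subgroup.zero_closed[OF is_additive_subgroup] one_imp_carrier by auto
qed

lemma local_ring_zero_not_Unit:
  assumes "local_ring R" shows "\<zero>\<^bsub>R\<^esub> \<notin> Units R"
proof -
  interpret cring R by (rule local_ring_cring[OF assms])
  show ?thesis using local_ring_nontrivial[OF assms] by (auto simp: Units_def)
qed

text \<open>Zorn's lemma. The set \<open>T\<close> is left open because two choices are used:
  \<open>{\<one>}\<close> yields maximal ideals and the powers of an element yield prime
  ideals.\<close>

lemma (in cring) ideal_avoiding_exists:
  assumes "ideal I R" "I \<inter> T = {}" "T \<subseteq> carrier R"
  obtains P where "ideal P R" "I \<subseteq> P" "P \<inter> T = {}"
    "\<forall>J. ideal J R \<longrightarrow> P \<subseteq> J \<longrightarrow> J \<inter> T = {} \<longrightarrow> J = P"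
proof -
  let ?A = "{J. ideal J R \<and> I \<subseteq> J \<and> J \<inter> T = {}}"
  have "\<exists>U\<in>?A. \<forall>X\<in>C. X \<subseteq> U" if "subset.chain ?A C" for C
  proof (cases "C = {}")
    case True
    then show ?thesis using assms by auto
  next
    case False
    have sub: "C \<subseteq> ?A" using that by (simp add: subset.chain_def)
    have tot: "x \<subseteq> y \<or> y \<subseteq> x" if "x \<in> C" "y \<in> C" for x y
      using subset.chain_total[OF \<open>subset.chain ?A C\<close> that] by auto
    have id: "\<And>J. J \<in> C \<Longrightarrow> ideal J R" using sub by auto
    have "ideal (\<Union>C) R"
    proof (rule idealI[OF ring_axioms])
      show "subgroup (\<Union>C) (add_monoid R)"
      proof (rule subgroup.intro)
        show "\<Union>C \<subseteq> carrier (add_monoid R)"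
          using id ideal.Icarr by fastforce
        show "x \<otimes>\<^bsub>add_monoid R\<^esub> y \<in> \<Union>C" if xy: "x \<in> \<Union>C" "y \<in> \<Union>C" for x y
        proof -
          obtain J where J: "J \<in> C" "x \<in> J" "y \<in> J" using xy tot by blast
          from additive_subgroup.a_closed[OF ideal.axioms(1)[OF id] this(2,3)] J(1)
          show ?thesis by auto
        qed
        show "\<one>\<^bsub>add_monoid R\<^esub> \<in> \<Union>C"
          using False id additive_subgroup.zero_closed[OF ideal.axioms(1)] by fastforce
        show "inv\<^bsub>add_monoid R\<^esub> x \<in> \<Union>C" if "x \<in> \<Union>C" for x
          using that id additive_subgroup.a_inv_closed[OF ideal.axioms(1)]
          by (fastforce simp: a_inv_def)
      qed
    next
      fix x r assume "x \<in> \<Union>C" and r: "r \<in> carrier R"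
      then obtain J where J: "J \<in> C" "x \<in> J" by blast
      then show "r \<otimes> x \<in> \<Union>C" "x \<otimes> r \<in> \<Union>C"
        using ideal.I_l_closed[OF id J(2) r] ideal.I_r_closed[OF id J(2) r] by auto
    qed
    moreover have "I \<subseteq> \<Union>C" "\<Union>C \<inter> T = {}" using sub False by auto
    ultimately show ?thesis by blast
  qed
  from subset_Zorn[of ?A, OF this] obtain P where "P \<in> ?A" "\<forall>X\<in>?A. P \<subseteq> X \<longrightarrow> X = P" by blast
  then show thesis by (intro that[of P]) auto
qed

text \<open>No multiple of a nonunit is \<open>\<one>\<close>, and an ideal is proper exactly when
  it misses \<open>\<one>\<close>.\<close>

lemma (in cring) nonunit_in_maximalideal:
  assumes "a \<in> carrier R" "a \<notin> Units R"
  obtains M where "maximalideal M R" "a \<in> M"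
proof -
  have "PIdl a \<inter> {\<one>} = {}"
  proof -
    have "x \<otimes> a \<noteq> \<one>" if "x \<in> carrier R" for x
      using that assms m_comm unfolding Units_def by auto
    then show ?thesis unfolding cgenideal_def by force
  qed
  from ideal_avoiding_exists[OF cgenideal_ideal[OF assms(1)] this]
  obtain P where P: "ideal P R" "PIdl a \<subseteq> P" "P \<inter> {\<one>} = {}"
    "\<forall>J. ideal J R \<longrightarrow> P \<subseteq> J \<longrightarrow> J \<inter> {\<one>} = {} \<longrightarrow> J = P" by blast
  have "maximalideal P R"
  proof (rule maximalidealI[OF P(1)])
    show "carrier R \<noteq> P" using P(3) by auto
    show "J = P \<or> J = carrier R" if "ideal J R" "P \<subseteq> J" "J \<subseteq> carrier R" for J
      using P(4) that ideal.one_imp_carrier[OF that(1)] by auto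
  qed
  then show thesis using that P(2) cgenideal_self[OF assms(1)] by auto
qed

text \<open>An ideal \<open>P\<close> maximal among those that miss all powers of \<open>a\<close>
  is prime: if \<open>x\<close> and \<open>y\<close> are outside \<open>P\<close>, then the ideals
  generated by \<open>P\<close> together with \<open>x\<close> or \<open>y\<close> each contain a
  power of \<open>a\<close>, and the product of these powers would lie in \<open>P\<close> as soon
  as the product of \<open>x\<close> and \<open>y\<close> does.\<close>

lemma (in cring) non_nilpotent_avoided_by_prime:
  assumes a: "a \<in> carrier R" "\<And>n::nat. a [^] n \<noteq> \<zero>"
  obtains P where "primeideal P R" "a \<notin> P"
proof -
  let ?T = "range (\<lambda>n::nat. a [^] n)"
  have "{\<zero>} \<inter> ?T = {}" "?T \<subseteq> carrier R" using a by (auto dest: sym)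
  from ideal_avoiding_exists[OF zeroideal this]
  obtain P where P: "ideal P R" "{\<zero>} \<subseteq> P" "P \<inter> ?T = {}"
    "\<forall>J. ideal J R \<longrightarrow> P \<subseteq> J \<longrightarrow> J \<inter> ?T = {} \<longrightarrow> J = P" by blast
  interpret P: ideal P R by (rule P(1))
  have pow: "\<exists>n::nat. \<exists>p\<in>P. \<exists>r\<in>carrier R. a [^] n = p \<oplus> r \<otimes> x"
    if x: "x \<in> carrier R" "x \<notin> P" for x
  proof -
    let ?J = "set_add R P (PIdl x)"
    have J: "ideal ?J R" by (rule add_ideals[OF P(1) cgenideal_ideal[OF x(1)]])
    have "P \<subseteq> ?J"
    proof
      fix y assume "y \<in> P"
      moreover have "\<zero> \<in> PIdl x"
        by (rule additive_subgroup.zero_closed[OF ideal.axioms(1)[OF cgenideal_ideal[OF x(1)]]])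
      ultimately show "y \<in> ?J"
        unfolding set_add_def' using P.Icarr[OF \<open>y \<in> P\<close>] by (intro UN_I[of y] UN_I[of "\<zero>"]) auto
    qed
    moreover have "x \<in> ?J"
      unfolding set_add_def' using cgenideal_self[OF x(1)] P.zero_closed x(1)
      by (intro UN_I[of "\<zero>"] UN_I[of x]) auto
    ultimately have "?J \<inter> ?T \<noteq> {}" using P(4) J x(2) by blast
    then show ?thesis unfolding set_add_def' cgenideal_def by auto
  qed
  have "primeideal P R"
  proof (rule primeidealI[OF P(1) is_cring])
    show "carrier R \<noteq> P" using P(3) by (metis disjoint_iff nat_pow_0 one_closed rangeI)
    fix x y assume xy: "x \<in> carrier R" "y \<in> carrier R" "x \<otimes> y \<in> P"
    show "x \<in> P \<or> y \<in> P"
    proof (rule ccontr)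
      assume "\<not> (x \<in> P \<or> y \<in> P)"
      then obtain n m :: nat and p p' r r' where *: "p \<in> P" "p' \<in> P" "r \<in> carrier R" "r' \<in> carrier R"
        "a [^] n = p \<oplus> r \<otimes> x" "a [^] m = p' \<oplus> r' \<otimes> y"
        using pow[of x] pow[of y] xy(1,2) by blast
      have pc: "p \<in> carrier R" "p' \<in> carrier R" using * P.Icarr by auto
      have "a [^] (n + m) = a [^] n \<otimes> a [^] m" by (simp add: a nat_pow_mult)
      \<comment> \<open>The expansion is grouped so that each summand has a factor in
        \<open>P\<close>, namely \<open>p\<close>, \<open>p'\<close> or
        \<open>x \<otimes> y\<close>.\<close>
      also have "\<dots> = p \<otimes> (a [^] m) \<oplus> ((r \<otimes> x) \<otimes> p' \<oplus> (r \<otimes> r') \<otimes> (x \<otimes> y))"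
        unfolding * using *(3,4) xy pc by (simp add: l_distr r_distr m_ac)
      also have "\<dots> \<in> P"
        by (rule P.a_closed) (use * xy pc a(1) P.a_closed P.I_l_closed P.I_r_closed in simp_all)
      finally show False using P(3) by blast
    qed
  qed
  moreover have "a [^] (1::nat) \<notin> P" using P(3) by blast
  then have "a \<notin> P" using a(1) by simp
  ultimately show thesis using that by blast
qed

lemma ring_hom_Units:
  assumes "h \<in> ring_hom R S" "a \<in> Units R" "cring R" "cring S"
  shows "h a \<in> Units S"
proof -
  interpret ring_hom_cring R S h
    by (rule ring_hom_cring.intro[OF assms(3,4) ring_hom_cring_axioms.intro[OF assms(1)]])
  obtain b where "b \<in> carrier R" "b \<otimes>\<^bsub>R\<^esub> a = \<one>\<^bsub>R\<^esub>" "a \<otimes>\<^bsub>R\<^esub> b = \<one>\<^bsub>R\<^esub>" "a \<in> carrier R"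
    using assms(2) by (auto simp: Units_def)
  then show ?thesis unfolding Units_def
    by (auto intro!: bexI[of _ "h b"]) (metis hom_mult hom_one)+
qed

section \<open>Locally ringed spaces and morphisms\<close>

context
  fixes X :: "('p, 's) lrs"
  assumes X: "locally_ringed_space X"
begin

lemma lrs_local_ring: "x \<in> pts X \<Longrightarrow> local_ring (stalk X x)"
  using X by (simp add: locally_ringed_space_def)

lemma lrs_cring: "x \<in> pts X \<Longrightarrow> cring (stalk X x)"
  by (simp add: lrs_local_ring local_ring_cring)

lemma lrs_sections:
  "\<forall>U. openin (sp X) U \<longrightarrow>
    sect X U \<subseteq> (\<Pi>\<^sub>E x\<in>U. carrier (stalk X x)) \<and> cring (section_ring X U)"
  using X unfolding locally_ringed_space_def by (elim conjE)

lemma lrs_sect: "openin (sp X) U \<Longrightarrow> s \<in> sect X U \<Longrightarrow> s \<in> (\<Pi>\<^sub>E x\<in>U. carrier (stalk X x))"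
  using lrs_sections by blast

lemma lrs_sect_closed: "openin (sp X) U \<Longrightarrow> s \<in> sect X U \<Longrightarrow> x \<in> U \<Longrightarrow> s x \<in> carrier (stalk X x)"
  using lrs_sect by blast

lemma lrs_section_ring: "openin (sp X) U \<Longrightarrow> cring (section_ring X U)"
  using lrs_sections by blast

lemma lrs_zero: "openin (sp X) U \<Longrightarrow> (\<lambda>x\<in>U. \<zero>\<^bsub>stalk X x\<^esub>) \<in> sect X U"
  using cring.cring_simprules(2)[OF lrs_section_ring] by (simp add: section_ring_def)

lemma lrs_one: "openin (sp X) U \<Longrightarrow> (\<lambda>x\<in>U. \<one>\<^bsub>stalk X x\<^esub>) \<in> sect X U"
  using cring.cring_simprules(6)[OF lrs_section_ring] by (simp add: section_ring_def)

lemma lrs_restrict: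
  assumes "openin (sp X) U" "openin (sp X) V" "V \<subseteq> U" "s \<in> sect X U"
  shows "restrict s V \<in> sect X V"
proof -
  have "\<forall>U V s. openin (sp X) U \<and> openin (sp X) V \<and> V \<subseteq> U \<and> s \<in> sect X U \<longrightarrow>
      restrict s V \<in> sect X V"
    using X unfolding locally_ringed_space_def by (elim conjE)
  then show ?thesis using assms by blast
qed

lemma lrs_glue:
  assumes "openin (sp X) U" "s \<in> (\<Pi>\<^sub>E x\<in>U. carrier (stalk X x))"
    and "\<And>x. x \<in> U \<Longrightarrow> \<exists>V. openin (sp X) V \<and> x \<in> V \<and> V \<subseteq> U \<and> restrict s V \<in> sect X V"
  shows "s \<in> sect X U"
proof -
  have "\<forall>U s. openin (sp X) U \<and> s \<in> (\<Pi>\<^sub>E x\<in>U. carrier (stalk X x)) \<and>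
        (\<forall>x\<in>U. \<exists>V. openin (sp X) V \<and> x \<in> V \<and> V \<subseteq> U \<and> restrict s V \<in> sect X V) \<longrightarrow>
        s \<in> sect X U"
    using X unfolding locally_ringed_space_def by (elim conjE)
  then show ?thesis using assms by blast
qed

lemma lrs_germ:
  assumes "x \<in> pts X" "a \<in> carrier (stalk X x)"
  obtains U s where "openin (sp X) U" "x \<in> U" "s \<in> sect X U" "s x = a"
proof -
  have "\<forall>x\<in>pts X. \<forall>a\<in>carrier (stalk X x).
        \<exists>U s. openin (sp X) U \<and> x \<in> U \<and> s \<in> sect X U \<and> s x = a"
    using X unfolding locally_ringed_space_def by (elim conjE)
  then show ?thesis using assms that by blast
qed

lemma lrs_germ_eq:
  assumes "openin (sp X) U" "s \<in> sect X U" "t \<in> sect X U" "x \<in> U" "s x = t x"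
  obtains V where "openin (sp X) V" "x \<in> V" "V \<subseteq> U" "\<And>y. y \<in> V \<Longrightarrow> s y = t y"
proof -
  have "\<forall>U s t x. openin (sp X) U \<and> s \<in> sect X U \<and> t \<in> sect X U \<and> x \<in> U \<and> s x = t x \<longrightarrow>
        (\<exists>V. openin (sp X) V \<and> x \<in> V \<and> V \<subseteq> U \<and> restrict s V = restrict t V)"
    using X unfolding locally_ringed_space_def by (elim conjE)
  from this[rule_format, of U s t x] obtain V where V: "openin (sp X) V" "x \<in> V" "V \<subseteq> U" "restrict s V = restrict t V"
    using assms by blast
  then have "s y = t y" if "y \<in> V" for y
    using that by (metis restrict_apply')
  then show ?thesis using that V by blast
qed

end

section \<open>Points, stalk maps and sections under a morphism\<close>

context
  fixes f :: "('p, 's, 'q, 't) mor"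
  assumes f: "is_mor f"
begin

lemma mor_lrs: "locally_ringed_space (src f)" "locally_ringed_space (tgt f)"
  using f by (simp_all add: is_mor_def)

lemma mor_continuous: "continuous_map (sp (src f)) (sp (tgt f)) (pmap f)"
  using f by (simp add: is_mor_def)

lemma mor_pt: "x \<in> pts (src f) \<Longrightarrow> pmap f x \<in> pts (tgt f)"
  using mor_continuous by (auto simp: continuous_map_def)

lemma mor_open_preimage:
  "openin (sp (tgt f)) V \<Longrightarrow> openin (sp (src f)) {x \<in> pts (src f). pmap f x \<in> V}"
  using mor_continuous by (simp add: continuous_map_def)

lemma mor_hom: "x \<in> pts (src f) \<Longrightarrow> smap f x \<in> ring_hom (stalk (tgt f) (pmap f x)) (stalk (src f) x)"
  using f by (simp add: is_mor_def)

lemma mor_hom_cring: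
  "x \<in> pts (src f) \<Longrightarrow> ring_hom_cring (stalk (tgt f) (pmap f x)) (stalk (src f) x) (smap f x)"
  by (rule ring_hom_cring.intro[OF _ _ ring_hom_cring_axioms.intro[OF mor_hom]])
    (auto intro: lrs_cring mor_lrs mor_pt)

lemma mor_closed:
  "x \<in> pts (src f) \<Longrightarrow> a \<in> carrier (stalk (tgt f) (pmap f x)) \<Longrightarrow> smap f x a \<in> carrier (stalk (src f) x)"
  using ring_hom_closed[OF mor_hom] by blast

lemma mor_local:
  "x \<in> pts (src f) \<Longrightarrow> a \<in> carrier (stalk (tgt f) (pmap f x)) \<Longrightarrow>
    smap f x a \<in> Units (stalk (src f) x) \<Longrightarrow> a \<in> Units (stalk (tgt f) (pmap f x))"
  using f by (simp add: is_mor_def)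

lemma mor_sect:
  "openin (sp (tgt f)) V \<Longrightarrow> s \<in> sect (tgt f) V \<Longrightarrow>
    (\<lambda>x\<in>{x \<in> pts (src f). pmap f x \<in> V}. smap f x (s (pmap f x)))
      \<in> sect (src f) {x \<in> pts (src f). pmap f x \<in> V}"
  using f unfolding is_mor_def by blast

end

lemma is_morI:
  assumes "locally_ringed_space (src f)" "locally_ringed_space (tgt f)"
    and "continuous_map (sp (src f)) (sp (tgt f)) (pmap f)"
    and "pmap f \<in> extensional (pts (src f))" "smap f \<in> extensional (pts (src f))"
    and "\<And>x. x \<in> pts (src f) \<Longrightarrow> smap f x \<in> ring_hom (stalk (tgt f) (pmap f x)) (stalk (src f) x)"
    and "\<And>x. x \<in> pts (src f) \<Longrightarrow> smap f x \<in> extensional (carrier (stalk (tgt f) (pmap f x)))"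
    and "\<And>x a. x \<in> pts (src f) \<Longrightarrow> a \<in> carrier (stalk (tgt f) (pmap f x)) \<Longrightarrow>
      smap f x a \<in> Units (stalk (src f) x) \<Longrightarrow> a \<in> Units (stalk (tgt f) (pmap f x))"
    and "\<And>V s. openin (sp (tgt f)) V \<Longrightarrow> s \<in> sect (tgt f) V \<Longrightarrow>
        (\<lambda>x\<in>{x \<in> pts (src f). pmap f x \<in> V}. smap f x (s (pmap f x)))
          \<in> sect (src f) {x \<in> pts (src f). pmap f x \<in> V}"
  shows "is_mor f"
  unfolding is_mor_def using assms by blast

text \<open>All components of a morphism are extensional, which is why agreement on points and on
  carriers of stalks is enough for equality of records.\<close>

lemma mor_eqI:
  assumes f: "is_mor f" and g: "is_mor g" and "src f = src g" "tgt f = tgt g"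
    and p: "\<And>x. x \<in> pts (src f) \<Longrightarrow> pmap f x = pmap g x"
    and s: "\<And>x a. x \<in> pts (src f) \<Longrightarrow> a \<in> carrier (stalk (tgt f) (pmap f x)) \<Longrightarrow> smap f x a = smap g x a"
  shows "f = g"
proof -
  have "pmap f = pmap g"
    using f g p \<open>src f = src g\<close> unfolding is_mor_def by (intro extensionalityI) auto
  moreover have "smap f x = smap g x" if "x \<in> pts (src f)" for x
    using f g s[OF that] p[OF that] \<open>src f = src g\<close> \<open>tgt f = tgt g\<close> that unfolding is_mor_def
    by (intro extensionalityI[of _ "carrier (stalk (tgt f) (pmap f x))"]) auto
  then have "smap f = smap g"
    using f g \<open>src f = src g\<close> unfolding is_mor_def by (intro extensionalityI) auto
  ultimately show ?thesis using assms(3,4) by simp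
qed

section \<open>The category of locally ringed spaces\<close>

lemma comp_mor_simps [simp]:
  "src (g \<circ>\<^sub>s f) = src f" "tgt (g \<circ>\<^sub>s f) = tgt g"
  by (simp_all add: comp_mor_def)

lemma pmap_comp: "x \<in> pts (src f) \<Longrightarrow> pmap (g \<circ>\<^sub>s f) x = pmap g (pmap f x)"
  by (simp add: comp_mor_def)

lemma smap_comp:
  "x \<in> pts (src f) \<Longrightarrow> a \<in> carrier (stalk (tgt g) (pmap g (pmap f x))) \<Longrightarrow>
    smap (g \<circ>\<^sub>s f) x a = smap f x (smap g (pmap f x) a)"
  by (simp add: comp_mor_def)

lemma id_mor_simps [simp]: "src (id_mor X) = X" "tgt (id_mor X) = X"
  by (simp_all add: id_mor_def)

lemma pmap_id: "x \<in> pts X \<Longrightarrow> pmap (id_mor X) x = x"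
  by (simp add: id_mor_def)

lemma smap_id: "x \<in> pts X \<Longrightarrow> a \<in> carrier (stalk X x) \<Longrightarrow> smap (id_mor X) x a = a"
  by (simp add: id_mor_def)

lemma is_mor_comp:
  assumes f: "is_mor f" and g: "is_mor g" and fg: "tgt f = src g"
  shows "is_mor (g \<circ>\<^sub>s f)"
proof (rule is_morI)
  have pt: "pmap f x \<in> pts (src g)" if "x \<in> pts (src f)" for x
    using mor_pt[OF f that] fg by simp
  have "continuous_map (sp (src f)) (sp (tgt g)) (pmap (g \<circ>\<^sub>s f))"
    by (rule continuous_map_eq[OF continuous_map_compose[OF mor_continuous[OF f]]])
      (use mor_continuous[OF g] fg in \<open>simp_all add: pmap_comp\<close>)
  then show "continuous_map (sp (src (g \<circ>\<^sub>s f))) (sp (tgt (g \<circ>\<^sub>s f))) (pmap (g \<circ>\<^sub>s f))"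
    by simp
  fix x assume "x \<in> pts (src (g \<circ>\<^sub>s f))"
  then have x: "x \<in> pts (src f)" by simp
  have gc: "smap g (pmap f x) a \<in> carrier (stalk (src g) (pmap f x))"
    if "a \<in> carrier (stalk (tgt g) (pmap g (pmap f x)))" for a
    using mor_closed[OF g pt[OF x] that] .
  show "smap (g \<circ>\<^sub>s f) x \<in> extensional (carrier (stalk (tgt (g \<circ>\<^sub>s f)) (pmap (g \<circ>\<^sub>s f) x)))"
    using x by (simp add: comp_mor_def)
  show "smap (g \<circ>\<^sub>s f) x \<in> ring_hom (stalk (tgt (g \<circ>\<^sub>s f)) (pmap (g \<circ>\<^sub>s f) x)) (stalk (src (g \<circ>\<^sub>s f)) x)"
  proof -
    have *: "smap f x \<circ> smap g (pmap f x) \<in> ring_hom (stalk (tgt g) (pmap g (pmap f x))) (stalk (src f) x)"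
      using ring_hom_trans[OF mor_hom[OF g pt[OF x]]] mor_hom[OF f x] fg by simp
    interpret G: cring "stalk (tgt g) (pmap g (pmap f x))"
      by (intro lrs_cring mor_lrs g mor_pt pt x)
    show ?thesis
      by (rule ring_hom_memI)
        (use ring_hom_closed[OF *] ring_hom_mult[OF *] ring_hom_add[OF *] ring_hom_one[OF *] x
         in \<open>simp_all add: pmap_comp smap_comp\<close>)
  qed
  show "a \<in> Units (stalk (tgt (g \<circ>\<^sub>s f)) (pmap (g \<circ>\<^sub>s f) x))"
    if "a \<in> carrier (stalk (tgt (g \<circ>\<^sub>s f)) (pmap (g \<circ>\<^sub>s f) x))"
      "smap (g \<circ>\<^sub>s f) x a \<in> Units (stalk (src (g \<circ>\<^sub>s f)) x)" for a
    using that mor_local[OF g pt[OF x]] mor_local[OF f x] gc fg x by (simp add: pmap_comp smap_comp)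
next
  fix V s assume V: "openin (sp (tgt (g \<circ>\<^sub>s f))) V" and s: "s \<in> sect (tgt (g \<circ>\<^sub>s f)) V"
  have pt: "pmap f x \<in> pts (src g)" if "x \<in> pts (src f)" for x
    using mor_pt[OF f that] fg by simp
  have V': "openin (sp (tgt g)) V" and s': "s \<in> sect (tgt g) V" using V s by simp_all
  have eq: "{x \<in> pts (src f). pmap f x \<in> {y \<in> pts (src g). pmap g y \<in> V}}
      = {x \<in> pts (src f). pmap (g \<circ>\<^sub>s f) x \<in> V}"
    using pt by (auto simp: pmap_comp)
  have "(\<lambda>x\<in>{x \<in> pts (src f). pmap f x \<in> {y \<in> pts (src g). pmap g y \<in> V}}.
      smap f x ((\<lambda>y\<in>{y \<in> pts (src g). pmap g y \<in> V}. smap g y (s (pmap g y))) (pmap f x)))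
    \<in> sect (src f) {x \<in> pts (src f). pmap f x \<in> {y \<in> pts (src g). pmap g y \<in> V}}"
    by (rule mor_sect[OF f]; unfold fg; fact mor_open_preimage[OF g V'] mor_sect[OF g V' s'])
  also have "(\<lambda>x\<in>{x \<in> pts (src f). pmap f x \<in> {y \<in> pts (src g). pmap g y \<in> V}}.
      smap f x ((\<lambda>y\<in>{y \<in> pts (src g). pmap g y \<in> V}. smap g y (s (pmap g y))) (pmap f x)))
    = (\<lambda>x\<in>{x \<in> pts (src f). pmap (g \<circ>\<^sub>s f) x \<in> V}. smap (g \<circ>\<^sub>s f) x (s (pmap (g \<circ>\<^sub>s f) x)))"
    unfolding eq
  proof (rule restrict_ext)
    fix x assume "x \<in> {x \<in> pts (src f). pmap (g \<circ>\<^sub>s f) x \<in> V}"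
    then have x: "x \<in> pts (src f)" "pmap g (pmap f x) \<in> V" by (auto simp: pmap_comp)
    then have "s (pmap g (pmap f x)) \<in> carrier (stalk (tgt g) (pmap g (pmap f x)))"
      using lrs_sect_closed[OF mor_lrs(2)[OF g]] V s by simp
    then show "smap f x ((\<lambda>y\<in>{y \<in> pts (src g). pmap g y \<in> V}. smap g y (s (pmap g y))) (pmap f x))
      = smap (g \<circ>\<^sub>s f) x (s (pmap (g \<circ>\<^sub>s f) x))"
      using x pt by (simp add: pmap_comp smap_comp)
  qed
  finally show "(\<lambda>x\<in>{x \<in> pts (src (g \<circ>\<^sub>s f)). pmap (g \<circ>\<^sub>s f) x \<in> V}. smap (g \<circ>\<^sub>s f) x (s (pmap (g \<circ>\<^sub>s f) x)))
    \<in> sect (src (g \<circ>\<^sub>s f)) {x \<in> pts (src (g \<circ>\<^sub>s f)). pmap (g \<circ>\<^sub>s f) x \<in> V}"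
    unfolding eq comp_mor_simps(1) .
qed (use mor_lrs[OF f] mor_lrs[OF g] in \<open>simp_all add: comp_mor_def\<close>)

lemma is_mor_id:
  assumes X: "locally_ringed_space X" shows "is_mor (id_mor X)"
proof (rule is_morI)
  fix V s assume "openin (sp (tgt (id_mor X))) V" "s \<in> sect (tgt (id_mor X)) V"
  then have V: "openin (sp X) V" and s: "s \<in> sect X V" by simp_all
  have eq: "{x \<in> pts (src (id_mor X)). pmap (id_mor X) x \<in> V} = V"
    using openin_subset[OF V] by (auto simp: id_mor_def)
  have "(\<lambda>x\<in>V. smap (id_mor X) x (s (pmap (id_mor X) x))) = s"
    using lrs_sect[OF X V s] openin_subset[OF V]
    by (intro extensionalityI[of _ V]) (auto simp: id_mor_def PiE_def Pi_def)
  then show "(\<lambda>x\<in>{x \<in> pts (src (id_mor X)). pmap (id_mor X) x \<in> V}. smap (id_mor X) x (s (pmap (id_mor X) x)))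
      \<in> sect (src (id_mor X)) {x \<in> pts (src (id_mor X)). pmap (id_mor X) x \<in> V}"
    using eq s by simp
next
  have "continuous_map (sp X) (sp X) (pmap (id_mor X))"
    by (rule continuous_map_eq[OF continuous_map_id]) (auto simp: id_mor_def)
  then show "continuous_map (sp (src (id_mor X))) (sp (tgt (id_mor X))) (pmap (id_mor X))"
    by simp
next
  fix x assume "x \<in> pts (src (id_mor X))"
  then interpret cring "stalk X x" using lrs_cring[OF X] by simp
  show "smap (id_mor X) x \<in> ring_hom (stalk (tgt (id_mor X)) (pmap (id_mor X) x)) (stalk (src (id_mor X)) x)"
    using \<open>x \<in> _\<close> by (intro ring_hom_memI) (auto simp: id_mor_def)
qed (use X in \<open>auto simp: id_mor_def\<close>)

lemma comp_mor_assoc: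
  assumes "is_mor f" "is_mor g" "is_mor h" "tgt f = src g" "tgt g = src h"
  shows "h \<circ>\<^sub>s (g \<circ>\<^sub>s f) = (h \<circ>\<^sub>s g) \<circ>\<^sub>s f"
proof (rule mor_eqI)
  fix x assume "x \<in> pts (src (h \<circ>\<^sub>s (g \<circ>\<^sub>s f)))"
  then have x: "x \<in> pts (src f)" "pmap f x \<in> pts (src g)" "pmap g (pmap f x) \<in> pts (src h)"
    using mor_pt[OF assms(1)] mor_pt[OF assms(2)] assms(4,5) by auto
  then show "pmap (h \<circ>\<^sub>s (g \<circ>\<^sub>s f)) x = pmap ((h \<circ>\<^sub>s g) \<circ>\<^sub>s f) x" by (simp add: pmap_comp)
  fix a assume "a \<in> carrier (stalk (tgt (h \<circ>\<^sub>s (g \<circ>\<^sub>s f))) (pmap (h \<circ>\<^sub>s (g \<circ>\<^sub>s f)) x))"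
  then have a: "a \<in> carrier (stalk (tgt h) (pmap h (pmap g (pmap f x))))"
    using x by (simp add: pmap_comp)
  then show "smap (h \<circ>\<^sub>s (g \<circ>\<^sub>s f)) x a = smap ((h \<circ>\<^sub>s g) \<circ>\<^sub>s f) x a"
    using x mor_closed[OF assms(3) x(3) a] assms(5) by (simp add: pmap_comp smap_comp)
qed (use assms in \<open>simp_all add: is_mor_comp\<close>)

lemma comp_id_right:
  assumes "is_mor f" shows "f \<circ>\<^sub>s id_mor (src f) = f"
  by (rule mor_eqI)
    (use assms is_mor_id[OF mor_lrs(1)[OF assms]] mor_closed[OF assms] in
      \<open>simp_all add: is_mor_comp pmap_comp smap_comp pmap_id smap_id\<close>)

lemma comp_id_left:
  assumes "is_mor f" shows "id_mor (tgt f) \<circ>\<^sub>s f = f"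
  by (rule mor_eqI)
    (use assms is_mor_id[OF mor_lrs(2)[OF assms]] mor_closed[OF assms] mor_pt[OF assms] in
      \<open>simp_all add: is_mor_comp pmap_comp smap_comp pmap_id smap_id\<close>)

lemma sch_mor_is_mor: "sch_mor f \<Longrightarrow> is_mor f"
  by (simp add: sch_mor_def)

lemma sch_mor_comp: "sch_mor f \<Longrightarrow> sch_mor g \<Longrightarrow> tgt f = src g \<Longrightarrow> sch_mor (g \<circ>\<^sub>s f)"
  by (simp add: sch_mor_def is_mor_comp)

lemma scheme_lrs: "scheme X \<Longrightarrow> locally_ringed_space X"
  by (simp add: scheme_def)

lemma sch_mor_id: "scheme X \<Longrightarrow> sch_mor (id_mor X)"
  by (simp add: sch_mor_def is_mor_id scheme_lrs)

lemma sch_comp_assoc: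
  "sch_mor f \<Longrightarrow> sch_mor g \<Longrightarrow> sch_mor h \<Longrightarrow> tgt f = src g \<Longrightarrow> tgt g = src h \<Longrightarrow>
    h \<circ>\<^sub>s (g \<circ>\<^sub>s f) = (h \<circ>\<^sub>s g) \<circ>\<^sub>s f"
  by (rule comp_mor_assoc) (simp_all add: sch_mor_is_mor)

section \<open>Fibre products\<close>

lemma pullbackD:
  assumes "is_pullback f g p q"
  shows "sch_mor f" "sch_mor g" "sch_mor p" "sch_mor q" "tgt f = tgt g" "src p = src q"
    "tgt p = src f" "tgt q = src g" "f \<circ>\<^sub>s p = g \<circ>\<^sub>s q"
  using assms unfolding is_pullback_def by blast+

lemma pullback_ex1:
  fixes f :: "('p, 's, 'q, 't) mor" and p u v :: "('p, 's, 'p, 's) mor"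
  assumes "is_pullback f g p q"
    and "sch_mor u" "sch_mor v" "src u = src v" "tgt u = src f" "tgt v = src g" "f \<circ>\<^sub>s u = g \<circ>\<^sub>s v"
  shows "\<exists>!h. sch_mor h \<and> src h = src u \<and> tgt h = src p \<and> p \<circ>\<^sub>s h = u \<and> q \<circ>\<^sub>s h = v"
proof -
  have "\<forall>(u :: ('p, 's, 'p, 's) mor) v. sch_mor u \<and> sch_mor v \<and> src u = src v \<and> tgt u = src f \<and> tgt v = src g \<and>
      f \<circ>\<^sub>s u = g \<circ>\<^sub>s v \<longrightarrow>
    (\<exists>!h. sch_mor h \<and> src h = src u \<and> tgt h = src p \<and> p \<circ>\<^sub>s h = u \<and> q \<circ>\<^sub>s h = v)"
    using assms(1) unfolding is_pullback_def by (elim conjE)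
  from this[rule_format, of u v] show ?thesis using assms(2-) by simp
qed

lemma pair_mor:
  assumes "is_pullback f g p q"
    and "sch_mor u" "sch_mor v" "src u = src v" "tgt u = src f" "tgt v = src g" "f \<circ>\<^sub>s u = g \<circ>\<^sub>s v"
  shows "sch_mor (pair_mor p q u v)" "src (pair_mor p q u v) = src u" "tgt (pair_mor p q u v) = src p"
    "p \<circ>\<^sub>s pair_mor p q u v = u" "q \<circ>\<^sub>s pair_mor p q u v = v"
  using theI'[OF pullback_ex1[OF assms]] unfolding pair_mor_def by blast+

text \<open>Both \<open>h\<close> and \<open>k\<close> solve the factorisation problem posed by
  \<open>p \<circ>\<^sub>s k\<close> and \<open>q \<circ>\<^sub>s k\<close>, and the solution is
  unique.\<close>

lemma pullback_eqI:
  fixes f :: "('p, 's, 'q, 't) mor" and p h k :: "('p, 's, 'p, 's) mor"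
  assumes pb: "is_pullback f g p q"
    and h: "sch_mor h" "tgt h = src p" and k: "sch_mor k" "tgt k = src p" and "src h = src k"
    and "p \<circ>\<^sub>s h = p \<circ>\<^sub>s k" "q \<circ>\<^sub>s h = q \<circ>\<^sub>s k"
  shows "h = k"
proof -
  note D = pullbackD[OF pb]
  have "f \<circ>\<^sub>s (p \<circ>\<^sub>s k) = g \<circ>\<^sub>s (q \<circ>\<^sub>s k)"
    using D k by (simp add: sch_comp_assoc)
  then have "\<exists>!h :: ('p, 's, 'p, 's) mor. sch_mor h \<and> src h = src (p \<circ>\<^sub>s k) \<and> tgt h = src p \<and> p \<circ>\<^sub>s h = p \<circ>\<^sub>s k \<and> q \<circ>\<^sub>s h = q \<circ>\<^sub>s k"
    using D k by (intro pullback_ex1[OF pb]) (simp_all add: sch_mor_comp)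
  then show ?thesis using assms by (metis comp_mor_simps(1))
qed

lemma is_pullbackI:
  fixes f :: "('p, 's, 'q, 't) mor" and p :: "('p, 's, 'p, 's) mor"
  assumes "sch_mor f" "sch_mor g" "sch_mor p" "sch_mor q" "tgt f = tgt g" "src p = src q"
    "tgt p = src f" "tgt q = src g" "f \<circ>\<^sub>s p = g \<circ>\<^sub>s q"
    and "\<And>(u :: ('p, 's, 'p, 's) mor) v. sch_mor u \<Longrightarrow> sch_mor v \<Longrightarrow> src u = src v \<Longrightarrow> tgt u = src f \<Longrightarrow> tgt v = src g \<Longrightarrow>
      f \<circ>\<^sub>s u = g \<circ>\<^sub>s v \<Longrightarrow> \<exists>h. sch_mor h \<and> src h = src u \<and> tgt h = src p \<and> p \<circ>\<^sub>s h = u \<and> q \<circ>\<^sub>s h = v"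
    and "\<And>(h :: ('p, 's, 'p, 's) mor) k. sch_mor h \<Longrightarrow> tgt h = src p \<Longrightarrow> sch_mor k \<Longrightarrow> tgt k = src p \<Longrightarrow> src h = src k \<Longrightarrow>
      p \<circ>\<^sub>s h = p \<circ>\<^sub>s k \<Longrightarrow> q \<circ>\<^sub>s h = q \<circ>\<^sub>s k \<Longrightarrow> h = k"
  shows "is_pullback f g p q"
  unfolding is_pullback_def
proof (intro conjI allI impI; (fact assms)?)
  fix u v :: "('p, 's, 'p, 's) mor"
  assume uv: "sch_mor u \<and> sch_mor v \<and> src u = src v \<and> tgt u = src f \<and> tgt v = src g \<and> f \<circ>\<^sub>s u = g \<circ>\<^sub>s v"
  then obtain h where h: "sch_mor h" "src h = src u" "tgt h = src p" "p \<circ>\<^sub>s h = u" "q \<circ>\<^sub>s h = v"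
    using assms(10)[of u v] by blast
  then show "\<exists>!h. sch_mor h \<and> src h = src u \<and> tgt h = src p \<and> p \<circ>\<^sub>s h = u \<and> q \<circ>\<^sub>s h = v"
    by (intro ex1I[of _ h]) (auto intro!: assms(11))
qed

text \<open>Two Cartesian squares side by side form a Cartesian square. For a point \<open>f\<close>
  of W this presents the fibre of B x W over \<open>f\<close> as a product of B with the source of
  \<open>f\<close>, the form in which geometric reducedness of B can be applied.\<close>

lemma pullback_paste:
  fixes B W :: "('p, 's, 'q, 't) mor" and p q f c c' :: "('p, 's, 'p, 's) mor"
  assumes pq: "is_pullback B W p q" and cc: "is_pullback q f c c'"
  shows "is_pullback B (W \<circ>\<^sub>s f) (p \<circ>\<^sub>s c) c'"
proof (rule is_pullbackI)
  note P = pullbackD[OF pq] and C = pullbackD[OF cc]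
  have fW: "tgt f = src W" using P C by simp
  show "B \<circ>\<^sub>s (p \<circ>\<^sub>s c) = W \<circ>\<^sub>s f \<circ>\<^sub>s c'"
    using P C fW by (metis sch_comp_assoc)
  {
    fix u v :: "('p, 's, 'p, 's) mor"
    assume uv: "sch_mor u" "sch_mor v" "src u = src v" "tgt u = src B" "tgt v = src (W \<circ>\<^sub>s f)"
      "B \<circ>\<^sub>s u = W \<circ>\<^sub>s f \<circ>\<^sub>s v"
    have fv: "sch_mor (f \<circ>\<^sub>s v)" "src (f \<circ>\<^sub>s v) = src u" "tgt (f \<circ>\<^sub>s v) = src W"
      using uv C fW by (simp_all add: sch_mor_comp)
    have "B \<circ>\<^sub>s u = W \<circ>\<^sub>s (f \<circ>\<^sub>s v)"
      using uv P C fW by (simp add: sch_comp_assoc)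
    note h1 = pair_mor[OF pq uv(1) fv(1) fv(2)[symmetric] uv(4) fv(3) this]
    let ?h1 = "pair_mor p q u (f \<circ>\<^sub>s v)"
    have "tgt ?h1 = src q" "src ?h1 = src v" "tgt v = src f" using h1 P uv by simp_all
    note h = pair_mor[OF cc h1(1) uv(2) this(2,1,3) h1(5)]
    let ?h = "pair_mor c c' ?h1 v"
    have "p \<circ>\<^sub>s c \<circ>\<^sub>s ?h = u"
      using sch_comp_assoc[of ?h c p] h h1 P C by simp
    then show "\<exists>h. sch_mor h \<and> src h = src u \<and> tgt h = src (p \<circ>\<^sub>s c) \<and> p \<circ>\<^sub>s c \<circ>\<^sub>s h = u \<and> c' \<circ>\<^sub>s h = v"
      using h h1 by (intro exI[of _ ?h]) simp
  }
  fix h k :: "('p, 's, 'p, 's) mor"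
  assume h: "sch_mor h" "tgt h = src (p \<circ>\<^sub>s c)" and k: "sch_mor k" "tgt k = src (p \<circ>\<^sub>s c)"
    and hk: "src h = src k" "p \<circ>\<^sub>s c \<circ>\<^sub>s h = p \<circ>\<^sub>s c \<circ>\<^sub>s k" "c' \<circ>\<^sub>s h = c' \<circ>\<^sub>s k"
  have "c \<circ>\<^sub>s h = c \<circ>\<^sub>s k"
  proof (rule pullback_eqI[OF pq])
    show "p \<circ>\<^sub>s (c \<circ>\<^sub>s h) = p \<circ>\<^sub>s (c \<circ>\<^sub>s k)"
      using h k hk P C by (simp add: sch_comp_assoc)
    have "q \<circ>\<^sub>s (c \<circ>\<^sub>s h) = f \<circ>\<^sub>s (c' \<circ>\<^sub>s h)" "q \<circ>\<^sub>s (c \<circ>\<^sub>s k) = f \<circ>\<^sub>s (c' \<circ>\<^sub>s k)"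
      using sch_comp_assoc[of h c q] sch_comp_assoc[of h c' f]
        sch_comp_assoc[of k c q] sch_comp_assoc[of k c' f] h k C by simp_all
    then show "q \<circ>\<^sub>s (c \<circ>\<^sub>s h) = q \<circ>\<^sub>s (c \<circ>\<^sub>s k)" using hk by simp
  qed (use h k hk P C in \<open>simp_all add: sch_mor_comp\<close>)
  then show "h = k" using pullback_eqI[OF cc, of h k] h k hk by simp
qed (use pullbackD[OF pq] pullbackD[OF cc] in \<open>simp_all add: sch_mor_comp\<close>)

text \<open>If the restriction of \<open>\<theta>\<close> to the base change along \<open>f\<close>
  lands in E through \<open>g\<close>, then \<open>c\<close> itself lifts to the pullback E_W, by
  \<open>n\<^sub>1\<close>. This lift, paired with \<open>c'\<close>, is the inverse
  \<open>n\<close> of the base change \<open>m\<close> of \<open>e\<^sub>W\<close>.\<close>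

lemma pullback_iso_if_factors:
  fixes q f \<theta> e e\<^sub>W e\<^sub>W' c c' d d' g :: "('p, 's, 'p, 's) mor"
  assumes E: "is_pullback \<theta> e e\<^sub>W e\<^sub>W'" and q: "sch_mor q" "src q = src \<theta>"
    and C: "is_pullback q f c c'" and D: "is_pullback (q \<circ>\<^sub>s e\<^sub>W) f d d'"
    and g: "sch_mor g" "src g = src c" "tgt g = src e" "e \<circ>\<^sub>s g = \<theta> \<circ>\<^sub>s c"
    and mono: "\<And>h k. sch_mor h \<Longrightarrow> sch_mor k \<Longrightarrow> src h = src k \<Longrightarrow> tgt h = src e \<Longrightarrow> tgt k = src e \<Longrightarrow>
      e \<circ>\<^sub>s h = e \<circ>\<^sub>s k \<Longrightarrow> h = (k :: ('p, 's, 'p, 's) mor)"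
  shows "is_iso (pair_mor c c' (e\<^sub>W \<circ>\<^sub>s d) d')"
proof -
  note E' = pullbackD[OF E] and C' = pullbackD[OF C] and D' = pullbackD[OF D]
  define m where "m = pair_mor c c' (e\<^sub>W \<circ>\<^sub>s d) d'"
  have "q \<circ>\<^sub>s (e\<^sub>W \<circ>\<^sub>s d) = f \<circ>\<^sub>s d'"
    using E' D' q by (simp add: sch_comp_assoc)
  then have m: "sch_mor m" "src m = src d" "tgt m = src c" "c \<circ>\<^sub>s m = e\<^sub>W \<circ>\<^sub>s d" "c' \<circ>\<^sub>s m = d'"
    using pair_mor[OF C, of "e\<^sub>W \<circ>\<^sub>s d" d'] E' D' q unfolding m_def by (simp_all add: sch_mor_comp)
  define n\<^sub>1 where "n\<^sub>1 = pair_mor e\<^sub>W e\<^sub>W' c g"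
  have n1: "sch_mor n\<^sub>1" "src n\<^sub>1 = src c" "tgt n\<^sub>1 = src e\<^sub>W" "e\<^sub>W \<circ>\<^sub>s n\<^sub>1 = c" "e\<^sub>W' \<circ>\<^sub>s n\<^sub>1 = g"
    using pair_mor[OF E, of c g] C' E' q g unfolding n\<^sub>1_def by simp_all
  define n where "n = pair_mor d d' n\<^sub>1 c'"
  have "(q \<circ>\<^sub>s e\<^sub>W) \<circ>\<^sub>s n\<^sub>1 = f \<circ>\<^sub>s c'"
    using n1 E' q C' sch_comp_assoc[of n\<^sub>1 e\<^sub>W q] by simp
  then have n: "sch_mor n" "src n = src c" "tgt n = src d" "d \<circ>\<^sub>s n = n\<^sub>1" "d' \<circ>\<^sub>s n = c'"
    using pair_mor[OF D, of n\<^sub>1 c'] n1 C' D' unfolding n_def by simp_all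
  have ids: "sch_mor (id_mor (src c))" "sch_mor (id_mor (src d))"
    by (rule sch_mor_id; use C'(3) D'(3) in \<open>simp add: sch_mor_def\<close>)+
  have "m \<circ>\<^sub>s n = id_mor (src c)"
  proof (rule pullback_eqI[OF C])
    show "c \<circ>\<^sub>s (m \<circ>\<^sub>s n) = c \<circ>\<^sub>s id_mor (src c)"
    proof -
      have "c \<circ>\<^sub>s (m \<circ>\<^sub>s n) = (e\<^sub>W \<circ>\<^sub>s d) \<circ>\<^sub>s n" using m n C' by (simp add: sch_comp_assoc)
      also have "\<dots> = e\<^sub>W \<circ>\<^sub>s n\<^sub>1" using sch_comp_assoc[of n d e\<^sub>W] n E' D' by simp
      finally show ?thesis using n1 C' comp_id_right[of c] by (simp add: sch_mor_is_mor)
    qed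
    show "c' \<circ>\<^sub>s (m \<circ>\<^sub>s n) = c' \<circ>\<^sub>s id_mor (src c)"
      using m n C' sch_comp_assoc[of n m c'] comp_id_right[of c'] by (simp add: sch_mor_is_mor)
  qed (use m n ids in \<open>simp_all add: sch_mor_comp\<close>)
  moreover have "n \<circ>\<^sub>s m = id_mor (src d)"
  proof (rule pullback_eqI[OF D])
    have nm: "n\<^sub>1 \<circ>\<^sub>s m = d"
    proof (rule pullback_eqI[OF E])
      show "e\<^sub>W \<circ>\<^sub>s (n\<^sub>1 \<circ>\<^sub>s m) = e\<^sub>W \<circ>\<^sub>s d"
        using m n1 E' sch_comp_assoc[of m n\<^sub>1 e\<^sub>W] by simp
      \<comment> \<open>The components in E only have to be compared after the monomorphism
        \<open>e\<close>, where both become \<open>\<theta>\<close> applied to the same morphism to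
        B x W.\<close>
      show "e\<^sub>W' \<circ>\<^sub>s (n\<^sub>1 \<circ>\<^sub>s m) = e\<^sub>W' \<circ>\<^sub>s d"
      proof (rule mono)
        have "e \<circ>\<^sub>s (e\<^sub>W' \<circ>\<^sub>s (n\<^sub>1 \<circ>\<^sub>s m)) = e \<circ>\<^sub>s (g \<circ>\<^sub>s m)"
          using m n1 E' sch_comp_assoc[of m n\<^sub>1 e\<^sub>W'] by simp
        also have "\<dots> = \<theta> \<circ>\<^sub>s (c \<circ>\<^sub>s m)"
          using m g E' C' q sch_comp_assoc[of m g e] sch_comp_assoc[of m c \<theta>] by simp
        also have "\<dots> = e \<circ>\<^sub>s (e\<^sub>W' \<circ>\<^sub>s d)"
          using m E' D' sch_comp_assoc[of d e\<^sub>W \<theta>] sch_comp_assoc[of d e\<^sub>W' e] by simp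
        finally show "e \<circ>\<^sub>s (e\<^sub>W' \<circ>\<^sub>s (n\<^sub>1 \<circ>\<^sub>s m)) = e \<circ>\<^sub>s (e\<^sub>W' \<circ>\<^sub>s d)" .
      qed (use m n1 E' D' in \<open>simp_all add: sch_mor_comp\<close>)
    qed (use m n1 D' in \<open>simp_all add: sch_mor_comp\<close>)
    show "d \<circ>\<^sub>s (n \<circ>\<^sub>s m) = d \<circ>\<^sub>s id_mor (src d)"
      using m n nm D' sch_comp_assoc[of m n d] comp_id_right[of d] by (simp add: sch_mor_is_mor)
    show "d' \<circ>\<^sub>s (n \<circ>\<^sub>s m) = d' \<circ>\<^sub>s id_mor (src d)"
      using m n D' sch_comp_assoc[of m n d'] comp_id_right[of d'] by (simp add: sch_mor_is_mor)
  qed (use m n ids in \<open>simp_all add: sch_mor_comp\<close>)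
  ultimately show ?thesis
    unfolding is_iso_def m_def[symmetric] using m n by (auto intro!: exI[of _ n] simp: sch_mor_is_mor)
qed

section \<open>Closed immersions\<close>

context
  fixes i :: "('p, 's, 'q, 't) mor"
  assumes i: "closed_immersion i"
begin

lemma closed_immersion_sch_mor: "sch_mor i"
  using i by (simp add: closed_immersion_def)

lemma closed_immersion_is_mor: "is_mor i"
  by (rule sch_mor_is_mor[OF closed_immersion_sch_mor])

lemma closed_immersion_embedding: "embedding_map (sp (src i)) (sp (tgt i)) (pmap i)"
  using i by (simp add: closed_immersion_def)

lemma closed_immersion_closedin: "closedin (sp (tgt i)) (pmap i ` pts (src i))"
  using i by (simp add: closed_immersion_def)

lemma closed_immersion_inj: "inj_on (pmap i) (pts (src i))"
  using closed_immersion_embedding unfolding embedding_map_def homeomorphic_map_def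
  using homeomorphic_imp_injective_map by blast

lemma closed_immersion_surj:
  "z \<in> pts (src i) \<Longrightarrow> smap i z ` carrier (stalk (tgt i) (pmap i z)) = carrier (stalk (src i) z)"
  using i by (simp add: closed_immersion_def)

lemma closed_immersion_open:
  assumes "openin (sp (src i)) V"
  obtains U where "openin (sp (tgt i)) U" "V = {z \<in> pts (src i). pmap i z \<in> U}"
proof -
  have "open_map (sp (src i)) (subtopology (sp (tgt i)) (pmap i ` pts (src i))) (pmap i)"
    using closed_immersion_embedding unfolding embedding_map_def
    by (rule homeomorphic_imp_open_map)
  then have "openin (subtopology (sp (tgt i)) (pmap i ` pts (src i))) (pmap i ` V)"
    using assms by (simp add: open_map_def)
  then obtain U where U: "openin (sp (tgt i)) U" "pmap i ` V = U \<inter> pmap i ` pts (src i)"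
    by (auto simp: openin_subtopology)
  have "V = {z \<in> pts (src i). pmap i z \<in> U}"
  proof -
    have "z \<in> V" if "z \<in> pts (src i)" "pmap i z \<in> U" for z
    proof -
      have "pmap i z \<in> pmap i ` V" using U that by blast
      then show ?thesis
        using closed_immersion_inj that openin_subset[OF assms] by (auto dest: inj_onD)
    qed
    then show ?thesis using U openin_subset[OF assms] by blast
  qed
  then show thesis using U that by blast
qed

text \<open>Ring homomorphisms preserve units, and zero is not a unit of a local ring. This turns
  membership in an ideal sheaf into being a nonunit at the points of the subscheme, which is what
  the nilpotence argument takes as input.\<close>

lemma closed_immersion_zero_nonunit:
  assumes "z \<in> pts (src i)" "smap i z a = \<zero>\<^bsub>stalk (src i) z\<^esub>"
  shows "a \<notin> Units (stalk (tgt i) (pmap i z))"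
proof
  note im = closed_immersion_is_mor and z = assms(1)
  assume "a \<in> Units (stalk (tgt i) (pmap i z))"
  then have "smap i z a \<in> Units (stalk (src i) z)"
    by (rule ring_hom_Units[OF mor_hom[OF im z] _ lrs_cring[OF mor_lrs(2)[OF im] mor_pt[OF im z]]
          lrs_cring[OF mor_lrs(1)[OF im] z]])
  then show False
    using assms(2) local_ring_zero_not_Unit[OF lrs_local_ring[OF mor_lrs(1)[OF im] z]] by simp
qed

text \<open>Injectivity on points determines the underlying map of \<open>h\<close>, and
  surjectivity on stalks determines its stalk maps.\<close>

lemma closed_immersion_mono:
  assumes h: "is_mor h" "tgt h = src i" and k: "is_mor k" "tgt k = src i"
    and hk: "src h = src k" "i \<circ>\<^sub>s h = i \<circ>\<^sub>s k"
  shows "h = k"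
proof (rule mor_eqI[OF h(1) k(1)])
  fix x assume x: "x \<in> pts (src h)"
  then have xk: "x \<in> pts (src k)" using hk by simp
  have pt: "pmap h x \<in> pts (src i)" "pmap k x \<in> pts (src i)"
    using mor_pt[OF h(1) x] mor_pt[OF k(1) xk] h k by simp_all
  have "pmap i (pmap h x) = pmap i (pmap k x)"
    using pmap_comp[OF x, of i] pmap_comp[OF xk, of i] hk by simp
  then show eq: "pmap h x = pmap k x"
    using closed_immersion_inj pt by (auto dest: inj_onD)
  fix a assume "a \<in> carrier (stalk (tgt h) (pmap h x))"
  then obtain b where b: "b \<in> carrier (stalk (tgt i) (pmap i (pmap h x)))" "a = smap i (pmap h x) b"
    using closed_immersion_surj[OF pt(1)] h by auto
  show "smap h x a = smap k x a"
    using smap_comp[OF x, of b i] smap_comp[OF xk, of b i] b eq hk by simp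
qed (use h k hk in simp_all)

text \<open>The hypothesis \<open>ideal\<close> concerns sections over open sets, whereas the
  factorisation below needs kernels of stalk maps. The bridge: if a germ dies at \<open>z\<close>,
  then a representative dies on a neighbourhood of \<open>z\<close> in the subscheme; this
  neighbourhood is the trace of an open set \<open>N\<close> of the target, over which the
  representative is a section of the ideal sheaf.\<close>

lemma closed_immersion_kernel:
  assumes g: "is_mor g" "tgt g = tgt i" and z: "z \<in> pts (src i)" and y: "y \<in> pts (src g)"
    and zy: "pmap i z = pmap g y"
    and ideal: "\<And>V s y. openin (sp (tgt i)) V \<Longrightarrow> s \<in> ideal_sheaf i V \<Longrightarrow> y \<in> pts (src g) \<Longrightarrow>
      pmap g y \<in> V \<Longrightarrow> smap g y (s (pmap g y)) = \<zero>\<^bsub>stalk (src g) y\<^esub>"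
    and b: "b \<in> carrier (stalk (tgt i) (pmap i z))" "smap i z b = \<zero>\<^bsub>stalk (src i) z\<^esub>"
  shows "smap g y b = \<zero>\<^bsub>stalk (src g) y\<^esub>"
proof -
  note im = closed_immersion_is_mor
  obtain U s where U: "openin (sp (tgt i)) U" "pmap i z \<in> U" "s \<in> sect (tgt i) U" "s (pmap i z) = b"
    using lrs_germ[OF mor_lrs(2)[OF im] mor_pt[OF im z] b(1)] by blast
  let ?V = "{x \<in> pts (src i). pmap i x \<in> U}"
  have V: "openin (sp (src i)) ?V" by (rule mor_open_preimage[OF im U(1)])
  obtain V' where V': "openin (sp (src i)) V'" "z \<in> V'" "V' \<subseteq> ?V"
    "\<And>x. x \<in> V' \<Longrightarrow> (\<lambda>x\<in>?V. smap i x (s (pmap i x))) x = (\<lambda>x\<in>?V. \<zero>\<^bsub>stalk (src i) x\<^esub>) x"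
    by (rule lrs_germ_eq[OF mor_lrs(1)[OF im] V mor_sect[OF im U(1,3)] lrs_zero[OF mor_lrs(1)[OF im] V], of z])
      (use z U b in auto)
  obtain N where N: "openin (sp (tgt i)) N" "V' = {x \<in> pts (src i). pmap i x \<in> N}"
    using closed_immersion_open[OF V'(1)] by blast
  have NU: "openin (sp (tgt i)) (U \<inter> N)" using U N by blast
  have "restrict s (U \<inter> N) \<in> ideal_sheaf i (U \<inter> N)"
    unfolding ideal_sheaf_def
  proof (intro CollectI conjI ballI impI)
    show "restrict s (U \<inter> N) \<in> sect (tgt i) (U \<inter> N)"
      by (rule lrs_restrict[OF mor_lrs(2)[OF im] U(1) NU _ U(3)]) auto
    fix x assume x: "x \<in> pts (src i)" "pmap i x \<in> U \<inter> N"
    then have "x \<in> V'" using N by auto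
    from V'(4)[OF this] x
    show "smap i x (restrict s (U \<inter> N) (pmap i x)) = \<zero>\<^bsub>stalk (src i) x\<^esub>" by auto
  qed
  from ideal[OF NU this y] show ?thesis
    using U N V'(2) zy by auto
qed

text \<open>The factorization sends \<open>y\<close> to the unique point over \<open>pmap g y\<close>; its maps of stalks are
  induced from those of \<open>g\<close> by passing to the quotients \<open>smap i z\<close>.\<close>

lemma closed_immersion_factor:
  assumes g: "is_mor g" "tgt g = tgt i"
    and image: "pmap g ` pts (src g) \<subseteq> pmap i ` pts (src i)"
    and ideal: "\<And>V s y. openin (sp (tgt i)) V \<Longrightarrow> s \<in> ideal_sheaf i V \<Longrightarrow> y \<in> pts (src g) \<Longrightarrow>
      pmap g y \<in> V \<Longrightarrow> smap g y (s (pmap g y)) = \<zero>\<^bsub>stalk (src g) y\<^esub>"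
  obtains h where "is_mor h" "src h = src g" "tgt h = src i" "i \<circ>\<^sub>s h = g"
proof -
  note im = closed_immersion_is_mor
  define \<rho> where "\<rho> y = inv_into (pts (src i)) (pmap i) (pmap g y)" for y
  have \<rho>: "\<rho> y \<in> pts (src i)" "pmap i (\<rho> y) = pmap g y" if "y \<in> pts (src g)" for y
  proof -
    have "pmap g y \<in> pmap i ` pts (src i)" using that image by blast
    then show "\<rho> y \<in> pts (src i)" "pmap i (\<rho> y) = pmap g y"
      by (simp_all add: \<rho>_def inv_into_into f_inv_into_f)
  qed
  define \<sigma> where "\<sigma> y a = smap g y (SOME b. b \<in> carrier (stalk (tgt i) (pmap g y)) \<and> smap i (\<rho> y) b = a)" for y a
  \<comment> \<open>The chosen preimage does not matter: two preimages differ by an element killed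
    by \<open>smap i (\<rho> y)\<close>, and \<open>closed_immersion_kernel\<close> shows that
    \<open>g\<close> kills it too.\<close>
  have \<sigma>: "\<sigma> y (smap i (\<rho> y) b) = smap g y b"
    if y: "y \<in> pts (src g)" and b: "b \<in> carrier (stalk (tgt i) (pmap g y))" for y b
  proof -
    define b' where "b' = (SOME b'. b' \<in> carrier (stalk (tgt i) (pmap g y)) \<and> smap i (\<rho> y) b' = smap i (\<rho> y) b)"
    have b': "b' \<in> carrier (stalk (tgt i) (pmap g y))" "smap i (\<rho> y) b' = smap i (\<rho> y) b"
      using someI[of "\<lambda>b'. b' \<in> carrier (stalk (tgt i) (pmap g y)) \<and> smap i (\<rho> y) b' = smap i (\<rho> y) b" b] b
      unfolding b'_def by simp_all
    interpret I: ring_hom_cring "stalk (tgt i) (pmap g y)" "stalk (src i) (\<rho> y)" "smap i (\<rho> y)"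
      using mor_hom_cring[OF im \<rho>(1)[OF y]] \<rho>(2)[OF y] by simp
    interpret G: ring_hom_cring "stalk (tgt i) (pmap g y)" "stalk (src g) y" "smap g y"
      using mor_hom_cring[OF g(1) y] g(2) by simp
    have d: "smap i (\<rho> y) (b' \<ominus>\<^bsub>stalk (tgt i) (pmap g y)\<^esub> b) = \<zero>\<^bsub>stalk (src i) (\<rho> y)\<^esub>"
      using b b' by (simp add: a_minus_def I.S.r_neg)
    have "smap g y (b' \<ominus>\<^bsub>stalk (tgt i) (pmap g y)\<^esub> b) = \<zero>\<^bsub>stalk (src g) y\<^esub>"
      by (rule closed_immersion_kernel[OF g \<rho>(1)[OF y] y \<rho>(2)[OF y]]; (rule ideal; assumption)?)
        (use b b' d \<rho>(2)[OF y] in simp_all)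
    then have "smap g y b' = smap g y b"
      using b b' by (simp add: a_minus_def) (metis G.S.add.inv_equality G.S.minus_minus G.hom_closed G.S.a_inv_closed)
    then show ?thesis by (simp add: \<sigma>_def b'_def)
  qed
  have lift: "\<exists>b. b \<in> carrier (stalk (tgt i) (pmap g y)) \<and> a = smap i (\<rho> y) b"
    if "y \<in> pts (src g)" "a \<in> carrier (stalk (src i) (\<rho> y))" for y a
    using closed_immersion_surj[OF \<rho>(1)[OF that(1)]] \<rho>(2)[OF that(1)] that(2) by auto
  define h where "h = \<lparr>src = src g, tgt = src i, pmap = restrict \<rho> (pts (src g)),
    smap = (\<lambda>y\<in>pts (src g). \<lambda>a\<in>carrier (stalk (src i) (\<rho> y)). \<sigma> y a)\<rparr>"
  have hs: "src h = src g" "tgt h = src i"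
    and hp: "\<And>y. y \<in> pts (src g) \<Longrightarrow> pmap h y = \<rho> y"
    and hm: "\<And>y a. y \<in> pts (src g) \<Longrightarrow> a \<in> carrier (stalk (src i) (\<rho> y)) \<Longrightarrow> smap h y a = \<sigma> y a"
    by (simp_all add: h_def)
  have hb: "smap h y (smap i (\<rho> y) b) = smap g y b"
    if y: "y \<in> pts (src g)" and b: "b \<in> carrier (stalk (tgt i) (pmap g y))" for y b
    using hm[OF y] \<sigma>[OF y b] mor_closed[OF im \<rho>(1)[OF y]] \<rho>(2)[OF y] b by simp
  have "is_mor h"
  proof (rule is_morI)
    have pre: "{y \<in> pts (src g). \<rho> y \<in> {z \<in> pts (src i). pmap i z \<in> U}} = {y \<in> pts (src g). pmap g y \<in> U}" for U
      using \<rho> by auto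
    show "continuous_map (sp (src h)) (sp (tgt h)) (pmap h)"
      unfolding continuous_map_def hs
    proof (intro conjI allI impI)
      show "pmap h \<in> pts (src g) \<rightarrow> pts (src i)" using hp \<rho> by auto
      fix V assume "openin (sp (src i)) V"
      then obtain U where U: "openin (sp (tgt i)) U" "V = {z \<in> pts (src i). pmap i z \<in> U}"
        using closed_immersion_open by blast
      have "{y \<in> pts (src g). pmap h y \<in> V} = {y \<in> pts (src g). pmap g y \<in> U}"
        using hp pre[of U] U by auto
      then show "openin (sp (src g)) {y \<in> pts (src g). pmap h y \<in> V}"
        using mor_open_preimage[OF g(1)] U g(2) by simp
    qed
    fix y assume "y \<in> pts (src h)"
    then have y: "y \<in> pts (src g)" by (simp add: hs)
    interpret I: ring_hom_cring "stalk (tgt i) (pmap g y)" "stalk (src i) (\<rho> y)" "smap i (\<rho> y)"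
      using mor_hom_cring[OF im \<rho>(1)[OF y]] \<rho>(2)[OF y] by simp
    interpret G: ring_hom_cring "stalk (tgt i) (pmap g y)" "stalk (src g) y" "smap g y"
      using mor_hom_cring[OF g(1) y] g(2) by simp
    show "smap h y \<in> ring_hom (stalk (tgt h) (pmap h y)) (stalk (src h) y)"
      unfolding hs hp[OF y]
    proof (rule ring_hom_memI)
      fix a a' assume "a \<in> carrier (stalk (src i) (\<rho> y))" "a' \<in> carrier (stalk (src i) (\<rho> y))"
      then obtain b b' where b: "b \<in> carrier (stalk (tgt i) (pmap g y))" "a = smap i (\<rho> y) b"
        "b' \<in> carrier (stalk (tgt i) (pmap g y))" "a' = smap i (\<rho> y) b'"
        using lift[OF y] by metis
      show "smap h y a \<in> carrier (stalk (src g) y)"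
        using b hb[OF y] by simp
      show "smap h y (a \<otimes>\<^bsub>stalk (src i) (\<rho> y)\<^esub> a') = smap h y a \<otimes>\<^bsub>stalk (src g) y\<^esub> smap h y a'"
        using b hb[OF y b(1)] hb[OF y b(3)]
          hb[OF y, of "b \<otimes>\<^bsub>stalk (tgt i) (pmap g y)\<^esub> b'"] by simp
      show "smap h y (a \<oplus>\<^bsub>stalk (src i) (\<rho> y)\<^esub> a') = smap h y a \<oplus>\<^bsub>stalk (src g) y\<^esub> smap h y a'"
        using b hb[OF y b(1)] hb[OF y b(3)]
          hb[OF y, of "b \<oplus>\<^bsub>stalk (tgt i) (pmap g y)\<^esub> b'"] by simp
    next
      show "smap h y \<one>\<^bsub>stalk (src i) (\<rho> y)\<^esub> = \<one>\<^bsub>stalk (src g) y\<^esub>"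
        using hb[OF y, of "\<one>\<^bsub>stalk (tgt i) (pmap g y)\<^esub>"] by simp
    qed
    show "smap h y \<in> extensional (carrier (stalk (tgt h) (pmap h y)))"
      unfolding hs hp[OF y] using y by (simp add: h_def)
    fix a assume a: "a \<in> carrier (stalk (tgt h) (pmap h y))" "smap h y a \<in> Units (stalk (src h) y)"
    then obtain b where b: "b \<in> carrier (stalk (tgt i) (pmap g y))" "a = smap i (\<rho> y) b"
      using lift[OF y, of a] by (auto simp: hs hp[OF y])
    \<comment> \<open>Locality passes from \<open>g\<close> to \<open>h\<close>: the lift
      \<open>b\<close> has a unit as image under \<open>g\<close>, hence is a unit, and so is its
      image \<open>a\<close>.\<close>
    then have "b \<in> Units (stalk (tgt i) (pmap g y))"
      using a hb[OF y] mor_local[OF g(1) y] g(2) hs by simp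
    then show "a \<in> Units (stalk (tgt h) (pmap h y))"
      unfolding hs hp[OF y] b(2) by (rule ring_hom_Units[OF I.homh _ I.R.is_cring I.S.is_cring])
  next
    fix V s assume "openin (sp (tgt h)) V" "s \<in> sect (tgt h) V"
    then have V: "openin (sp (src i)) V" and s: "s \<in> sect (src i) V" by (simp_all add: hs)
    obtain U where U: "openin (sp (tgt i)) U" "V = {z \<in> pts (src i). pmap i z \<in> U}"
      using closed_immersion_open[OF V] by blast
    have Vg: "{y \<in> pts (src g). \<rho> y \<in> V} = {y \<in> pts (src g). pmap g y \<in> U}"
      using U \<rho> by auto
    let ?t = "\<lambda>y\<in>{y \<in> pts (src g). \<rho> y \<in> V}. smap h y (s (\<rho> y))"
    have sc: "s z \<in> carrier (stalk (src i) z)" if "z \<in> V" for z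
      using lrs_sect_closed[OF mor_lrs(1)[OF im] V s that] .
    have hc: "smap h y a \<in> carrier (stalk (src g) y)"
      if y: "y \<in> pts (src g)" and a: "a \<in> carrier (stalk (src i) (\<rho> y))" for y a
      using lift[OF y a] hb[OF y] mor_closed[OF g(1) y] g(2) by auto
    \<comment> \<open>Sections of \<open>src i\<close> need not lift to sections of
      \<open>tgt i\<close>, but germs do. Near \<open>\<rho> y\<close> the section \<open>s\<close>
      is the image of a section \<open>t\<close> of the target, so near \<open>y\<close> its
      pullback along \<open>h\<close> is the pullback of \<open>t\<close> along \<open>g\<close>;
      the pieces are then glued.\<close>
    have "?t \<in> sect (src g) {y \<in> pts (src g). \<rho> y \<in> V}"
    proof (rule lrs_glue[OF mor_lrs(1)[OF g(1)]])
      show "openin (sp (src g)) {y \<in> pts (src g). \<rho> y \<in> V}"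
        unfolding Vg using mor_open_preimage[OF g(1)] U g(2) by simp
      show "?t \<in> (\<Pi>\<^sub>E y\<in>{y \<in> pts (src g). \<rho> y \<in> V}. carrier (stalk (src g) y))"
        using hc sc by (auto simp: PiE_def Pi_def)
      fix y assume "y \<in> {y \<in> pts (src g). \<rho> y \<in> V}"
      then have y: "y \<in> pts (src g)" "\<rho> y \<in> V" by auto
      obtain b where b: "b \<in> carrier (stalk (tgt i) (pmap g y))" "s (\<rho> y) = smap i (\<rho> y) b"
        using lift[OF y(1) sc[OF y(2)]] by blast
      have "pmap g y \<in> pts (tgt i)" using mor_pt[OF g(1) y(1)] g(2) by simp
      then obtain N t where N: "openin (sp (tgt i)) N" "pmap g y \<in> N" "t \<in> sect (tgt i) N" "t (pmap g y) = b"
        using lrs_germ[OF mor_lrs(2)[OF im] _ b(1)] by blast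
      let ?N = "{z \<in> pts (src i). pmap i z \<in> N}"
      let ?r = "\<lambda>z\<in>?N. smap i z (t (pmap i z))"
      have N': "openin (sp (src i)) ?N" by (rule mor_open_preimage[OF im N(1)])
      have V2: "openin (sp (src i)) (V \<inter> ?N)" using V N' by blast
      have r1: "restrict s (V \<inter> ?N) \<in> sect (src i) (V \<inter> ?N)"
        by (rule lrs_restrict[OF mor_lrs(1)[OF im] V V2 _ s]) auto
      have r2: "restrict ?r (V \<inter> ?N) \<in> sect (src i) (V \<inter> ?N)"
        by (rule lrs_restrict[OF mor_lrs(1)[OF im] N' V2 _ mor_sect[OF im N(1,3)]]) auto
      have yN: "\<rho> y \<in> V \<inter> ?N" using y \<rho>[OF y(1)] N by auto
      have "restrict s (V \<inter> ?N) (\<rho> y) = restrict ?r (V \<inter> ?N) (\<rho> y)"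
        using yN b \<rho>[OF y(1)] N by simp
      from lrs_germ_eq[OF mor_lrs(1)[OF im] V2 r1 r2 yN this]
      obtain V3 where V3: "openin (sp (src i)) V3" "\<rho> y \<in> V3" "V3 \<subseteq> V \<inter> ?N"
        "\<And>z. z \<in> V3 \<Longrightarrow> restrict s (V \<inter> ?N) z = restrict ?r (V \<inter> ?N) z" by blast
      obtain M where M: "openin (sp (tgt i)) M" "V3 = {z \<in> pts (src i). pmap i z \<in> M}"
        using closed_immersion_open[OF V3(1)] by blast
      let ?M = "{y \<in> pts (src g). pmap g y \<in> M \<inter> N}"
      have MN: "openin (sp (tgt i)) (M \<inter> N)" using M N by blast
      have Mo: "openin (sp (src g)) ?M" using mor_open_preimage[OF g(1), of "M \<inter> N"] MN g(2) by simp
      have inV3: "\<rho> x \<in> V3" if "x \<in> ?M" for x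
        using that \<rho>[of x] M by auto
      have sub: "?M \<subseteq> {y \<in> pts (src g). \<rho> y \<in> V}" using inV3 V3(3) by auto
      have "restrict t (M \<inter> N) \<in> sect (tgt i) (M \<inter> N)"
        by (rule lrs_restrict[OF mor_lrs(2)[OF im] N(1) MN _ N(3)]) auto
      with MN have "(\<lambda>x\<in>?M. smap g x (restrict t (M \<inter> N) (pmap g x))) \<in> sect (src g) ?M"
        using mor_sect[OF g(1), of "M \<inter> N" "restrict t (M \<inter> N)"] g(2) by simp
      also have "(\<lambda>x\<in>?M. smap g x (restrict t (M \<inter> N) (pmap g x))) = restrict ?t ?M"
      proof (rule extensionalityI[of _ ?M])
        fix x assume x: "x \<in> ?M"
        then have xs: "x \<in> pts (src g)" "pmap g x \<in> M" "pmap g x \<in> N" by auto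
        have "s (\<rho> x) = smap i (\<rho> x) (t (pmap g x))"
        proof -
          have "\<rho> x \<in> V \<inter> ?N" using V3(3) inV3[OF x] by blast
          then show ?thesis using V3(4)[OF inV3[OF x]] \<rho>[OF xs(1)] by simp
        qed
        moreover have "t (pmap g x) \<in> carrier (stalk (tgt i) (pmap g x))"
          using lrs_sect_closed[OF mor_lrs(2)[OF im] N(1,3) xs(3)] .
        ultimately show "(\<lambda>x\<in>?M. smap g x (restrict t (M \<inter> N) (pmap g x))) x = restrict ?t ?M x"
          using x xs sub hb[OF xs(1)] by auto
      qed (auto simp: extensional_def)
      finally have "restrict ?t ?M \<in> sect (src g) ?M" .
      moreover have "y \<in> ?M" using y N V3(2) M(2) \<rho>[OF y(1)] by auto
      ultimately show "\<exists>V'. openin (sp (src g)) V' \<and> y \<in> V' \<and> V' \<subseteq> {y \<in> pts (src g). \<rho> y \<in> V} \<and>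
          restrict ?t V' \<in> sect (src g) V'"
        using Mo sub by blast
    qed
    moreover have "{y \<in> pts (src h). pmap h y \<in> V} = {y \<in> pts (src g). \<rho> y \<in> V}"
      using hp hs by auto
    moreover have "(\<lambda>y\<in>{y \<in> pts (src g). \<rho> y \<in> V}. smap h y (s (pmap h y))) = ?t"
      by (rule restrict_ext) (simp add: hp)
    ultimately show "(\<lambda>y\<in>{y \<in> pts (src h). pmap h y \<in> V}. smap h y (s (pmap h y)))
        \<in> sect (src h) {y \<in> pts (src h). pmap h y \<in> V}"
      by (simp only: hs)
  qed (use mor_lrs[OF im] mor_lrs[OF g(1)] in \<open>simp_all add: hs\<close>, simp_all add: h_def)
  moreover from this have "i \<circ>\<^sub>s h = g"
    by (intro mor_eqI is_mor_comp)
      (use im g hs hp \<rho> hb in \<open>auto simp: pmap_comp smap_comp\<close>)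
  ultimately show thesis using that hs by blast
qed

end

text \<open>Since \<open>u\<close> is injective, the image of a closed set under \<open>h\<close> is
  the preimage under \<open>u\<close> of its closed image under the composite; this makes
  \<open>h\<close> a closed embedding. On stalks, the composite can only be surjective if its last
  factor \<open>smap h x\<close> is.\<close>

lemma closed_immersion_cancel:
  assumes u: "closed_immersion u" and r: "closed_immersion (u \<circ>\<^sub>s h)"
    and h: "sch_mor h" "tgt h = src u"
  shows "closed_immersion h"
  unfolding closed_immersion_def
proof (intro conjI ballI)
  note hm = sch_mor_is_mor[OF h(1)]
  note um = closed_immersion_is_mor[OF u]
  have pt: "pmap h x \<in> pts (src u)" if "x \<in> pts (src h)" for x
    using mor_pt[OF hm that] h(2) by simp
  have image: "pmap h ` C = {z \<in> pts (src u). pmap u z \<in> pmap (u \<circ>\<^sub>s h) ` C}" if C: "C \<subseteq> pts (src h)" for C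
  proof -
    have "pmap (u \<circ>\<^sub>s h) ` C = pmap u ` pmap h ` C"
      unfolding image_image using C by (intro image_cong) (auto simp: pmap_comp)
    moreover have "pmap h ` C \<subseteq> pts (src u)" using C pt by blast
    moreover from this have "z \<in> pmap h ` C \<longleftrightarrow> pmap u z \<in> pmap u ` pmap h ` C" if "z \<in> pts (src u)" for z
      using inj_on_image_mem_iff[OF closed_immersion_inj[OF u] that] by blast
    ultimately show ?thesis by blast
  qed
  show "sch_mor h" by fact
  show cl: "closedin (sp (tgt h)) (pmap h ` pts (src h))"
  proof -
    have "closedin (sp (tgt u)) (pmap (u \<circ>\<^sub>s h) ` pts (src h))"
      using closed_immersion_closedin[OF r] by simp
    then show ?thesis
      using mor_continuous[OF um] h(2) image[OF order_refl] by (simp add: continuous_map_closedin)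
  qed
  have "closed_map (sp (src h)) (sp (tgt h)) (pmap h)"
    unfolding closed_map_def
  proof (intro allI impI)
    fix C assume C: "closedin (sp (src h)) C"
    have "closed_map (sp (src h)) (sp (tgt u)) (pmap (u \<circ>\<^sub>s h))"
      using embedding_imp_closed_map[OF closed_immersion_embedding[OF r] closed_immersion_closedin[OF r]]
      by simp
    then have "closedin (sp (tgt u)) (pmap (u \<circ>\<^sub>s h) ` C)" using C by (simp add: closed_map_def)
    then show "closedin (sp (tgt h)) (pmap h ` C)"
      using mor_continuous[OF um] h(2) image[OF closedin_subset[OF C]]
      by (simp add: continuous_map_closedin)
  qed
  moreover have "inj_on (pmap h) (pts (src h))"
    using closed_immersion_inj[OF r] by (auto simp: inj_on_def pmap_comp)
  ultimately show "embedding_map (sp (src h)) (sp (tgt h)) (pmap h)"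
    using mor_continuous[OF hm] by (intro injective_closed_imp_embedding_map)
  fix x assume x: "x \<in> pts (src h)"
  have "carrier (stalk (src h) x)
      = smap (u \<circ>\<^sub>s h) x ` carrier (stalk (tgt u) (pmap u (pmap h x)))"
    using closed_immersion_surj[OF r, of x] x by (simp add: pmap_comp)
  also have "\<dots> = smap h x ` (smap u (pmap h x) ` carrier (stalk (tgt u) (pmap u (pmap h x))))"
    unfolding image_image by (rule image_cong) (use x in \<open>simp_all add: smap_comp\<close>)
  finally show "smap h x ` carrier (stalk (tgt h) (pmap h x)) = carrier (stalk (src h) x)"
    using closed_immersion_surj[OF u pt[OF x]] h(2) by simp
qed

section \<open>Spectra\<close>

locale localization_at_prime = primeideal I R for I and R :: "'r ring" (structure)
begin

abbreviation "frac_at \<equiv> fraction R (carrier R \<times> (carrier R - I))"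

lemma not_in_mult: "f \<in> carrier R - I \<Longrightarrow> g \<in> carrier R - I \<Longrightarrow> f \<otimes> g \<in> carrier R - I"
  using I_prime by blast

lemma one_not_in: "\<one> \<in> carrier R - I"
  using I_notcarr one_imp_carrier by auto

lemma frac_iff:
  assumes "a \<in> carrier R" "f \<in> carrier R - I"
  shows "(b, g) \<in> frac_at (a, f) \<longleftrightarrow>
    b \<in> carrier R \<and> g \<in> carrier R - I \<and> (\<exists>h\<in>carrier R - I. h \<otimes> (g \<otimes> a) = h \<otimes> (f \<otimes> b))"
proof -
  have snd: "snd ` (carrier R \<times> (carrier R - I)) = carrier R - I" by force
  have minus_zero: "x \<ominus> y = \<zero> \<longleftrightarrow> x = y" if "x \<in> carrier R" "y \<in> carrier R" for x y
    using that by (metis a_minus_def add.inv_closed minus_equality r_neg)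
  have "h \<otimes> (g \<otimes> a \<ominus> f \<otimes> b) = \<zero> \<longleftrightarrow> h \<otimes> (g \<otimes> a) = h \<otimes> (f \<otimes> b)"
    if "h \<in> carrier R" "b \<in> carrier R" "g \<in> carrier R" for h
  proof -
    have "h \<otimes> (g \<otimes> a \<ominus> f \<otimes> b) = h \<otimes> (g \<otimes> a) \<ominus> h \<otimes> (f \<otimes> b)"
      using that assms by (simp add: a_minus_def r_distr r_minus)
    then show ?thesis using minus_zero that assms by simp
  qed
  then show ?thesis unfolding fraction_def snd by auto
qed

lemma frac_self: "a \<in> carrier R \<Longrightarrow> f \<in> carrier R - I \<Longrightarrow> (a, f) \<in> frac_at (a, f)"
  using one_not_in by (auto simp: frac_iff)

lemma frac_trans:
  assumes af: "a \<in> carrier R" "f \<in> carrier R - I"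
    and bg: "(b, g) \<in> frac_at (a, f)" and ck: "(c, k) \<in> frac_at (b, g)"
  shows "(c, k) \<in> frac_at (a, f)"
proof -
  obtain h where h: "h \<in> carrier R - I" "h \<otimes> (g \<otimes> a) = h \<otimes> (f \<otimes> b)"
    and bg': "b \<in> carrier R" "g \<in> carrier R - I" using bg frac_iff[OF af] by auto
  obtain h' where h': "h' \<in> carrier R - I" "h' \<otimes> (k \<otimes> b) = h' \<otimes> (g \<otimes> c)"
    and ck': "c \<in> carrier R" "k \<in> carrier R - I" using ck frac_iff[OF bg'] by auto
  have C: "a \<in> carrier R" "b \<in> carrier R" "c \<in> carrier R" "f \<in> carrier R" "g \<in> carrier R"
    "k \<in> carrier R" "h \<in> carrier R" "h' \<in> carrier R"
    using af bg' ck' h h' by auto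
  \<comment> \<open>The middle denominator \<open>g\<close> has to join the multipliers
    \<open>h\<close> and \<open>h'\<close>: it is what lets each of the two given relations be
    substituted in turn.\<close>
  have "(h \<otimes> h' \<otimes> g) \<otimes> (k \<otimes> a) = (h' \<otimes> k) \<otimes> (h \<otimes> (g \<otimes> a))" using C by (simp add: m_ac)
  also have "\<dots> = (h \<otimes> f) \<otimes> (h' \<otimes> (k \<otimes> b))" unfolding h(2) using C by (simp add: m_ac)
  also have "\<dots> = (h \<otimes> h' \<otimes> g) \<otimes> (f \<otimes> c)" unfolding h'(2) using C by (simp add: m_ac)
  finally have "(h \<otimes> h' \<otimes> g) \<otimes> (k \<otimes> a) = (h \<otimes> h' \<otimes> g) \<otimes> (f \<otimes> c)" .
  moreover have "h \<otimes> h' \<otimes> g \<in> carrier R - I"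
    by (intro not_in_mult h h' bg')
  ultimately show ?thesis using frac_iff[OF af] ck' by blast
qed

lemma frac_eqI:
  assumes af: "a \<in> carrier R" "f \<in> carrier R - I" and bg: "b \<in> carrier R" "g \<in> carrier R - I"
    and h: "h \<in> carrier R - I" "h \<otimes> (g \<otimes> a) = h \<otimes> (f \<otimes> b)"
  shows "frac_at (a, f) = frac_at (b, g)"
proof -
  have "(b, g) \<in> frac_at (a, f)" "(a, f) \<in> frac_at (b, g)"
    using frac_iff[OF af] frac_iff[OF bg] assms by metis+
  then have "(c, k) \<in> frac_at (a, f) \<longleftrightarrow> (c, k) \<in> frac_at (b, g)" for c k
    using frac_trans[OF af] frac_trans[OF bg] by blast
  then show ?thesis by auto
qed

text \<open>\<open>fraction_ring\<close> defines the product as a union over all representatives, so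
  the content is that every choice of representatives yields the same class. The same holds for the
  sum below.\<close>

lemma frac_mult:
  assumes af: "a \<in> carrier R" "f \<in> carrier R - I" and bg: "b \<in> carrier R" "g \<in> carrier R - I"
  shows "frac_at (a, f) \<otimes>\<^bsub>fraction_ring R (carrier R \<times> (carrier R - I))\<^esub> frac_at (b, g)
    = frac_at (a \<otimes> b, f \<otimes> g)"
proof -
  have "frac_at (a' \<otimes> b', f' \<otimes> g') = frac_at (a \<otimes> b, f \<otimes> g)"
    if mem: "(a', f') \<in> frac_at (a, f)" "(b', g') \<in> frac_at (b, g)" for a' f' b' g'
  proof -
    obtain h where h: "h \<in> carrier R - I" "h \<otimes> (f' \<otimes> a) = h \<otimes> (f \<otimes> a')"
      and a': "a' \<in> carrier R" "f' \<in> carrier R - I" using mem(1) frac_iff[OF af] by auto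
    obtain k where k: "k \<in> carrier R - I" "k \<otimes> (g' \<otimes> b) = k \<otimes> (g \<otimes> b')"
      and b': "b' \<in> carrier R" "g' \<in> carrier R - I" using mem(2) frac_iff[OF bg] by auto
    have C: "a \<in> carrier R" "b \<in> carrier R" "f \<in> carrier R" "g \<in> carrier R" "h \<in> carrier R"
      "k \<in> carrier R" "a' \<in> carrier R" "b' \<in> carrier R" "f' \<in> carrier R" "g' \<in> carrier R"
      using assms a' b' h k by auto
    have "(h \<otimes> k) \<otimes> ((f \<otimes> g) \<otimes> (a' \<otimes> b')) = (h \<otimes> (f \<otimes> a')) \<otimes> (k \<otimes> (g \<otimes> b'))"
      using C by (simp add: m_ac)
    also have "\<dots> = (h \<otimes> k) \<otimes> ((f' \<otimes> g') \<otimes> (a \<otimes> b))"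
      unfolding h(2)[symmetric] k(2)[symmetric] using C by (simp add: m_ac)
    finally show ?thesis
      using C by (intro frac_eqI[where h = "h \<otimes> k"] not_in_mult h k af bg a' b') auto
  qed
  moreover have "frac_at (a, f) \<noteq> {}" "frac_at (b, g) \<noteq> {}" using frac_self assms by blast+
  ultimately show ?thesis unfolding fraction_ring_def by fastforce
qed

lemma frac_add:
  assumes af: "a \<in> carrier R" "f \<in> carrier R - I" and bg: "b \<in> carrier R" "g \<in> carrier R - I"
  shows "frac_at (a, f) \<oplus>\<^bsub>fraction_ring R (carrier R \<times> (carrier R - I))\<^esub> frac_at (b, g)
    = frac_at (g \<otimes> a \<oplus> f \<otimes> b, f \<otimes> g)"
proof -
  have "frac_at (g' \<otimes> a' \<oplus> f' \<otimes> b', f' \<otimes> g') = frac_at (g \<otimes> a \<oplus> f \<otimes> b, f \<otimes> g)"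
    if mem: "(a', f') \<in> frac_at (a, f)" "(b', g') \<in> frac_at (b, g)" for a' f' b' g'
  proof -
    obtain h where h: "h \<in> carrier R - I" "h \<otimes> (f' \<otimes> a) = h \<otimes> (f \<otimes> a')"
      and a': "a' \<in> carrier R" "f' \<in> carrier R - I" using mem(1) frac_iff[OF af] by auto
    obtain k where k: "k \<in> carrier R - I" "k \<otimes> (g' \<otimes> b) = k \<otimes> (g \<otimes> b')"
      and b': "b' \<in> carrier R" "g' \<in> carrier R - I" using mem(2) frac_iff[OF bg] by auto
    have C: "a \<in> carrier R" "b \<in> carrier R" "f \<in> carrier R" "g \<in> carrier R" "h \<in> carrier R"
      "k \<in> carrier R" "a' \<in> carrier R" "b' \<in> carrier R" "f' \<in> carrier R" "g' \<in> carrier R"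
      using assms a' b' h k by auto
    have "(h \<otimes> k) \<otimes> ((f \<otimes> g) \<otimes> (g' \<otimes> a' \<oplus> f' \<otimes> b'))
        = (k \<otimes> g \<otimes> g') \<otimes> (h \<otimes> (f \<otimes> a')) \<oplus> (h \<otimes> f \<otimes> f') \<otimes> (k \<otimes> (g \<otimes> b'))"
      using C by (simp add: r_distr m_ac)
    also have "\<dots> = (h \<otimes> k) \<otimes> ((f' \<otimes> g') \<otimes> (g \<otimes> a \<oplus> f \<otimes> b))"
      unfolding h(2)[symmetric] k(2)[symmetric] using C by (simp add: r_distr m_ac)
    finally show ?thesis
      using C by (intro frac_eqI[where h = "h \<otimes> k"] not_in_mult h k af bg a' b') auto
  qed
  moreover have "frac_at (a, f) \<noteq> {}" "frac_at (b, g) \<noteq> {}" using frac_self assms by blast+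
  ultimately show ?thesis unfolding fraction_ring_def by fastforce
qed

lemma frac_pow:
  assumes af: "a \<in> carrier R" "f \<in> carrier R - I"
  shows "f [^] n \<in> carrier R - I" (is ?th1)
    "frac_at (a, f) [^]\<^bsub>fraction_ring R (carrier R \<times> (carrier R - I))\<^esub> (n :: nat) = frac_at (a [^] n, f [^] n)" (is ?th2)
proof -
  have "?th1 \<and> ?th2"
  proof (induction n)
    case 0
    then show ?case using one_not_in by (simp add: nat_pow_def fraction_ring_def)
  next
    case (Suc n)
    \<comment> \<open>Unfolds the recursion of powers in an arbitrary structure, so that no ring
      axioms for the fraction ring enter.\<close>
    have "x [^]\<^bsub>G\<^esub> Suc n = x [^]\<^bsub>G\<^esub> n \<otimes>\<^bsub>G\<^esub> x" for x and G :: "('r \<times> 'r) set ring"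
      by (simp add: nat_pow_def)
    then show ?case
      using Suc af not_in_mult[of "f [^] n" f] frac_mult[of "a [^] n" "f [^] n" a f] by simp
  qed
  then show ?th1 ?th2 by blast+
qed

lemma frac_Unit:
  assumes "a \<in> carrier R - I" "f \<in> carrier R - I"
  shows "frac_at (a, f) \<in> Units (fraction_ring R (carrier R \<times> (carrier R - I)))"
proof -
  have "frac_at (a \<otimes> f, f \<otimes> a) = frac_at (\<one>, \<one>)" "frac_at (f \<otimes> a, a \<otimes> f) = frac_at (\<one>, \<one>)"
    using assms one_not_in
    by (intro frac_eqI[where h = \<one>] not_in_mult; simp add: m_comm)+
  then have "frac_at (a, f) \<otimes>\<^bsub>fraction_ring R (carrier R \<times> (carrier R - I))\<^esub> frac_at (f, a) = frac_at (\<one>, \<one>)"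
    "frac_at (f, a) \<otimes>\<^bsub>fraction_ring R (carrier R \<times> (carrier R - I))\<^esub> frac_at (a, f) = frac_at (\<one>, \<one>)"
    using assms by (simp_all add: frac_mult)
  moreover have "frac_at (a, f) \<in> carrier (fraction_ring R (carrier R \<times> (carrier R - I)))"
    "frac_at (f, a) \<in> carrier (fraction_ring R (carrier R \<times> (carrier R - I)))"
    using assms by (auto simp: fraction_ring_def)
  moreover have "\<one>\<^bsub>fraction_ring R (carrier R \<times> (carrier R - I))\<^esub> = frac_at (\<one>, \<one>)"
    by (simp add: fraction_ring_def)
  ultimately show ?thesis unfolding Units_def by auto
qed

end

section \<open>Topology and sections of a spectrum\<close>

lemma Spec_simps:
  "sp (Spec R) = topology_generated_by ((\<lambda>f. {P \<in> {P. primeideal P R}. f \<notin> P}) ` carrier R)"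
  "stalk (Spec R) P = fraction_ring R (carrier R \<times> (carrier R - P))"
  by (simp_all add: Spec_def fraction_space_def Let_def)

lemma Spec_sect_iff:
  "s \<in> sect (Spec R) U \<longleftrightarrow>
    s \<in> (\<Pi>\<^sub>E P\<in>U. carrier (stalk (Spec R) P)) \<and>
    (\<forall>P\<in>U. \<exists>V af. openin (sp (Spec R)) V \<and> P \<in> V \<and> V \<subseteq> U \<and>
      (\<forall>Q\<in>V. af \<in> carrier R \<times> (carrier R - Q) \<and> s Q = fraction R (carrier R \<times> (carrier R - Q)) af))"
  by (simp add: Spec_def fraction_space_def Let_def)

lemma pts_Spec:
  fixes R (structure)
  assumes "cring R" shows "pts (Spec R) = {P. primeideal P R}"
proof -
  interpret cring R by fact
  have "\<one> \<notin> P" if "primeideal P R" for P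
    using localization_at_prime.one_not_in[OF localization_at_prime.intro[OF that]] by blast
  then show ?thesis unfolding Spec_simps topology_generated_by_topspace by auto
qed

text \<open>The basic sets are only given as generators of the topology. They form a basis because a
  prime avoids \<open>f \<otimes> g\<close> exactly when it avoids both factors. The induction
  treats all points of \<open>V\<close> at once, as the case of intersections requires.\<close>

lemma Spec_basis:
  fixes R (structure)
  assumes "cring R" "openin (sp (Spec R)) V" "P \<in> V"
  obtains g where "g \<in> carrier R" "g \<notin> P" "{Q. primeideal Q R \<and> g \<notin> Q} \<subseteq> V"
proof -
  interpret cring R by fact
  have "generate_topology_on ((\<lambda>f. {P \<in> {P. primeideal P R}. f \<notin> P}) ` carrier R) V"
    using assms(2) openin_topology_generated_by unfolding Spec_simps by blast
  then have "\<forall>P\<in>V. primeideal P R \<and> (\<exists>g\<in>carrier R. g \<notin> P \<and> {Q. primeideal Q R \<and> g \<notin> Q} \<subseteq> V)"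
  proof (induction V rule: generate_topology_on.induct)
    case (Int A B)
    show ?case
    proof
      fix P assume P: "P \<in> A \<inter> B"
      then obtain f g where fg: "f \<in> carrier R" "f \<notin> P" "{Q. primeideal Q R \<and> f \<notin> Q} \<subseteq> A"
        "g \<in> carrier R" "g \<notin> P" "{Q. primeideal Q R \<and> g \<notin> Q} \<subseteq> B" "primeideal P R"
        using Int.IH by (meson IntD1 IntD2)
      have "f \<otimes> g \<notin> P" using primeideal.I_prime[OF fg(7,1,4)] fg by blast
      moreover have "f \<notin> Q \<and> g \<notin> Q" if "primeideal Q R" "f \<otimes> g \<notin> Q" for Q
        using that fg(1,4) ideal.I_l_closed ideal.I_r_closed primeideal.axioms(1)[OF that(1)] by metis
      then have "{Q. primeideal Q R \<and> f \<otimes> g \<notin> Q} \<subseteq> A \<inter> B" using fg(3,6) by blast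
      ultimately show "primeideal P R \<and>
          (\<exists>g\<in>carrier R. g \<notin> P \<and> {Q. primeideal Q R \<and> g \<notin> Q} \<subseteq> A \<inter> B)"
        using fg by (intro conjI bexI[of _ "f \<otimes> g"]) auto
    qed
  next
    case (UN K)
    show ?case
    proof
      fix P assume "P \<in> \<Union>K"
      then obtain k where k: "k \<in> K" "P \<in> k" by blast
      then obtain g where "g \<in> carrier R" "g \<notin> P" "{Q. primeideal Q R \<and> g \<notin> Q} \<subseteq> k" "primeideal P R"
        using UN.IH[OF k(1)] by blast
      then show "primeideal P R \<and>
          (\<exists>g\<in>carrier R. g \<notin> P \<and> {Q. primeideal Q R \<and> g \<notin> Q} \<subseteq> \<Union>K)"
        using k(1) by (intro conjI bexI[of _ g]) auto
    qed
  qed auto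
  then show thesis using assms(3) that by blast
qed

text \<open>Near \<open>P\<close>, on the primes avoiding some \<open>g\<close>, the section is a
  single fraction with numerator \<open>a\<close> and denominator \<open>f\<close>. A prime
  \<open>Q\<close> contains \<open>g\<close>, or else the fraction is a nonunit at \<open>Q\<close>
  and \<open>Q\<close> contains \<open>a\<close>. Hence \<open>a \<otimes> g\<close> lies in every
  prime and is nilpotent. As \<open>g\<close> is not in \<open>P\<close>, its power can be cancelled
  in the stalk at \<open>P\<close>.\<close>

lemma Spec_nonunit_nilpotent:
  fixes R (structure)
  assumes R: "cring R" and V: "openin (sp (Spec R)) V" and s: "s \<in> sect (Spec R) V"
    and nonunit: "\<And>Q. Q \<in> V \<Longrightarrow> s Q \<notin> Units (stalk (Spec R) Q)" and P: "P \<in> V"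
  shows "\<exists>n::nat. s P [^]\<^bsub>stalk (Spec R) P\<^esub> n = \<zero>\<^bsub>stalk (Spec R) P\<^esub>"
proof -
  interpret cring R by fact
  obtain V' a f where V': "openin (sp (Spec R)) V'" "P \<in> V'" "V' \<subseteq> V"
    and af: "\<And>Q. Q \<in> V' \<Longrightarrow> a \<in> carrier R \<and> f \<in> carrier R - Q \<and>
      s Q = fraction R (carrier R \<times> (carrier R - Q)) (a, f)"
  proof -
    obtain V' af where "openin (sp (Spec R)) V'" "P \<in> V'" "V' \<subseteq> V"
      "\<forall>Q\<in>V'. af \<in> carrier R \<times> (carrier R - Q) \<and> s Q = fraction R (carrier R \<times> (carrier R - Q)) af"
      using s P unfolding Spec_sect_iff by blast
    then show thesis by (intro that[of V' "fst af" "snd af"]) auto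
  qed
  obtain g where g: "g \<in> carrier R" "g \<notin> P" "{Q. primeideal Q R \<and> g \<notin> Q} \<subseteq> V'"
    using Spec_basis[OF R V'(1,2)] by blast
  have a: "a \<in> carrier R" using af V'(2) by blast
  have prime: "primeideal Q R" if "Q \<in> V" for Q
    using openin_subset[OF V] that pts_Spec[OF R] by auto
  have ag: "a \<otimes> g \<in> Q" if Q: "primeideal Q R" for Q
  proof (cases "g \<in> Q")
    case True
    then show ?thesis using ideal.I_l_closed[OF primeideal.axioms(1)[OF Q]] a by blast
  next
    case False
    then have QV: "Q \<in> V'" using g Q by blast
    have "a \<in> Q"
    proof (rule ccontr)
      assume "a \<notin> Q"
      then have "s Q \<in> Units (stalk (Spec R) Q)"
        using localization_at_prime.frac_Unit[OF localization_at_prime.intro[OF Q]] af[OF QV] unfolding Spec_simps by auto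
      then show False using nonunit QV V' by blast
    qed
    then show ?thesis using ideal.I_r_closed[OF primeideal.axioms(1)[OF Q]] g by blast
  qed
  have "\<exists>n::nat. (a \<otimes> g) [^] n = \<zero>"
    using non_nilpotent_avoided_by_prime[of "a \<otimes> g"] ag a g by blast
  then obtain n :: nat where n: "(a \<otimes> g) [^] n = \<zero>" by blast
  interpret P: localization_at_prime P R using prime P by (simp add: localization_at_prime_def)
  have f: "f \<in> carrier R - P" "s P = P.frac_at (a, f)" using af[OF V'(2)] by auto
  note pow = P.frac_pow[OF a f(1), of n] and gn = P.frac_pow(1)[OF a, of g n]
  have "P.frac_at (a [^] n, f [^] n) = P.frac_at (\<zero>, \<one>)"
  proof (rule P.frac_eqI[where h = "g [^] n"])
    have "g [^] n \<otimes> (\<one> \<otimes> a [^] n) = (a \<otimes> g) [^] n"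
      using a g nat_pow_distrib[of a g n] by (simp add: m_comm)
    also have "\<dots> = g [^] n \<otimes> (f [^] n \<otimes> \<zero>)" using n f g by simp
    finally show "g [^] n \<otimes> (\<one> \<otimes> a [^] n) = g [^] n \<otimes> (f [^] n \<otimes> \<zero>)" .
  qed (use a g pow gn P.one_not_in in auto)
  then have "s P [^]\<^bsub>stalk (Spec R) P\<^esub> n = \<zero>\<^bsub>stalk (Spec R) P\<^esub>"
    using f pow unfolding Spec_simps by (simp add: fraction_ring_def)
  then show ?thesis by blast
qed

lemma ring_hom_nat_pow:
  assumes "ring_hom_cring R S h" "a \<in> carrier R"
  shows "h (a [^]\<^bsub>R\<^esub> (n :: nat)) = h a [^]\<^bsub>S\<^esub> n"
proof -
  interpret ring_hom_cring R S h by fact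
  show ?thesis using assms(2) by (induction n) auto
qed

text \<open>On an affine neighbourhood of \<open>x\<close>, the inverse \<open>g\<close> of the
  chart \<open>f\<close> pulls \<open>s\<close> back to a spectrum; \<open>g\<close> is local, so
  nonunits stay nonunits there, and \<open>f\<close> carries the nilpotence back to
  \<open>x\<close>. Charts are essential: on a one-point locally ringed space whose stalk is a
  discrete valuation ring, a uniformizer is a nonunit that is not nilpotent.\<close>

lemma scheme_nonunit_nilpotent:
  assumes X: "scheme X" and U: "openin (sp X) U" and s: "s \<in> sect X U"
    and nonunit: "\<And>y. y \<in> U \<Longrightarrow> s y \<notin> Units (stalk X y)" and x: "x \<in> U"
  shows "\<exists>n::nat. s x [^]\<^bsub>stalk X x\<^esub> n = \<zero>\<^bsub>stalk X x\<^esub>"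
proof -
  have xX: "x \<in> pts X" using openin_subset[OF U] x by blast
  note L = scheme_lrs[OF X]
  obtain A where A: "openin (sp X) A" "x \<in> A" "affine_scheme (open_sub X A)"
    using X xX by (auto simp: scheme_def)
  let ?A = "open_sub X A"
  obtain R :: "('a \<Rightarrow> 'b) ring" where R: "cring R" "isomorphic ?A (Spec R)"
    using A by (auto simp: affine_scheme_def)
  obtain f g where f: "is_mor f" "src f = ?A" "tgt f = Spec R"
    and g: "is_mor g" "src g = Spec R" "tgt g = ?A" and gf: "g \<circ>\<^sub>s f = id_mor ?A"
    using R(2) unfolding isomorphic_def is_iso_def by auto
  have ptsA: "pts ?A = A" using openin_subset[OF A(1)] by (auto simp: open_sub_def)
  have stalkA: "stalk ?A y = stalk X y" and sectA: "sect ?A W = sect X W" for y W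
    by (simp_all add: open_sub_def)
  let ?U = "U \<inter> A"
  have UA: "openin (sp X) ?U" using U A by blast
  then have UA': "openin (sp ?A) ?U"
    by (simp add: open_sub_def openin_open_subtopology A)
  have sA: "restrict s ?U \<in> sect ?A ?U"
    unfolding sectA by (rule lrs_restrict[OF L U UA _ s]) auto
  let ?V = "{P \<in> pts (Spec R). pmap g P \<in> ?U}"
  let ?t = "\<lambda>P\<in>?V. smap g P (restrict s ?U (pmap g P))"
  have V: "openin (sp (Spec R)) ?V" using mor_open_preimage[OF g(1), of ?U] UA' g by simp
  have t: "?t \<in> sect (Spec R) ?V" using mor_sect[OF g(1), of ?U "restrict s ?U"] UA' sA g by simp
  have sc: "s y \<in> carrier (stalk X y)" if "y \<in> ?U" for y
    using lrs_sect_closed[OF L U s] that by blast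
  have tn: "?t P \<notin> Units (stalk (Spec R) P)" if P: "P \<in> ?V" for P
  proof
    assume "?t P \<in> Units (stalk (Spec R) P)"
    then have "s (pmap g P) \<in> Units (stalk X (pmap g P))"
      using mor_local[OF g(1), of P "s (pmap g P)"] P g sc by (simp add: stalkA)
    then show False using nonunit P by blast
  qed
  let ?P = "pmap f x"
  have gP: "pmap g ?P = x" "?P \<in> ?V"
  proof -
    show "pmap g ?P = x" using pmap_comp[of x f g] gf f ptsA A(2) by (simp add: pmap_id)
    then show "?P \<in> ?V" using mor_pt[OF f(1)] f ptsA A(2) x by simp
  qed
  obtain n :: nat where n: "?t ?P [^]\<^bsub>stalk (Spec R) ?P\<^esub> n = \<zero>\<^bsub>stalk (Spec R) ?P\<^esub>"
    using Spec_nonunit_nilpotent[OF R(1) V t tn gP(2)] by blast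
  have xf: "x \<in> pts (src f)" using f ptsA A(2) by simp
  interpret F: ring_hom_cring "stalk (Spec R) ?P" "stalk X x" "smap f x"
    using mor_hom_cring[OF f(1) xf] f by (simp add: stalkA)
  have tP: "?t ?P = smap g ?P (s x)" using gP x A by simp
  have tc: "?t ?P \<in> carrier (stalk (Spec R) ?P)"
    using lrs_sect_closed[OF mor_lrs(2)[OF f(1)], of ?V ?t ?P] V t gP f by simp
  have "smap f x (?t ?P) = s x"
    using smap_comp[OF xf, of "s x" g] g gf gP sc[of x] x A ptsA unfolding tP
    by (simp add: stalkA smap_id)
  then have "s x [^]\<^bsub>stalk X x\<^esub> n = smap f x (?t ?P [^]\<^bsub>stalk (Spec R) ?P\<^esub> n)"
    using ring_hom_nat_pow[OF F.ring_hom_cring_axioms tc] by simp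
  also have "\<dots> = \<zero>\<^bsub>stalk X x\<^esub>" unfolding n by simp
  finally show ?thesis by blast
qed

text \<open>A section of the ideal of \<open>e\<close> is a nonunit at all points of the image of
  \<open>e\<close>. Because \<open>g\<close> is local and maps into this image, the pullback along
  \<open>g\<close> is a unit nowhere, hence nilpotent in each stalk, hence zero on the reduced
  source. So containment of sets of points already gives a factorisation.\<close>

lemma reduced_factor:
  assumes e: "closed_immersion e" and g: "sch_mor g" "tgt g = tgt e" and red: "reduced_scheme (src g)"
    and image: "pmap g ` pts (src g) \<subseteq> pmap e ` pts (src e)"
  obtains h where "sch_mor h" "src h = src g" "tgt h = src e" "e \<circ>\<^sub>s h = g"
proof -
  note gm = sch_mor_is_mor[OF g(1)]
  have Y: "scheme (src g)" using g by (simp add: sch_mor_def)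
  obtain h where "is_mor h" "src h = src g" "tgt h = src e" "e \<circ>\<^sub>s h = g"
  proof (rule closed_immersion_factor[OF e gm g(2) image])
    fix V s y assume V: "openin (sp (tgt e)) V" and s: "s \<in> ideal_sheaf e V"
      and y: "y \<in> pts (src g)" "pmap g y \<in> V"
    have sV: "s \<in> sect (tgt e) V" using s by (simp add: ideal_sheaf_def)
    let ?V = "{y \<in> pts (src g). pmap g y \<in> V}"
    let ?t = "\<lambda>y\<in>?V. smap g y (s (pmap g y))"
    have tV: "openin (sp (src g)) ?V" using mor_open_preimage[OF gm] V g(2) by simp
    have t: "?t \<in> sect (src g) ?V" using mor_sect[OF gm] V sV g(2) by simp
    have "?t y' \<notin> Units (stalk (src g) y')" if y': "y' \<in> ?V" for y'
    proof
      assume "?t y' \<in> Units (stalk (src g) y')"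
      moreover have "s (pmap g y') \<in> carrier (stalk (tgt g) (pmap g y'))"
        using lrs_sect_closed[OF mor_lrs(2)[OF gm]] V sV y' g(2) by simp
      ultimately have "s (pmap g y') \<in> Units (stalk (tgt g) (pmap g y'))"
        using mor_local[OF gm, of y'] y' by simp
      moreover obtain z where "z \<in> pts (src e)" "pmap e z = pmap g y'"
        using image y' by (metis (no_types, lifting) image_iff image_subset_iff mem_Collect_eq)
      ultimately show False
        using closed_immersion_zero_nonunit[OF e, of z "s (pmap g y')"] s y' g(2)
        by (auto simp: ideal_sheaf_def)
    qed
    from scheme_nonunit_nilpotent[OF Y tV t this, of y]
    obtain n :: nat where "?t y [^]\<^bsub>stalk (src g) y\<^esub> n = \<zero>\<^bsub>stalk (src g) y\<^esub>" using y by blast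
    moreover have "?t y \<in> carrier (stalk (src g) y)"
      using lrs_sect_closed[OF mor_lrs(1)[OF gm] tV t] y by blast
    ultimately have "?t y = \<zero>\<^bsub>stalk (src g) y\<^esub>"
      using red y unfolding reduced_scheme_def by blast
    then show "smap g y (s (pmap g y)) = \<zero>\<^bsub>stalk (src g) y\<^esub>" using y by simp
  qed
  then show thesis
    using that Y closed_immersion_sch_mor[OF e] by (auto simp: sch_mor_def)
qed

section \<open>One-point schemes\<close>

lemma field_local_ring:
  assumes "field F" shows "local_ring F"
proof -
  interpret field F by fact
  have "M = {\<zero>\<^bsub>F\<^esub>}" if "maximalideal M F" for M
  proof -
    interpret M: maximalideal M F by fact
    show ?thesis using all_ideals M.is_ideal M.I_notcarr by blast
  qed
  then show ?thesis unfolding local_ring_def using zeromaximalideal is_cring by blast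
qed

lemma field_primeideals:
  assumes "field F" shows "{P. primeideal P F} = {{\<zero>\<^bsub>F\<^esub>}}"
proof -
  interpret field F by fact
  have "P = {\<zero>\<^bsub>F\<^esub>}" if "primeideal P F" for P
    using all_ideals primeideal.axioms(1)[OF that] primeideal.I_notcarr[OF that] by blast
  then show ?thesis using zeroprimeideal by blast
qed

text \<open>A shape shared by the spectrum of a field and its copies in other types of points and
  stalks; isomorphisms between such spaces reduce to isomorphisms of their single stalks. The clause
  for \<open>U = {}\<close> allows exactly one section over the empty set.\<close>

definition point_space :: "('p, 's) lrs \<Rightarrow> 'p \<Rightarrow> bool"
  where "point_space X x \<longleftrightarrow> sp X = discrete_topology {x} \<and> local_ring (stalk X x) \<and>
    (\<forall>U\<subseteq>{x}. sect X U = (\<Pi>\<^sub>E y\<in>U. carrier (stalk X y)))"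

lemma section_ring_full_cring:
  assumes U: "sect X U = (\<Pi>\<^sub>E y\<in>U. carrier (stalk X y))" and R: "\<And>y. y \<in> U \<Longrightarrow> cring (stalk X y)"
  shows "cring (section_ring X U)"
proof (rule cringI)
  have mem: "s y \<in> carrier (stalk X y)" if "s \<in> (\<Pi>\<^sub>E y\<in>U. carrier (stalk X y))" "y \<in> U" for s y
    using that by (rule PiE_mem)
  have ext: "restrict f U = s" if "s \<in> (\<Pi>\<^sub>E y\<in>U. carrier (stalk X y))" "\<And>y. y \<in> U \<Longrightarrow> f y = s y" for f s
    using that by (intro extensionalityI[of _ U]) (auto simp: PiE_def)
  show "abelian_group (section_ring X U)"
  proof (rule abelian_groupI; simp add: section_ring_def U)
    fix s assume s: "s \<in> (\<Pi>\<^sub>E y\<in>U. carrier (stalk X y))"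
    show "\<exists>t\<in>\<Pi>\<^sub>E y\<in>U. carrier (stalk X y).
        (\<lambda>y\<in>U. t y \<oplus>\<^bsub>stalk X y\<^esub> s y) = (\<lambda>y\<in>U. \<zero>\<^bsub>stalk X y\<^esub>)"
    proof (intro bexI restrict_ext)
      show "(\<lambda>y\<in>U. \<ominus>\<^bsub>stalk X y\<^esub> s y) \<in> (\<Pi>\<^sub>E y\<in>U. carrier (stalk X y))"
        using mem[OF s] R by (auto simp: cring.cring_simprules)
      show "(\<lambda>y\<in>U. \<ominus>\<^bsub>stalk X y\<^esub> s y) y \<oplus>\<^bsub>stalk X y\<^esub> s y = \<zero>\<^bsub>stalk X y\<^esub>" if "y \<in> U" for y
        using mem[OF s that] R[OF that] that by (simp add: cring.cring_simprules)
    qed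
  qed (use R mem in \<open>auto intro!: ext restrict_ext simp: cring.cring_simprules\<close>)
  have r_one: "a \<otimes>\<^bsub>stalk X y\<^esub> \<one>\<^bsub>stalk X y\<^esub> = a" if "y \<in> U" "a \<in> carrier (stalk X y)" for y a
  proof -
    interpret cring "stalk X y" by (rule R[OF that(1)])
    show ?thesis using that(2) by simp
  qed
  show "Group.comm_monoid (section_ring X U)"
    by (rule comm_monoidI; simp add: section_ring_def U)
      (use R mem r_one in \<open>auto intro!: ext restrict_ext simp: cring.cring_simprules\<close>)
  show "(x \<oplus>\<^bsub>section_ring X U\<^esub> y) \<otimes>\<^bsub>section_ring X U\<^esub> z =
      x \<otimes>\<^bsub>section_ring X U\<^esub> z \<oplus>\<^bsub>section_ring X U\<^esub> y \<otimes>\<^bsub>section_ring X U\<^esub> z"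
    if "x \<in> carrier (section_ring X U)" "y \<in> carrier (section_ring X U)" "z \<in> carrier (section_ring X U)"
    for x y z
    using that R mem by (auto intro!: restrict_ext simp: section_ring_def U cring.cring_simprules)
qed

lemma point_space_lrs:
  assumes X: "point_space X x" shows "locally_ringed_space X"
proof -
  have op: "openin (sp X) U \<longleftrightarrow> U \<subseteq> {x}" for U using X by (simp add: point_space_def)
  have sect: "sect X U = (\<Pi>\<^sub>E y\<in>U. carrier (stalk X y))" if "U \<subseteq> {x}" for U
    using X that by (simp add: point_space_def)
  have loc: "local_ring (stalk X x)" and pts: "pts X = {x}" using X by (simp_all add: point_space_def)
  show ?thesis
    unfolding locally_ringed_space_def op
  proof (intro conjI allI impI ballI; (elim conjE)?)
    fix U :: "'a set" assume U: "U \<subseteq> {x}"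
    show "sect X U \<subseteq> (\<Pi>\<^sub>E y\<in>U. carrier (stalk X y))" by (simp add: sect U)
    show "cring (section_ring X U)"
      by (rule section_ring_full_cring[OF sect[OF U]]) (use U loc local_ring_cring in blast)
  next
    fix U V :: "'a set" and s assume "U \<subseteq> {x}" "V \<subseteq> {x}" "V \<subseteq> U" "s \<in> sect X U"
    then show "restrict s V \<in> sect X V" by (auto simp: sect)
  next
    fix y a assume "y \<in> pts X" "a \<in> carrier (stalk X y)"
    then show "\<exists>U s. U \<subseteq> {x} \<and> y \<in> U \<and> s \<in> sect X U \<and> s y = a"
      by (intro exI[of _ "{x}"] exI[of _ "\<lambda>y\<in>{x}. a"]) (auto simp: sect pts)
  next
    fix U s t y assume "U \<subseteq> {x}" "s \<in> sect X U" "t \<in> sect X U" "y \<in> U" "s y = t y"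
    then show "\<exists>V\<subseteq>{x}. y \<in> V \<and> V \<subseteq> U \<and> restrict s V = restrict t V"
      by (intro exI[of _ U]) (auto intro!: restrict_ext)
  qed (use loc pts sect in auto)
qed

definition point_mor :: "('p, 's) lrs \<Rightarrow> 'p \<Rightarrow> ('q, 't) lrs \<Rightarrow> 'q \<Rightarrow> ('t \<Rightarrow> 's) \<Rightarrow> ('p, 's, 'q, 't) mor"
  where "point_mor X x W w \<phi> = \<lparr>src = X, tgt = W, pmap = (\<lambda>y\<in>{x}. w),
    smap = (\<lambda>y\<in>{x}. restrict \<phi> (carrier (stalk W w)))\<rparr>"

lemma point_mor_simps [simp]:
  "src (point_mor X x W w \<phi>) = X" "tgt (point_mor X x W w \<phi>) = W"
  "pmap (point_mor X x W w \<phi>) x = w" "smap (point_mor X x W w \<phi>) x = restrict \<phi> (carrier (stalk W w))"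
  by (simp_all add: point_mor_def)

lemma is_mor_point_mor:
  assumes X: "point_space X x" and W: "locally_ringed_space W" "w \<in> pts W"
    and \<phi>: "\<phi> \<in> ring_hom (stalk W w) (stalk X x)"
    and local: "\<And>a. a \<in> carrier (stalk W w) \<Longrightarrow> \<phi> a \<in> Units (stalk X x) \<Longrightarrow> a \<in> Units (stalk W w)"
  shows "is_mor (point_mor X x W w \<phi>)"
proof (rule is_morI)
  have pts: "pts X = {x}" and sp: "sp X = discrete_topology {x}"
    and sect: "\<And>U. U \<subseteq> {x} \<Longrightarrow> sect X U = (\<Pi>\<^sub>E y\<in>U. carrier (stalk X y))"
    using X by (simp_all add: point_space_def)
  interpret cring "stalk W w" by (rule lrs_cring[OF W])
  let ?f = "point_mor X x W w \<phi>"
  show "continuous_map (sp (src ?f)) (sp (tgt ?f)) (pmap ?f)"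
    using W(2) by (auto simp: continuous_map_def sp)
  fix y assume "y \<in> pts (src ?f)"
  then have y: "y = x" by (simp add: pts)
  show "smap ?f y \<in> ring_hom (stalk (tgt ?f) (pmap ?f y)) (stalk (src ?f) y)"
    unfolding y using ring_hom_closed[OF \<phi>] ring_hom_mult[OF \<phi>] ring_hom_add[OF \<phi>] ring_hom_one[OF \<phi>]
    by (intro ring_hom_memI) simp_all
  show "smap ?f y \<in> extensional (carrier (stalk (tgt ?f) (pmap ?f y)))"
    unfolding y by simp
  show "a \<in> Units (stalk (tgt ?f) (pmap ?f y))"
    if "a \<in> carrier (stalk (tgt ?f) (pmap ?f y))" "smap ?f y a \<in> Units (stalk (src ?f) y)" for a
    using that local unfolding y by simp
next
  have pts: "pts X = {x}"
    and sect: "\<And>U. U \<subseteq> {x} \<Longrightarrow> sect X U = (\<Pi>\<^sub>E y\<in>U. carrier (stalk X y))"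
    using X by (simp_all add: point_space_def)
  let ?f = "point_mor X x W w \<phi>"
  fix V s assume V: "openin (sp (tgt ?f)) V" and s: "s \<in> sect (tgt ?f) V"
  have sub: "{y \<in> pts (src ?f). pmap ?f y \<in> V} \<subseteq> {x}" by (auto simp: pts)
  have "\<phi> (s w) \<in> carrier (stalk X x)" "s w \<in> carrier (stalk W w)" if "w \<in> V"
    using lrs_sect_closed[OF W(1), of V s w] V s that ring_hom_closed[OF \<phi>] by simp_all
  then show "(\<lambda>y\<in>{y \<in> pts (src ?f). pmap ?f y \<in> V}. smap ?f y (s (pmap ?f y)))
      \<in> sect (src ?f) {y \<in> pts (src ?f). pmap ?f y \<in> V}"
    unfolding point_mor_simps(1) sect[OF sub[unfolded point_mor_simps(1)]]
    by (intro restrict_PiE_iff[THEN iffD2] ballI) (auto simp: pts)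
qed (use X W point_space_lrs[OF X] in \<open>simp_all add: point_mor_def point_space_def\<close>)

lemma ring_iso_Units:
  assumes "cring R" "cring S" "h \<in> ring_iso R S" "a \<in> carrier R" "h a \<in> Units S"
  shows "a \<in> Units R"
proof -
  interpret R: cring R by fact
  have "inv_into (carrier R) h \<in> ring_hom S R"
    using ring_iso_set_sym[OF R.ring_axioms assms(3)] by (simp add: ring_iso_def)
  from ring_hom_Units[OF this assms(5,2,1)] have "inv_into (carrier R) h (h a) \<in> Units R" .
  moreover have "inv_into (carrier R) h (h a) = a"
    using assms(3,4) by (auto simp: ring_iso_def bij_betw_def)
  ultimately show ?thesis by simp
qed

lemma point_space_isomorphic:
  assumes X: "point_space X x" and Y: "point_space Y y" and \<phi>: "\<phi> \<in> ring_iso (stalk Y y) (stalk X x)"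
  shows "isomorphic X Y"
proof -
  have L: "locally_ringed_space X" "locally_ringed_space Y" by (rule point_space_lrs[OF X], rule point_space_lrs[OF Y])
  have pts: "pts X = {x}" "pts Y = {y}" using X Y by (simp_all add: point_space_def)
  have C: "cring (stalk X x)" "cring (stalk Y y)"
    using X Y local_ring_cring by (auto simp: point_space_def)
  let ?\<psi> = "inv_into (carrier (stalk Y y)) \<phi>"
  have \<psi>: "?\<psi> \<in> ring_iso (stalk X x) (stalk Y y)"
    using ring_iso_set_sym[OF cring.axioms(1)[OF C(2)] \<phi>] .
  have hom: "\<phi> \<in> ring_hom (stalk Y y) (stalk X x)" "?\<psi> \<in> ring_hom (stalk X x) (stalk Y y)"
    and bij: "bij_betw \<phi> (carrier (stalk Y y)) (carrier (stalk X x))"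
    using \<phi> \<psi> by (simp_all add: ring_iso_def)
  let ?f = "point_mor X x Y y \<phi>" and ?g = "point_mor Y y X x ?\<psi>"
  have f: "is_mor ?f"
    by (rule is_mor_point_mor[OF X L(2) _ hom(1)]) (use pts ring_iso_Units[OF C(2,1) \<phi>] in auto)
  have g: "is_mor ?g"
    by (rule is_mor_point_mor[OF Y L(1) _ hom(2)]) (use pts ring_iso_Units[OF C \<psi>] in auto)
  have "?g \<circ>\<^sub>s ?f = id_mor X"
  proof (rule mor_eqI)
    fix z a assume z: "z \<in> pts (src (?g \<circ>\<^sub>s ?f))"
      and a: "a \<in> carrier (stalk (tgt (?g \<circ>\<^sub>s ?f)) (pmap (?g \<circ>\<^sub>s ?f) z))"
    then have "z = x" by (simp add: pts)
    moreover have "a \<in> carrier (stalk X x)" using a \<open>z = x\<close> by (simp add: pmap_comp pts)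
    moreover from this have "?\<psi> a \<in> carrier (stalk Y y)" "\<phi> (?\<psi> a) = a"
      using bij by (auto simp: bij_betw_def f_inv_into_f inv_into_into)
    ultimately show "smap (?g \<circ>\<^sub>s ?f) z a = smap (id_mor X) z a"
      by (simp add: smap_comp smap_id pts)
  qed (use f g is_mor_id[OF L(1)] pts in \<open>simp_all add: is_mor_comp pmap_comp pmap_id\<close>)
  moreover have "?f \<circ>\<^sub>s ?g = id_mor Y"
  proof (rule mor_eqI)
    fix z a assume z: "z \<in> pts (src (?f \<circ>\<^sub>s ?g))"
      and a: "a \<in> carrier (stalk (tgt (?f \<circ>\<^sub>s ?g)) (pmap (?f \<circ>\<^sub>s ?g) z))"
    then have "z = y" by (simp add: pts)
    moreover have "a \<in> carrier (stalk Y y)" using a \<open>z = y\<close> by (simp add: pmap_comp pts)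
    moreover from this have "\<phi> a \<in> carrier (stalk X x)" "?\<psi> (\<phi> a) = a"
      using bij by (auto simp: bij_betw_def)
    ultimately show "smap (?f \<circ>\<^sub>s ?g) z a = smap (id_mor Y) z a"
      by (simp add: smap_comp smap_id pts)
  qed (use f g is_mor_id[OF L(2)] pts in \<open>simp_all add: is_mor_comp pmap_comp pmap_id\<close>)
  ultimately show ?thesis
    unfolding isomorphic_def is_iso_def using f g
    by (intro exI[of _ ?f] conjI exI[of _ ?g]) simp_all
qed

text \<open>Over a field, a fraction equals the quotient of its numerator by its denominator, placed
  over the denominator one; cancellation gives injectivity.\<close>

lemma field_fraction_iso:
  assumes "field F"
  shows "(\<lambda>a. fraction F (carrier F \<times> (carrier F - {\<zero>\<^bsub>F\<^esub>})) (a, \<one>\<^bsub>F\<^esub>))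
    \<in> ring_iso F (stalk (Spec F) {\<zero>\<^bsub>F\<^esub>})"
proof -
  interpret field F by fact
  interpret L: localization_at_prime "{\<zero>\<^bsub>F\<^esub>}" F
    by (rule localization_at_prime.intro[OF zeroprimeideal])
  let ?h = "\<lambda>a. L.frac_at (a, \<one>\<^bsub>F\<^esub>)"
  have "?h \<in> ring_hom F (stalk (Spec F) {\<zero>\<^bsub>F\<^esub>})"
  proof (rule ring_hom_memI)
    fix a b assume "a \<in> carrier F" "b \<in> carrier F"
    then show "?h a \<in> carrier (stalk (Spec F) {\<zero>\<^bsub>F\<^esub>})"
      "?h (a \<otimes>\<^bsub>F\<^esub> b) = ?h a \<otimes>\<^bsub>stalk (Spec F) {\<zero>\<^bsub>F\<^esub>}\<^esub> ?h b"
      "?h (a \<oplus>\<^bsub>F\<^esub> b) = ?h a \<oplus>\<^bsub>stalk (Spec F) {\<zero>\<^bsub>F\<^esub>}\<^esub> ?h b"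
      using L.one_not_in unfolding Spec_simps
      by (simp_all add: L.frac_mult L.frac_add) (auto simp: fraction_ring_def)
  qed (simp add: Spec_simps fraction_ring_def)
  moreover have "inj_on ?h (carrier F)"
  proof (rule inj_onI)
    fix a b assume ab: "a \<in> carrier F" "b \<in> carrier F" "?h a = ?h b"
    then have "(b, \<one>\<^bsub>F\<^esub>) \<in> ?h a" using L.frac_self L.one_not_in by simp
    then obtain h where "h \<in> carrier F - {\<zero>\<^bsub>F\<^esub>}" "h \<otimes>\<^bsub>F\<^esub> a = h \<otimes>\<^bsub>F\<^esub> b"
      using L.frac_iff[OF ab(1) L.one_not_in] ab by auto
    then show "a = b" using m_lcancel[of h a b] ab by auto
  qed
  moreover have "?h ` carrier F = carrier (stalk (Spec F) {\<zero>\<^bsub>F\<^esub>})"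
  proof
    show "?h ` carrier F \<subseteq> carrier (stalk (Spec F) {\<zero>\<^bsub>F\<^esub>})"
      using ring_hom_closed[OF calculation(1)] by blast
    show "carrier (stalk (Spec F) {\<zero>\<^bsub>F\<^esub>}) \<subseteq> ?h ` carrier F"
    proof
      fix c assume "c \<in> carrier (stalk (Spec F) {\<zero>\<^bsub>F\<^esub>})"
      then obtain a f where af: "a \<in> carrier F" "f \<in> carrier F - {\<zero>\<^bsub>F\<^esub>}" "c = L.frac_at (a, f)"
        by (auto simp: Spec_simps fraction_ring_def)
      then have fU: "f \<in> Units F" using field_Units by simp
      have "c = ?h (inv\<^bsub>F\<^esub> f \<otimes>\<^bsub>F\<^esub> a)"
        unfolding af(3)
      proof (rule L.frac_eqI[OF af(1,2) _ L.one_not_in L.one_not_in])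
        show "\<one>\<^bsub>F\<^esub> \<otimes>\<^bsub>F\<^esub> (\<one>\<^bsub>F\<^esub> \<otimes>\<^bsub>F\<^esub> a) = \<one>\<^bsub>F\<^esub> \<otimes>\<^bsub>F\<^esub> (f \<otimes>\<^bsub>F\<^esub> (inv\<^bsub>F\<^esub> f \<otimes>\<^bsub>F\<^esub> a))"
          using af(1) fU by (simp add: m_assoc[symmetric] Units_closed)
      qed (use af(1) fU in simp)
      then show "c \<in> ?h ` carrier F" using af(1) fU by simp
    qed
  qed
  ultimately show ?thesis by (simp add: ring_iso_def bij_betw_def)
qed

lemma Spec_field_point_space:
  assumes F: "field F" shows "point_space (Spec F) {\<zero>\<^bsub>F\<^esub>}"
proof -
  interpret field F by fact
  let ?o = "{\<zero>\<^bsub>F\<^esub>}"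
  have pts: "pts (Spec F) = {?o}" using pts_Spec[OF is_cring] field_primeideals[OF F] by simp
  have "field (stalk (Spec F) ?o)"
  proof -
    \<comment> \<open>The field structure transported along an isomorphism has the image of zero as
      its zero; here this is already the zero of the stalk.\<close>
    have "stalk (Spec F) ?o \<lparr>zero := fraction F (carrier F \<times> (carrier F - ?o)) (\<zero>\<^bsub>F\<^esub>, \<one>\<^bsub>F\<^esub>)\<rparr>
        = stalk (Spec F) ?o"
      by (simp add: Spec_simps fraction_ring_def)
    then show ?thesis using ring_iso_imp_img_field[OF field_fraction_iso[OF F]] by simp
  qed
  moreover have disc: "sp (Spec F) = discrete_topology {?o}"
    using pts by (simp add: subtopology_eq_discrete_topology_sing)
  moreover have "sect (Spec F) U = (\<Pi>\<^sub>E P\<in>U. carrier (stalk (Spec F) P))" if U: "U \<subseteq> {?o}" for U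
  proof -
    have "\<exists>V af. openin (sp (Spec F)) V \<and> P \<in> V \<and> V \<subseteq> U \<and>
        (\<forall>Q\<in>V. af \<in> carrier F \<times> (carrier F - Q) \<and> s Q = fraction F (carrier F \<times> (carrier F - Q)) af)"
      if s: "s \<in> (\<Pi>\<^sub>E P\<in>U. carrier (stalk (Spec F) P))" and P: "P \<in> U" for s P
    proof -
      have "P = ?o" "U = {?o}" using U P by auto
      moreover have "s P \<in> carrier (stalk (Spec F) P)" using s P by blast
      then obtain af where "af \<in> carrier F \<times> (carrier F - P)"
        "s P = fraction F (carrier F \<times> (carrier F - P)) af"
        by (auto simp: Spec_simps fraction_ring_def)
      ultimately show ?thesis
        unfolding disc by (intro exI[of _ U] exI[of _ af]) auto
    qed
    note frac = this
    show ?thesis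
    proof (intro Set.set_eqI iffI)
      fix s assume "s \<in> sect (Spec F) U"
      then show "s \<in> (\<Pi>\<^sub>E P\<in>U. carrier (stalk (Spec F) P))" by (subst (asm) Spec_sect_iff) blast
    next
      fix s assume s: "s \<in> (\<Pi>\<^sub>E P\<in>U. carrier (stalk (Spec F) P))"
      then show "s \<in> sect (Spec F) U" by (subst Spec_sect_iff) (intro conjI ballI frac)
    qed
  qed
  ultimately show ?thesis
    unfolding point_space_def using field_local_ring by blast
qed

text \<open>The type of \<open>F\<close> is free, so one space can be matched with the spectra of
  several copies of its stalk: \<open>field_spectrum\<close> and \<open>affine_scheme\<close> ask
  for rings of different types.\<close>

lemma point_space_isomorphic_Spec:
  assumes X: "point_space X x" and F: "field F" "\<phi> \<in> ring_iso F (stalk X x)"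
  shows "isomorphic X (Spec F)"
proof -
  interpret field F by fact
  have "inv_into (carrier F) (\<lambda>a. fraction F (carrier F \<times> (carrier F - {\<zero>\<^bsub>F\<^esub>})) (a, \<one>\<^bsub>F\<^esub>))
      \<in> ring_iso (stalk (Spec F) {\<zero>\<^bsub>F\<^esub>}) F"
    by (rule ring_iso_set_sym[OF ring_axioms field_fraction_iso[OF F(1)]])
  from ring_iso_set_trans[OF this F(2)]
  show ?thesis by (rule point_space_isomorphic[OF X Spec_field_point_space[OF F(1)]])
qed

text \<open>The test object for the universal properties: a copy of the spectrum of the residue
  field at \<open>w\<close>, with points and stalks in the types of \<open>W\<close>, which are the
  types over which those properties quantify.\<close>

lemma residue_point_exists:
  fixes W :: "('p, 's) lrs"
  assumes W: "scheme W" and w: "w \<in> pts W"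
  obtains f :: "('p, 's, 'p, 's) mor" and x where "sch_mor f" "tgt f = W" "field_spectrum (src f)"
    "pts (src f) = {x}" "pmap f x = w"
proof -
  let ?A = "stalk W w"
  note L = scheme_lrs[OF W]
  have A: "local_ring ?A" by (rule lrs_local_ring[OF L w])
  interpret A: cring ?A by (rule local_ring_cring[OF A])
  obtain M where M: "maximalideal M ?A" and Muniq: "\<And>M'. maximalideal M' ?A \<Longrightarrow> M' = M"
    using A unfolding local_ring_def by blast
  interpret M: maximalideal M ?A by (rule M)
  let ?Q = "?A Quot M"
  have Q: "field ?Q" by (rule M.quotient_is_field[OF A.is_cring])
  \<comment> \<open>The residue field is carried over to the type \<open>'s\<close>, where the stalks have to live.\<close>
  define rep where "rep C = (SOME a. a \<in> C)" for C :: "'s set"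
  have rep: "rep C \<in> C" if C: "C \<in> carrier ?Q" for C
  proof -
    obtain a where "a \<in> carrier ?A" "C = M +>\<^bsub>?A\<^esub> a"
      using C by (auto simp: FactRing_def A_RCOSETS_def')
    then have "a \<in> C" using M.a_rcos_self by blast
    then show ?thesis unfolding rep_def by (rule someI)
  qed
  have "C = D" if CD: "C \<in> carrier ?Q" "D \<in> carrier ?Q" "rep C = rep D" for C D
  proof -
    obtain a b where "a \<in> carrier ?A" "C = M +>\<^bsub>?A\<^esub> a" "b \<in> carrier ?A" "D = M +>\<^bsub>?A\<^esub> b"
      using CD(1,2) by (auto simp: FactRing_def A_RCOSETS_def')
    then show ?thesis using rep[OF CD(1)] rep[OF CD(2)] CD(3)
      by (metis M.a_repr_independence')
  qed
  then have inj: "inj_on rep (carrier ?Q)" by (simp add: inj_on_def)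
  define K where "K = image_ring rep ?Q"
  have K: "field K" and repiso: "rep \<in> ring_iso ?Q K"
    unfolding K_def using field.inj_imp_image_ring_is_field[OF Q inj] inj_imp_image_ring_iso[OF inj] .
  interpret K: field K by (rule K)
  define \<phi> where "\<phi> = rep \<circ> (+>\<^bsub>?A\<^esub>) M"
  have \<phi>: "\<phi> \<in> ring_hom ?A K"
    unfolding \<phi>_def using ring_hom_trans[OF M.rcos_ring_hom, of rep K] repiso by (simp add: ring_iso_def)
  \<comment> \<open>A nonunit lies in some maximal ideal, hence in \<open>M\<close>, the only one,
    and so it vanishes in the residue field.\<close>
  have local: "a \<in> Units ?A" if a: "a \<in> carrier ?A" "\<phi> a \<in> Units K" for a
  proof (rule ccontr)
    assume "a \<notin> Units ?A"
    then obtain M' where "maximalideal M' ?A" "a \<in> M'" using A.nonunit_in_maximalideal a(1) by blast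
    then have "a \<in> M" using Muniq by blast
    then have "M +>\<^bsub>?A\<^esub> a = \<zero>\<^bsub>?Q\<^esub>" by (simp add: FactRing_def M.a_rcos_const)
    then have "\<phi> a = \<zero>\<^bsub>K\<^esub>" by (simp add: \<phi>_def K_def image_ring_zero)
    then show False using a(2) K.field_Units by simp
  qed
  define T :: "('p, 's) lrs" where "T = \<lparr>sp = discrete_topology {w}, stalk = (\<lambda>_. K),
    sect = (\<lambda>U. \<Pi>\<^sub>E y\<in>U. carrier K)\<rparr>"
  have T: "point_space T w" and TK: "stalk T w = K" and ptsT: "pts T = {w}"
    using field_local_ring[OF K] by (simp_all add: T_def point_space_def)
  have idK: "id \<in> ring_iso K (stalk T w)"
    unfolding TK by (rule ring_iso_set_refl)
  have "field_spectrum T"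
    unfolding field_spectrum_def using point_space_isomorphic_Spec[OF T K idK] K by blast
  moreover have "scheme T"
  proof -
    \<comment> \<open>Affineness refers to the spectrum of a ring of type \<open>'p \<Rightarrow> 's\<close>: use constant functions.\<close>
    define c :: "'s \<Rightarrow> 'p \<Rightarrow> 's" where "c a = (\<lambda>_. a)" for a
    have c: "inj_on c (carrier K)" by (rule inj_onI) (auto simp: c_def dest: fun_cong)
    note cK = field.inj_imp_image_ring_is_field[OF K c]
    have "inv_into (carrier K) c \<in> ring_iso (image_ring c K) (stalk T w)"
      unfolding TK by (rule ring_iso_set_sym[OF K.ring_axioms inj_imp_image_ring_iso[OF c]])
    from point_space_isomorphic_Spec[OF T cK this]
    have "affine_scheme T" unfolding affine_scheme_def using field.axioms(1)[OF cK] domain.axioms(1) by blast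
    moreover have "open_sub T {w} = T" by (simp add: open_sub_def T_def)
    ultimately show ?thesis
      unfolding scheme_def ptsT using point_space_lrs[OF T] by (auto simp: T_def intro!: exI[of _ "{w}"])
  qed
  moreover have "is_mor (point_mor T w W w \<phi>)"
    by (rule is_mor_point_mor[OF T L w]) (use \<phi> local in \<open>simp_all add: TK\<close>)
  ultimately show thesis
    using that[of "point_mor T w W w \<phi>" w] W ptsT by (simp add: sch_mor_def)
qed

section \<open>Blow-ups and unions\<close>

text \<open>The ideal sheaf of the empty subscheme is the whole structure sheaf, and the constant
  section one is a global equation for it.\<close>

lemma empty_effective_cartier:
  assumes d: "sch_mor d" and empty: "pts (src d) = {}"
  shows "effective_cartier d"
proof -
  note L = mor_lrs(2)[OF sch_mor_is_mor[OF d]]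
  have "closed_map (sp (src d)) (sp (tgt d)) (pmap d)"
    using empty by (auto simp: closed_map_def dest: closedin_subset)
  then have "closed_immersion d"
    unfolding closed_immersion_def using d empty mor_continuous[OF sch_mor_is_mor[OF d]]
    by (auto intro: injective_closed_imp_embedding_map)
  moreover have "bij_betw (\<lambda>g. restrict (\<lambda>y\<in>pts (tgt d). \<one>\<^bsub>stalk (tgt d) y\<^esub>) V \<otimes>\<^bsub>section_ring (tgt d) V\<^esub> g)
      (sect (tgt d) V) (ideal_sheaf d V)" if V: "openin (sp (tgt d)) V" for V
  proof -
    interpret S: cring "section_ring (tgt d) V" by (rule lrs_section_ring[OF L V])
    have one: "restrict (\<lambda>y\<in>pts (tgt d). \<one>\<^bsub>stalk (tgt d) y\<^esub>) V = \<one>\<^bsub>section_ring (tgt d) V\<^esub>"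
      using openin_subset[OF V] by (simp add: section_ring_def Int_absorb1)
    have "carrier (section_ring (tgt d) V) = sect (tgt d) V" by (simp add: section_ring_def)
    then have "bij_betw (\<lambda>g. \<one>\<^bsub>section_ring (tgt d) V\<^esub> \<otimes>\<^bsub>section_ring (tgt d) V\<^esub> g) (sect (tgt d) V) (sect (tgt d) V)"
      using S.l_one by (intro bij_betw_byWitness[where f' = id]) auto
    moreover have "ideal_sheaf d V = sect (tgt d) V" using empty by (simp add: ideal_sheaf_def)
    ultimately show ?thesis unfolding one by simp
  qed
  ultimately show ?thesis
    unfolding effective_cartier_def
    using lrs_one[OF L openin_topspace]
    by (intro conjI ballI exI[of _ "pts (tgt d)"] exI[of _ "\<lambda>y\<in>pts (tgt d). \<one>\<^bsub>stalk (tgt d) y\<^esub>"]) auto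
qed

text \<open>The inclusion of a point outside the center pulls the center back to the empty subscheme,
  which is an effective Cartier divisor.\<close>

lemma blowup_surj_off_center:
  fixes i bl :: "('p, 's, 'p, 's) mor"
  assumes bl: "is_blowup i bl" and X: "scheme (tgt i)"
    and y: "y \<in> pts (tgt i)" "y \<notin> pmap i ` pts (src i)"
  shows "y \<in> pmap bl ` pts (src bl)"
proof -
  obtain g :: "('p, 's, 'p, 's) mor" and x where g: "sch_mor g" "tgt g = tgt i"
    and x: "pts (src g) = {x}" "pmap g x = y"
    using residue_point_exists[OF X y(1)] by metis
  have "cartier_pullback g i"
    unfolding cartier_pullback_def
  proof (intro allI impI)
    fix d d' assume "is_pullback g i d d'"
    note P = pullbackD[OF this]
    have "z \<notin> pts (src d)" for z
    proof
      assume z: "z \<in> pts (src d)"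
      then have zd': "z \<in> pts (src d')" using P by simp
      have "pmap d z = x" using mor_pt[OF sch_mor_is_mor[OF P(3)] z] P(7) x by simp
      then have "y = pmap i (pmap d' z)"
        using pmap_comp[OF z, of g] pmap_comp[OF zd', of i] P(9) x by simp
      moreover have "pmap d' z \<in> pts (src i)"
        using mor_pt[OF sch_mor_is_mor[OF P(4)] zd'] P(8) by simp
      ultimately show False using y(2) by blast
    qed
    then show "effective_cartier d" using empty_effective_cartier[OF P(3)] by blast
  qed
  then obtain h where h: "sch_mor h" "src h = src g" "tgt h = src bl" "bl \<circ>\<^sub>s h = g"
    using bl g unfolding is_blowup_def by blast
  have xh: "x \<in> pts (src h)" using h x by simp
  have "pmap bl (pmap h x) = y" using pmap_comp[OF xh, of bl] h x by simp
  moreover have "pmap h x \<in> pts (src bl)" using mor_pt[OF sch_mor_is_mor[OF h(1)] xh] h by simp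
  ultimately show ?thesis by blast
qed

section \<open>Schematic unions of two closed subschemes covering all points\<close>

lemma schematic_unionD:
  assumes "schematic_union i\<^sub>1 i\<^sub>2 u"
  shows "closed_immersion i\<^sub>1" "closed_immersion i\<^sub>2" "closed_immersion u"
    "tgt i\<^sub>1 = tgt u" "tgt i\<^sub>2 = tgt u"
  using assms by (simp_all add: schematic_union_def)

context
  fixes i\<^sub>1 i\<^sub>2 u :: "('p, 's, 'q, 't) mor"
  assumes union: "schematic_union i\<^sub>1 i\<^sub>2 u"
    and cover: "pts (tgt u) \<subseteq> pmap i\<^sub>1 ` pts (src i\<^sub>1) \<union> pmap i\<^sub>2 ` pts (src i\<^sub>2)"
begin

text \<open>Such a section lies in both ideals, and \<open>y\<close> lies in at least one of the two
  subschemes, where the section vanishes.\<close>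

lemma union_ideal_nonunit:
  assumes U: "openin (sp (tgt u)) U" and s: "s \<in> ideal_sheaf u U" and y: "y \<in> U"
  shows "s y \<notin> Units (stalk (tgt u) y)"
proof -
  have s12: "s \<in> ideal_sheaf i\<^sub>1 U" "s \<in> ideal_sheaf i\<^sub>2 U"
    using union U s by (auto simp: schematic_union_def)
  have "y \<in> pmap i\<^sub>1 ` pts (src i\<^sub>1) \<union> pmap i\<^sub>2 ` pts (src i\<^sub>2)"
    using cover openin_subset[OF U] y by blast
  then show ?thesis
  proof
    assume "y \<in> pmap i\<^sub>1 ` pts (src i\<^sub>1)"
    then obtain z where z: "z \<in> pts (src i\<^sub>1)" "y = pmap i\<^sub>1 z" by blast
    then show ?thesis
      using closed_immersion_zero_nonunit[OF schematic_unionD(1)[OF union] z(1), of "s y"] s12(1) y schematic_unionD(4,5)[OF union]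
      by (simp add: ideal_sheaf_def)
  next
    assume "y \<in> pmap i\<^sub>2 ` pts (src i\<^sub>2)"
    then obtain z where z: "z \<in> pts (src i\<^sub>2)" "y = pmap i\<^sub>2 z" by blast
    then show ?thesis
      using closed_immersion_zero_nonunit[OF schematic_unionD(2)[OF union] z(1), of "s y"] s12(2) y schematic_unionD(4,5)[OF union]
      by (simp add: ideal_sheaf_def)
  qed
qed

text \<open>Over the open complement of the image of \<open>u\<close> the vanishing condition is
  empty, so the section one belongs to the ideal sheaf. It is a unit at every point there, so the
  complement has no points.\<close>

lemma union_surj: "pmap u ` pts (src u) = pts (tgt u)"
proof
  note um = closed_immersion_is_mor[OF schematic_unionD(3)[OF union]]
  show "pmap u ` pts (src u) \<subseteq> pts (tgt u)" using mor_pt[OF um] by blast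
  let ?U = "pts (tgt u) - pmap u ` pts (src u)"
  let ?s = "\<lambda>y\<in>?U. \<one>\<^bsub>stalk (tgt u) y\<^esub>"
  have U: "openin (sp (tgt u)) ?U"
    using closed_immersion_closedin[OF schematic_unionD(3)[OF union]] by (simp add: openin_diff)
  have s: "?s \<in> ideal_sheaf u ?U"
    using lrs_one[OF mor_lrs(2)[OF um] U] by (auto simp: ideal_sheaf_def)
  show "pts (tgt u) \<subseteq> pmap u ` pts (src u)"
  proof
    fix y assume y: "y \<in> pts (tgt u)"
    show "y \<in> pmap u ` pts (src u)"
    proof (rule ccontr)
      interpret cring "stalk (tgt u) y" by (rule lrs_cring[OF mor_lrs(2)[OF um] y])
      assume "y \<notin> pmap u ` pts (src u)"
      then have "?s y \<notin> Units (stalk (tgt u) y)" "y \<in> ?U"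
        using union_ideal_nonunit[OF U s] y by blast+
      then show False using Units_one_closed by simp
    qed
  qed
qed

text \<open>The two conditions for factoring through \<open>u\<close> are met by
  \<open>union_surj\<close> on points and by nilpotence of the germs on ideals; the latter is the
  condition by which \<open>reduction\<close> describes its ideal sheaf. Cancelling \<open>u\<close>
  then makes the factor a closed immersion.\<close>

lemma reduction_factors_through_union:
  assumes r: "reduction r" "tgt r = tgt u"
  shows "\<exists>h. closed_immersion h \<and> src h = src r \<and> tgt h = src u \<and> u \<circ>\<^sub>s h = r"
proof -
  note um = closed_immersion_is_mor[OF schematic_unionD(3)[OF union]]
  have rc: "closed_immersion r" using r(1) by (simp add: reduction_def)
  note rm = closed_immersion_is_mor[OF rc]
  have W: "scheme (tgt u)" "scheme (src u)" "scheme (src r)"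
    using closed_immersion_sch_mor[OF schematic_unionD(3)[OF union]] closed_immersion_sch_mor[OF rc]
    by (simp_all add: sch_mor_def)
  have im: "pmap r ` pts (src r) \<subseteq> pmap u ` pts (src u)"
    using mor_pt[OF rm] r(2) unfolding union_surj by auto
  obtain h where h: "is_mor h" "src h = src r" "tgt h = src u" "u \<circ>\<^sub>s h = r"
  proof (rule closed_immersion_factor[OF schematic_unionD(3)[OF union] rm r(2) im])
    fix V s y assume V: "openin (sp (tgt u)) V" and s: "s \<in> ideal_sheaf u V"
      and y: "y \<in> pts (src r)" "pmap r y \<in> V"
    have sV: "s \<in> sect (tgt u) V" using s by (simp add: ideal_sheaf_def)
    have "\<exists>n::nat. s x [^]\<^bsub>stalk (tgt r) x\<^esub> n = \<zero>\<^bsub>stalk (tgt r) x\<^esub>" if "x \<in> V" for x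
      using scheme_nonunit_nilpotent[OF W(1) V sV union_ideal_nonunit[OF V s] that] r(2) by simp
    then have "s \<in> ideal_sheaf r V"
      using r V sV unfolding reduction_def by simp
    then show "smap r y (s (pmap r y)) = \<zero>\<^bsub>stalk (src r) y\<^esub>"
      using y by (simp add: ideal_sheaf_def)
  qed
  then have "sch_mor h" using W by (simp add: sch_mor_def)
  then have "closed_immersion h"
    using closed_immersion_cancel[OF schematic_unionD(3)[OF union], of h] rc h by simp
  then show ?thesis using h by blast
qed

end

section \<open>Relative clusters\<close>

text \<open>The topological core, used both for an arbitrary cluster family and for
  \<open>X\<^sub>1 \<circ>\<^sub>s c\<close>.\<close>

lemma blowup_locus_iso_locus_cover:
  fixes B W :: "'a ksch" and p q \<theta> e e\<^sub>W e\<^sub>W' i j :: "'a smor"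
  assumes B: "geometrically_reduced k B" and W: "kscheme k W" and pq: "is_pullback B W p q"
    and \<theta>: "src \<theta> = src p" and e: "closed_immersion e"
    and E: "is_pullback \<theta> e e\<^sub>W e\<^sub>W'"
    and i: "blowup_locus B W p q e\<^sub>W i" and j: "iso_locus W q e\<^sub>W j"
  shows "pts (src W) \<subseteq> pmap i ` pts (src i) \<union> pmap j ` pts (src j)"
proof
  note P = pullbackD[OF pq] and E' = pullbackD[OF E]
  fix w assume w: "w \<in> pts (src W)"
  show "w \<in> pmap i ` pts (src i) \<union> pmap j ` pts (src j)"
  proof (cases "w \<in> pmap i ` pts (src i)")
    case False
    have ic: "closed_immersion i" "tgt i = src W" using i by (simp_all add: blowup_locus_def)
    note ism = closed_immersion_sch_mor[OF ic(1)]
    obtain p' q' where pq': "is_pullback B (W \<circ>\<^sub>s i) p' q'"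
      and blow: "is_blowup e\<^sub>W (cross_mor p q p' q' (id_mor (src B)) i)"
      using i by (auto simp: blowup_locus_def)
    note P' = pullbackD[OF pq']
    let ?bl = "cross_mor p q p' q' (id_mor (src B)) i"
    have idp: "id_mor (src B) \<circ>\<^sub>s p' = p'"
      using comp_id_left[OF sch_mor_is_mor[OF P'(3)]] P'(7) by simp
    \<comment> \<open>The blow-up lies over the inclusion \<open>i\<close>, so every point of B x W
      that it hits lies over a point in the image of \<open>i\<close>.\<close>
    have bl: "src ?bl = src p'" "q \<circ>\<^sub>s ?bl = i \<circ>\<^sub>s q'"
    proof -
      have "B \<circ>\<^sub>s p' = W \<circ>\<^sub>s (i \<circ>\<^sub>s q')"
        using P' P ic ism sch_comp_assoc[of q' i W] by simp
      then show "src ?bl = src p'" "q \<circ>\<^sub>s ?bl = i \<circ>\<^sub>s q'"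
        using pair_mor[OF pq, of p' "i \<circ>\<^sub>s q'"] P' ic ism idp unfolding cross_mor_def
        by (simp_all add: sch_mor_comp)
    qed
    have fibre: "pmap \<theta> b \<in> pmap e ` pts (src e)" if b: "b \<in> pts (src p)" "pmap q b = w" for b
    proof (rule ccontr)
      assume contr: "pmap \<theta> b \<notin> pmap e ` pts (src e)"
      have "b \<notin> pmap e\<^sub>W ` pts (src e\<^sub>W)"
      proof
        assume "b \<in> pmap e\<^sub>W ` pts (src e\<^sub>W)"
        then obtain z where z: "z \<in> pts (src e\<^sub>W)" "b = pmap e\<^sub>W z" by blast
        then have z': "z \<in> pts (src e\<^sub>W')" using E' by simp
        have "pmap \<theta> b = pmap e (pmap e\<^sub>W' z)"
          using pmap_comp[OF z(1), of \<theta>] pmap_comp[OF z', of e] E'(9) z(2) by simp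
        moreover have "pmap e\<^sub>W' z \<in> pts (src e)"
          using mor_pt[OF sch_mor_is_mor[OF E'(4)] z'] E'(8) by simp
        ultimately show False using contr by blast
      qed
      moreover have "scheme (tgt e\<^sub>W)" "b \<in> pts (tgt e\<^sub>W)"
        using E' b \<theta> by (simp_all add: sch_mor_def)
      ultimately have "b \<in> pmap ?bl ` pts (src ?bl)"
        using blowup_surj_off_center[OF blow] by blast
      then obtain z where z: "z \<in> pts (src ?bl)" "b = pmap ?bl z" by blast
      then have z': "z \<in> pts (src q')" using bl P' by simp
      have "w = pmap i (pmap q' z)"
        using pmap_comp[OF z(1), of q] pmap_comp[OF z', of i] bl(2) z(2) b(2) by simp
      moreover have "pmap q' z \<in> pts (src i)"
        using mor_pt[OF sch_mor_is_mor[OF P'(4)] z'] P'(8) by simp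
      ultimately show False using False by blast
    qed
    have "scheme (src W)" using W by (simp add: kscheme_def sch_mor_def)
    \<comment> \<open>Membership of \<open>w\<close> in W_E is tested with its residue point: if
      \<open>f\<close> factors through \<open>j\<close>, then its single value \<open>w\<close> is
      in the image of \<open>j\<close>.\<close>
    then obtain f :: "'a smor" and x where f: "sch_mor f" "tgt f = src W" "field_spectrum (src f)"
      and x: "pts (src f) = {x}" "pmap f x = w"
      using residue_point_exists[OF _ w] by metis
    have "is_iso (pair_mor c c' (e\<^sub>W \<circ>\<^sub>s d) d')"
      if C: "is_pullback q f c c'" and D: "is_pullback (q \<circ>\<^sub>s e\<^sub>W) f d d'" for c c' d d'
    proof -
      note C' = pullbackD[OF C]
      \<comment> \<open>By pasting, \<open>src c\<close> is the product of B with the spectrum of a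
        field over \<open>k\<close>, so geometric reducedness applies to it.\<close>
      have "kscheme k (W \<circ>\<^sub>s f)" using W f by (simp add: kscheme_def sch_mor_comp)
      then have red: "reduced_scheme (src c)"
        using B f(3) pullback_paste[OF pq C] unfolding geometrically_reduced_def by fastforce
      have \<theta>c: "sch_mor (\<theta> \<circ>\<^sub>s c)" "tgt (\<theta> \<circ>\<^sub>s c) = tgt e" "src (\<theta> \<circ>\<^sub>s c) = src c"
        using E' C' P \<theta> by (simp_all add: sch_mor_comp)
      have im: "pmap (\<theta> \<circ>\<^sub>s c) ` pts (src (\<theta> \<circ>\<^sub>s c)) \<subseteq> pmap e ` pts (src e)"
      proof
        fix a assume "a \<in> pmap (\<theta> \<circ>\<^sub>s c) ` pts (src (\<theta> \<circ>\<^sub>s c))"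
        then obtain y where y: "y \<in> pts (src c)" "a = pmap \<theta> (pmap c y)"
          by (auto simp: pmap_comp)
        then have y': "y \<in> pts (src c')" using C' by simp
        have "pmap q (pmap c y) = pmap f (pmap c' y)"
          using pmap_comp[OF y(1), of q] pmap_comp[OF y', of f] C'(9) by simp
        also have "pmap c' y = x" using mor_pt[OF sch_mor_is_mor[OF C'(4)] y'] C'(8) x by simp
        finally have "pmap q (pmap c y) = w" using x by simp
        moreover have "pmap c y \<in> pts (src p)"
          using mor_pt[OF sch_mor_is_mor[OF C'(3)] y(1)] C'(7) P(6) by simp
        ultimately show "a \<in> pmap e ` pts (src e)" using fibre y by simp
      qed
      obtain g where g: "sch_mor g" "src g = src (\<theta> \<circ>\<^sub>s c)" "tgt g = src e" "e \<circ>\<^sub>s g = \<theta> \<circ>\<^sub>s c"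
        using reduced_factor[OF e \<theta>c(1,2) _ im] red \<theta>c(3) by metis
      \<comment> \<open>The lift \<open>g\<close> of \<open>\<theta> \<circ>\<^sub>s c\<close> to E
        makes the base change of \<open>e\<^sub>W\<close> invertible.\<close>
      show ?thesis
      proof (rule pullback_iso_if_factors[OF E _ _ C D g(1) _ g(3,4)])
        show "sch_mor q" "src q = src \<theta>" "src g = src c" using P \<theta> g \<theta>c by simp_all
        show "h = h'" if "sch_mor h" "sch_mor h'" "src h = src h'" "tgt h = src e" "tgt h' = src e"
          "e \<circ>\<^sub>s h = e \<circ>\<^sub>s h'" for h h' :: "'a smor"
          using closed_immersion_mono[OF e, of h h'] that by (simp add: sch_mor_is_mor)
      qed
    qed
    then have "factors_through f j" using j f unfolding iso_locus_def by blast
    then obtain h where h: "sch_mor h" "src h = src f" "tgt h = src j" "j \<circ>\<^sub>s h = f"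
      by (auto simp: factors_through_def)
    have xh: "x \<in> pts (src h)" using h x by simp
    have "w = pmap j (pmap h x)" using pmap_comp[OF xh, of j] h x by simp
    moreover have "pmap h x \<in> pts (src j)" using mor_pt[OF sch_mor_is_mor[OF h(1)] xh] h by simp
    ultimately show ?thesis by blast
  qed blast
qed

theorem theorem5p12:
  fixes k :: "'a::infinite ring"
    and B S X X\<^sub>1 :: "'a ksch"
    and \<pi> p q \<psi> s t x\<^sub>1 x\<^sub>2 a d \<iota> \<psi>\<^sub>0 \<delta> \<pi>\<^sub>0 bl e e' \<pi>\<^sub>1 q\<^sub>1 p\<^sub>1 r\<^sub>1 \<psi>\<^sub>1 c p\<^sub>c q\<^sub>c \<psi>\<^sub>c e\<^sub>c e\<^sub>c' j\<^sub>E
        z z' b p' q' b' j u\<^sub>c :: "'a smor"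
  assumes "field k"
    and "kscheme k B" and "projective k B" and "integral_scheme (src B)"
    and "geometrically_reduced k B"
    and "kscheme k S" and "piecewise_quasiprojective k S" and "over_mor S B \<pi>"
    \<comment> \<open>the universal section family of \<open>\<pi>\<close>; \<open>p\<close>, \<open>q\<close> are the projections of \<open>B \<times> X\<close>\<close>
    and "universal_section_family k B \<pi> X p q \<psi>"
    \<comment> \<open>\<open>\<S>\<^sub>0 = \<S> \<times> X\<close>, \<open>X \<times> X\<close> and \<open>B \<times> X \<times> X\<close>\<close>
    and "is_pullback S X s t" and "is_pullback X X x\<^sub>1 x\<^sub>2" and "is_pullback B (X \<circ>\<^sub>s x\<^sub>1) a d"
    and "\<pi>\<^sub>0 = cross_mor p q s t \<pi> (id_mor (src X))"
    and "\<iota> = cross_mor a d a d (id_mor (src B)) (pair_mor x\<^sub>1 x\<^sub>2 x\<^sub>2 x\<^sub>1)"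
    \<comment> \<open>\<open>\<psi>\<^sub>0 = (\<psi> \<times> Id) \<circ> \<iota>\<close>, where \<open>B \<times> X \<times> X\<close> is seen as \<open>(B \<times> X) \<times> X\<close>, with projections
        \<open>(a, x\<^sub>1 d)\<close> to \<open>B \<times> X\<close> and \<open>x\<^sub>2 d\<close> to \<open>X\<close>\<close>
    and "\<psi>\<^sub>0 = cross_mor s t (pair_mor p q a (x\<^sub>1 \<circ>\<^sub>s d)) (x\<^sub>2 \<circ>\<^sub>s d) \<psi> (id_mor (src X)) \<circ>\<^sub>s \<iota>"
    \<comment> \<open>\<open>\<delta>\<close> is a section of the separated morphism \<open>\<pi>\<^sub>0\<close>, hence a closed immersion with image \<open>\<Delta>\<close>\<close>
    and "\<delta> = pair_mor s t \<psi> q"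
    and "is_blowup \<delta> bl" and "is_pullback bl \<delta> e e'"
    and "\<pi>\<^sub>1 = \<pi>\<^sub>0 \<circ>\<^sub>s bl" and "q\<^sub>1 = t \<circ>\<^sub>s bl"
    and "universal_section_family k B (p \<circ>\<^sub>s \<pi>\<^sub>1) X\<^sub>1 p\<^sub>1 r\<^sub>1 \<psi>\<^sub>1"
    \<comment> \<open>\<open>X\<^sub>1\<^sup>c\<close>, \<open>\<psi>\<^sup>c\<close> and \<open>X\<^sub>E\<^sup>c\<close>\<close>
    and "const_locus B q\<^sub>1 X\<^sub>1 p\<^sub>1 r\<^sub>1 \<psi>\<^sub>1 c"
    and "is_pullback B (X\<^sub>1 \<circ>\<^sub>s c) p\<^sub>c q\<^sub>c"
    and "\<psi>\<^sub>c = \<psi>\<^sub>1 \<circ>\<^sub>s cross_mor p\<^sub>1 r\<^sub>1 p\<^sub>c q\<^sub>c (id_mor (src B)) c"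
    and "is_pullback \<psi>\<^sub>c e e\<^sub>c e\<^sub>c'"
    and "iso_locus (X\<^sub>1 \<circ>\<^sub>s c) q\<^sub>c e\<^sub>c j\<^sub>E"
    \<comment> \<open>\<open>X'\<close> and its embedding \<open>j\<close> in \<open>X\<^sub>1\<^sup>c\<close>\<close>
    and "is_pullback \<psi>\<^sub>0 \<delta> z z'"
    and "blowup_split B (X \<circ>\<^sub>s x\<^sub>1) a d z b p' q'"
    and "sch_mor b'" and "src b' = src p'" and "tgt b' = src bl"
    and "bl \<circ>\<^sub>s b' = \<psi>\<^sub>0 \<circ>\<^sub>s cross_mor a d p' q' (id_mor (src B)) b"
    and "closed_immersion j" and "over_mor (X \<circ>\<^sub>s x\<^sub>1 \<circ>\<^sub>s b) (X\<^sub>1 \<circ>\<^sub>s c) j"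
    and "\<psi>\<^sub>c \<circ>\<^sub>s cross_mor p\<^sub>c q\<^sub>c p' q' (id_mor (src B)) j = b'"
    and "blowup_locus B (X\<^sub>1 \<circ>\<^sub>s c) p\<^sub>c q\<^sub>c e\<^sub>c j"
    \<comment> \<open>\<open>X' + X\<^sub>E\<^sup>c\<close>\<close>
    and "schematic_union j j\<^sub>E u\<^sub>c"
  shows "(\<forall>W p\<^sub>W q\<^sub>W \<theta> e\<^sub>W e\<^sub>W' i\<^sub>W j\<^sub>W u. \<forall>r :: 'a smor.
            cluster_family k B (p \<circ>\<^sub>s \<pi>\<^sub>1) q\<^sub>1 W p\<^sub>W q\<^sub>W \<theta> \<and>
            is_pullback \<theta> e e\<^sub>W e\<^sub>W' \<and>
            blowup_locus B W p\<^sub>W q\<^sub>W e\<^sub>W i\<^sub>W \<and>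
            iso_locus W q\<^sub>W e\<^sub>W j\<^sub>W \<and>
            schematic_union i\<^sub>W j\<^sub>W u \<and>
            reduction r \<and> tgt r = src W \<longrightarrow>
            (\<exists>h. closed_immersion h \<and> src h = src r \<and> tgt h = src u \<and> u \<circ>\<^sub>s h = r))
         \<and> sp (src u\<^sub>c) homeomorphic_space sp (src (X\<^sub>1 \<circ>\<^sub>s c))"
proof -
  note red = assms(5) and blowup = assms(17) and E = assms(18)
    and X1 = assms(21) and c = assms(22) and pc = assms(23) and \<psi>c = assms(24) and Ec = assms(25)
    and jE = assms(26) and j = assms(36) and uc = assms(37)
  \<comment> \<open>E is the pullback of the center by its own blow-up, hence an effective Cartier
    divisor and in particular a closed subscheme.\<close>
  have e: "closed_immersion e"
  proof -
    have "cartier_pullback bl \<delta>" using blowup by (simp add: is_blowup_def)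
    then have "effective_cartier e" using E unfolding cartier_pullback_def by blast
    then show ?thesis by (simp add: effective_cartier_def)
  qed
  have "\<exists>h. closed_immersion h \<and> src h = src r \<and> tgt h = src u \<and> u \<circ>\<^sub>s h = r"
    if W: "cluster_family k B (p \<circ>\<^sub>s \<pi>\<^sub>1) q\<^sub>1 W p\<^sub>W q\<^sub>W \<theta>" "is_pullback \<theta> e e\<^sub>W e\<^sub>W'"
      "blowup_locus B W p\<^sub>W q\<^sub>W e\<^sub>W i\<^sub>W" "iso_locus W q\<^sub>W e\<^sub>W j\<^sub>W"
      and u: "schematic_union i\<^sub>W j\<^sub>W u" and r: "reduction r" "tgt r = src W"
    for W p\<^sub>W q\<^sub>W \<theta> e\<^sub>W e\<^sub>W' i\<^sub>W j\<^sub>W u and r :: "'a smor"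
  proof -
    have "kscheme k W" "is_pullback B W p\<^sub>W q\<^sub>W" "src \<theta> = src p\<^sub>W"
      using W(1) by (simp_all add: cluster_family_def section_family_def over_mor_def)
    from blowup_locus_iso_locus_cover[OF red this e W(2-4)]
    have "pts (tgt u) \<subseteq> pmap i\<^sub>W ` pts (src i\<^sub>W) \<union> pmap j\<^sub>W ` pts (src j\<^sub>W)" "tgt r = tgt u"
      using W(3) r(2) schematic_unionD(4)[OF u] by (simp_all add: blowup_locus_def)
    then show ?thesis using reduction_factors_through_union[OF u _ r(1)] by blast
  qed
  \<comment> \<open>The closed embedding \<open>u\<^sub>c\<close> is onto by
    \<open>union_surj\<close>, and a surjective embedding is a homeomorphism.\<close>
  moreover have "sp (src u\<^sub>c) homeomorphic_space sp (src (X\<^sub>1 \<circ>\<^sub>s c))"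
  proof -
    have X1': "kscheme k X\<^sub>1" "is_pullback B X\<^sub>1 p\<^sub>1 r\<^sub>1"
      using X1 by (simp_all add: universal_section_family_def section_family_def)
    have c': "sch_mor c" "tgt c = src X\<^sub>1"
      using c closed_immersion_sch_mor by (auto simp: const_locus_def)
    note P = pullbackD[OF pc] and P1 = pullbackD[OF X1'(2)]
    \<comment> \<open>\<open>\<psi>\<^sub>c\<close> is built from \<open>cross_mor\<close>, a
      definite description; its source is known only after the two legs are shown to agree over the
      base.\<close>
    have "id_mor (src B) \<circ>\<^sub>s p\<^sub>c = p\<^sub>c"
      using comp_id_left[OF sch_mor_is_mor[OF P(3)]] P(7) by simp
    moreover have "B \<circ>\<^sub>s p\<^sub>c = X\<^sub>1 \<circ>\<^sub>s (c \<circ>\<^sub>s q\<^sub>c)"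
      using P P1 c' sch_comp_assoc[of q\<^sub>c c X\<^sub>1] by simp
    ultimately have "src \<psi>\<^sub>c = src p\<^sub>c"
      using pair_mor(2)[OF X1'(2), of p\<^sub>c "c \<circ>\<^sub>s q\<^sub>c"] P c' unfolding \<psi>c cross_mor_def
      by (simp add: sch_mor_comp)
    moreover have "kscheme k (X\<^sub>1 \<circ>\<^sub>s c)"
      using X1'(1) c' by (simp add: kscheme_def sch_mor_comp)
    ultimately have cover: "pts (tgt u\<^sub>c) \<subseteq> pmap j ` pts (src j) \<union> pmap j\<^sub>E ` pts (src j\<^sub>E)"
      using blowup_locus_iso_locus_cover[OF red _ pc _ e Ec j jE] j schematic_unionD(4)[OF uc]
      by (simp add: blowup_locus_def)
    have "tgt u\<^sub>c = src (X\<^sub>1 \<circ>\<^sub>s c)"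
      using j schematic_unionD(4)[OF uc] by (simp add: blowup_locus_def)
    then show ?thesis
      using closed_immersion_embedding[OF schematic_unionD(3)[OF uc]] union_surj[OF uc cover]
      by (metis embedding_map_imp_homeomorphic_space subtopology_topspace)
  qed
  ultimately show ?thesis by blast
qed

end
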